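(* Every model of $\mathsf{ORCMVR}$ is weakly o-minimal, but not o-minimal.
   Context: Models of $\mathsf{ORCMVR}$ are structures $(\mathcal{O}, d, 0,1,+,-,\cdot,D, r)$ where: $\mathcal{O}$ is the valuation ring of a valued field $(K,v)$; $|\cdot|$ is an absolute value on $K$ corresponding to a valuation coarsening $v$, $d(x,y)=|x-y|$ is complete on $\mathcal{O}$, and $|\cdot|$ is nontrivial on $\mathcal{O}$; $D(x,y)=\inf_{z\in\mathcal{O}}|y-xz|$; $\le$ is a linear order on $\mathcal{O}$ such that every open $d$-ball is order-convex, $r(x,y)=\inf_{z\le y}d(x,z)$ is its ray predicate, and $\le$ extends to a field ordering of $K$ making $(K,v)$ an ordered valued field (for $x,y\ge0$, $v(x+y)=\min(v(x),v(y))$); and $K$ is real closed. A structure expanding a metric linear order (language containing $r$) is o-minimal if the interpretation of every definable predicate with parameters in one variable is strongly regulated (a uniform limit of functions in the $\mathbb{R}$-linear span of characteristic functions of intervals), and weakly o-minimal if every such interpretation is weakly regulated (a uniform limit of functions in the $\mathbb{R}$-linear span of characteristic functions of order-convex sets). *)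

theory Defs
  imports
    "HOL-Analysis.Analysis"
    "HOL-Library.Extended"
    "HOL-Library.More_List"
    "HOL-Computational_Algebra.Polynomial"
begin

section \<open>Continuous first-order logic\<close>

record ('f, 'p) signature =
  fn_arity :: "'f \<Rightarrow> nat"
  pr_arity :: "'p \<Rightarrow> nat"

record ('a, 'f, 'p) metric_structure =
  universe :: "'a set"
  metric :: "'a \<Rightarrow> 'a \<Rightarrow> real"
  fn_interp :: "'f \<Rightarrow> 'a list \<Rightarrow> 'a"
  pr_interp :: "'p \<Rightarrow> 'a list \<Rightarrow> real"

datatype ('a, 'f) trm =
    Var nat
  | Param 'a
  | Fn 'f "('a, 'f) trm list"

text \<open>
  A connective is a continuous map on \<open>\<real>\<^sup>n\<close>, \<open>n\<close> being the number of formulas it is applied to.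
  It is represented by a function on \<open>nat \<Rightarrow> real\<close>, continuous for the product topology, that is
  evaluated at the given \<open>n\<close> values padded with zeros: precomposing with this padding yields
  exactly the continuous maps \<open>\<real>\<^sup>n \<rightarrow> \<real>\<close>. Continuity is imposed in \<open>wf_fm\<close>.
\<close>

datatype ('a, 'f, 'p) fm =
    Dist "('a, 'f) trm" "('a, 'f) trm"
  | Pred 'p "('a, 'f) trm list"
  | Conn "(nat \<Rightarrow> real) \<Rightarrow> real" "('a, 'f, 'p) fm list"
  | SupQ nat "('a, 'f, 'p) fm"
  | InfQ nat "('a, 'f, 'p) fm"

fun wf_trm :: "('f, 'p) signature \<Rightarrow> 'a set \<Rightarrow> ('a, 'f) trm \<Rightarrow> bool" where
  "wf_trm L A (Var i) \<longleftrightarrow> True"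
| "wf_trm L A (Param a) \<longleftrightarrow> a \<in> A"
| "wf_trm L A (Fn f ts) \<longleftrightarrow> length ts = fn_arity L f \<and> (\<forall>t\<in>set ts. wf_trm L A t)"

fun wf_fm :: "('f, 'p) signature \<Rightarrow> 'a set \<Rightarrow> ('a, 'f, 'p) fm \<Rightarrow> bool" where
  "wf_fm L A (Dist s t) \<longleftrightarrow> wf_trm L A s \<and> wf_trm L A t"
| "wf_fm L A (Pred p ts) \<longleftrightarrow> length ts = pr_arity L p \<and> (\<forall>t\<in>set ts. wf_trm L A t)"
| "wf_fm L A (Conn u \<phi>s) \<longleftrightarrow> continuous_on UNIV u \<and> (\<forall>\<phi>\<in>set \<phi>s. wf_fm L A \<phi>)"
| "wf_fm L A (SupQ i \<phi>) \<longleftrightarrow> wf_fm L A \<phi>"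
| "wf_fm L A (InfQ i \<phi>) \<longleftrightarrow> wf_fm L A \<phi>"

fun vars_trm :: "('a, 'f) trm \<Rightarrow> nat set" where
  "vars_trm (Var i) = {i}"
| "vars_trm (Param a) = {}"
| "vars_trm (Fn f ts) = (\<Union>t\<in>set ts. vars_trm t)"

fun free_vars :: "('a, 'f, 'p) fm \<Rightarrow> nat set" where
  "free_vars (Dist s t) = vars_trm s \<union> vars_trm t"
| "free_vars (Pred p ts) = (\<Union>t\<in>set ts. vars_trm t)"
| "free_vars (Conn u \<phi>s) = (\<Union>\<phi>\<in>set \<phi>s. free_vars \<phi>)"
| "free_vars (SupQ i \<phi>) = free_vars \<phi> - {i}"
| "free_vars (InfQ i \<phi>) = free_vars \<phi> - {i}"

fun eval_trm :: "('a, 'f, 'p) metric_structure \<Rightarrow> (nat \<Rightarrow> 'a) \<Rightarrow> ('a, 'f) trm \<Rightarrow> 'a" where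
  "eval_trm M e (Var i) = e i"
| "eval_trm M e (Param a) = a"
| "eval_trm M e (Fn f ts) = fn_interp M f (map (eval_trm M e) ts)"

fun eval_fm :: "('a, 'f, 'p) metric_structure \<Rightarrow> (nat \<Rightarrow> 'a) \<Rightarrow> ('a, 'f, 'p) fm \<Rightarrow> real" where
  "eval_fm M e (Dist s t) = metric M (eval_trm M e s) (eval_trm M e t)"
| "eval_fm M e (Pred p ts) = pr_interp M p (map (eval_trm M e) ts)"
| "eval_fm M e (Conn u \<phi>s) = u (nth_default 0 (map (eval_fm M e) \<phi>s))"
| "eval_fm M e (SupQ i \<phi>) = (SUP a\<in>universe M. eval_fm M (e(i := a)) \<phi>)"
| "eval_fm M e (InfQ i \<phi>) = (INF a\<in>universe M. eval_fm M (e(i := a)) \<phi>)"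

text \<open>
  Interpretations of definable predicates in one variable, with parameters: uniform limits of
  (interpretations of) formulas whose only free variable is \<open>Var 0\<close>. Here and below only the
  values on the universe matter.
\<close>

definition definable_predicate ::
    "('f, 'p) signature \<Rightarrow> ('a, 'f, 'p) metric_structure \<Rightarrow> ('a \<Rightarrow> real) \<Rightarrow> bool" where
  "definable_predicate L M P \<longleftrightarrow>
     (\<exists>\<phi> :: nat \<Rightarrow> ('a, 'f, 'p) fm.
        (\<forall>n. wf_fm L (universe M) (\<phi> n) \<and> free_vars (\<phi> n) \<subseteq> {0}) \<and>
        uniform_limit (universe M) (\<lambda>n x. eval_fm M (\<lambda>_. x) (\<phi> n)) P sequentially)"

section \<open>Regulated functions and o-minimality\<close>

definition order_convex_in :: "'a::linorder set \<Rightarrow> 'a set \<Rightarrow> bool" where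
  "order_convex_in U C \<longleftrightarrow>
     C \<subseteq> U \<and> (\<forall>a\<in>C. \<forall>b\<in>C. \<forall>x\<in>U. a \<le> x \<and> x \<le> b \<longrightarrow> x \<in> C)"

text \<open>Intervals of \<open>U\<close> have their endpoints in \<open>U \<union> {-\<infinity>, \<infinity>}\<close>.\<close>

definition upward_rays :: "'a::linorder set \<Rightarrow> 'a set set" where
  "upward_rays U = {U} \<union> {U \<inter> {a..} |a. a \<in> U} \<union> {U \<inter> {a<..} |a. a \<in> U}"

definition downward_rays :: "'a::linorder set \<Rightarrow> 'a set set" where
  "downward_rays U = {U} \<union> {U \<inter> {..b} |b. b \<in> U} \<union> {U \<inter> {..<b} |b. b \<in> U}"

definition intervals :: "'a::linorder set \<Rightarrow> 'a set set" where
  "intervals U = {A \<inter> B |A B. A \<in> upward_rays U \<and> B \<in> downward_rays U}"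

definition char_span :: "'a set set \<Rightarrow> ('a \<Rightarrow> real) set" where
  "char_span \<C> =
     {\<lambda>x. \<Sum>A\<in>\<F>. c A * indicator A x |\<F> c. finite \<F> \<and> \<F> \<subseteq> \<C>}"

definition strongly_regulated :: "'a::linorder set \<Rightarrow> ('a \<Rightarrow> real) \<Rightarrow> bool" where
  "strongly_regulated U P \<longleftrightarrow>
     (\<exists>f. (\<forall>n. f n \<in> char_span (intervals U)) \<and> uniform_limit U f P sequentially)"

definition weakly_regulated :: "'a::linorder set \<Rightarrow> ('a \<Rightarrow> real) \<Rightarrow> bool" where
  "weakly_regulated U P \<longleftrightarrow>
     (\<exists>f. (\<forall>n. f n \<in> char_span {C. order_convex_in U C}) \<and> uniform_limit U f P sequentially)"

definition o_minimal ::
    "('f, 'p) signature \<Rightarrow> ('a::linorder, 'f, 'p) metric_structure \<Rightarrow> bool" where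
  "o_minimal L M \<longleftrightarrow>
     (\<forall>P. definable_predicate L M P \<longrightarrow> strongly_regulated (universe M) P)"

definition weakly_o_minimal ::
    "('f, 'p) signature \<Rightarrow> ('a::linorder, 'f, 'p) metric_structure \<Rightarrow> bool" where
  "weakly_o_minimal L M \<longleftrightarrow>
     (\<forall>P. definable_predicate L M P \<longrightarrow> weakly_regulated (universe M) P)"

definition ray_predicate :: "'a::linorder set \<Rightarrow> ('a \<Rightarrow> 'a \<Rightarrow> real) \<Rightarrow> 'a \<Rightarrow> 'a \<Rightarrow> real" where
  "ray_predicate U d x y = (INF z\<in>{z\<in>U. z \<le> y}. d x z)"

section \<open>Ordered valued fields\<close>

definition valuation :: "('k::field \<Rightarrow> 'g::linordered_ab_group_add extended) \<Rightarrow> bool" where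
  "valuation v \<longleftrightarrow>
     (\<forall>x. v x \<noteq> Minf) \<and>
     (\<forall>x. v x = Pinf \<longleftrightarrow> x = 0) \<and>
     (\<forall>x y. v (x * y) = v x + v y) \<and>
     (\<forall>x y. min (v x) (v y) \<le> v (x + y))"

definition val_ring :: "('k::field \<Rightarrow> 'g::linordered_ab_group_add extended) \<Rightarrow> 'k set" where
  "val_ring v = {x. 0 \<le> v x}"

definition coarsens ::
    "('k::field \<Rightarrow> 'h::linordered_ab_group_add extended) \<Rightarrow>
     ('k \<Rightarrow> 'g::linordered_ab_group_add extended) \<Rightarrow> bool" where
  "coarsens w v \<longleftrightarrow> val_ring v \<subseteq> val_ring w"

text \<open>Fixing the base \<open>exp 1\<close> loses no generality, as a real valuation can be rescaled.\<close>

definition abs_val_of :: "('k::field \<Rightarrow> real extended) \<Rightarrow> 'k \<Rightarrow> real" where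
  "abs_val_of w x = (case w x of Fin g \<Rightarrow> exp (- g) | _ \<Rightarrow> 0)"

definition ordered_valued_field ::
    "('k::linordered_field \<Rightarrow> 'g::linordered_ab_group_add extended) \<Rightarrow> bool" where
  "ordered_valued_field v \<longleftrightarrow>
     valuation v \<and> (\<forall>x y. 0 \<le> x \<and> 0 \<le> y \<longrightarrow> v (x + y) = min (v x) (v y))"

definition real_closed :: "'k::linordered_field itself \<Rightarrow> bool" where
  "real_closed _ \<longleftrightarrow>
     (\<forall>x::'k. 0 \<le> x \<longrightarrow> (\<exists>y. y ^ 2 = x)) \<and>
     (\<forall>p::'k poly. odd (degree p) \<longrightarrow> (\<exists>x. poly p x = 0))"

section \<open>Ordered real closed metric valuation rings\<close>

datatype ring_fn = Zero | One | Plus | Minus | Times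

datatype ring_pr = Divis | Ray

definition orcmvr_sig :: "(ring_fn, ring_pr) signature" where
  "orcmvr_sig =
     \<lparr>fn_arity = (\<lambda>f. case f of Zero \<Rightarrow> 0 | One \<Rightarrow> 0 | Plus \<Rightarrow> 2 | Minus \<Rightarrow> 1 | Times \<Rightarrow> 2),
      pr_arity = (\<lambda>_. 2)\<rparr>"

fun ring_fn_interp :: "ring_fn \<Rightarrow> 'k::field list \<Rightarrow> 'k" where
  "ring_fn_interp Zero [] = 0"
| "ring_fn_interp One [] = 1"
| "ring_fn_interp Plus [x, y] = x + y"
| "ring_fn_interp Minus [x] = - x"
| "ring_fn_interp Times [x, y] = x * y"
| "ring_fn_interp _ _ = undefined"

definition divis_predicate :: "'k::field set \<Rightarrow> ('k \<Rightarrow> real) \<Rightarrow> 'k \<Rightarrow> 'k \<Rightarrow> real" where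
  "divis_predicate R nrm x y = (INF z\<in>R. nrm (y - x * z))"

fun orcmvr_pr_interp ::
    "'k::linordered_field set \<Rightarrow> ('k \<Rightarrow> real) \<Rightarrow> ring_pr \<Rightarrow> 'k list \<Rightarrow> real" where
  "orcmvr_pr_interp R nrm Divis [x, y] = divis_predicate R nrm x y"
| "orcmvr_pr_interp R nrm Ray [x, y] = ray_predicate R (\<lambda>a b. nrm (a - b)) x y"
| "orcmvr_pr_interp R nrm _ _ = undefined"

definition orcmvr_structure ::
    "('k::linordered_field \<Rightarrow> 'g::linordered_ab_group_add extended) \<Rightarrow> ('k \<Rightarrow> real) \<Rightarrow>
     ('k, ring_fn, ring_pr) metric_structure" where
  "orcmvr_structure v nrm =
     \<lparr>universe = val_ring v,
      metric = (\<lambda>x y. nrm (x - y)),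
      fn_interp = ring_fn_interp,
      pr_interp = orcmvr_pr_interp (val_ring v) nrm\<rparr>"

text \<open>
  The valuation \<open>v\<close> and absolute value \<open>nrm\<close> on the field \<open>'k\<close> present \<open>orcmvr_structure v nrm\<close>
  as a model of \<open>ORCMVR\<close>. The linear order of the valuation ring is the restriction of the field
  ordering of \<open>'k\<close>.
\<close>

locale orcmvr =
  fixes v :: "'k::linordered_field \<Rightarrow> 'g::linordered_ab_group_add extended"
    and nrm :: "'k \<Rightarrow> real"
  assumes ordered_valued: "ordered_valued_field v"
    and real_closed: "real_closed TYPE('k)"
    and abs_val: "\<exists>w. valuation w \<and> coarsens w v \<and> nrm = abs_val_of w"
    and nontrivial: "\<exists>x\<in>val_ring v. x \<noteq> 0 \<and> nrm x \<noteq> 1"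
    and complete: "Metric_space.mcomplete (val_ring v) (\<lambda>x y. nrm (x - y))"
    and balls_convex: "\<And>x \<epsilon>. x \<in> val_ring v \<Longrightarrow> 0 < \<epsilon> \<Longrightarrow>
      order_convex_in (val_ring v) (Metric_space.mball (val_ring v) (\<lambda>x y. nrm (x - y)) x \<epsilon>)"

end

theory Submission
  imports Defs "HOL-Algebra.Algebraic_Closure_Type"
    "HOL-Computational_Algebra.Computational_Algebra"
begin

hide_const (open) up_ring.monom up_ring.coeff Polynomials.degree
  Polynomials.lead_coeff module.smult Coset.order

text \<open>
  Call \<open>C \<subseteq> {0<..}\<close> a scaling cut if it is downward closed and stable under doubling. The positive
  part of the valuation ring and the balls of the absolute value are scaling cuts, so up to uniform
  approximation every atomic formula is a step function whose level sets are defined by conditions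
  \<open>p / q \<in> C\<close> on polynomials. Uniform limits of such step functions are preserved by
  connectives, and they are preserved by suprema and infima as soon as the sets defined by these
  conditions are closed under projection.

  For the projection, fix the parameters. Near a root \<open>g\<close> of one of the derivatives of a
  polynomial \<open>p\<close>, and away from all other such roots, no cancellation occurs: \<open>\<bar>p (g + z)\<bar>\<close> agrees
  with the largest term of its Taylor expansion at \<open>g\<close> up to a bounded factor, which scaling cuts do
  not see. Hence the condition on \<open>z\<close> becomes a Boolean combination of cuts, which form a chain, and
  an element separating two families of cuts exists as soon as all pairs are separated. The roots
  \<open>g\<close> depend on the parameters; the functions of the parameters defining no new sets, among them
  these root functions by Cohen's induction on the degree, form an algebra over which the pairwise
  comparisons are again conditions of the same kind. For one variable the same description yields
  finite unions of convex sets.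

  O-minimality fails for the predicate \<open>D(x, 1)\<close>: it jumps at the edge of the maximal ideal, which
  is not the endpoint of an interval since the ideal is stable under doubling.
\<close>

section \<open>Polynomials over a real closed field\<close>

text \<open>The obstacle is that the roots at which a polynomial is expanded are not polynomial
  functions of the parameters. Instead of describing them by formulas, Zorn's lemma enlarges the
  algebra of parameter functions to a maximal one with the same cut sets. Stability under doubling
  comes from \<open>v (x + y) = min (v x) (v y)\<close> for nonnegative arguments, which forces
  \<open>v 2 = 0\<close>; it lets every estimate lose an integer factor. Real closedness only
  provides square roots and zeros in odd degree, so the intermediate value property is first derived
  from a factorization over K(i). Formulas are real-valued, so no exact elimination is sought: the
  supremum of a finite-valued function depends only on its set of values, and that set is found by
  projections.\<close>

lemma fps_power_sum:
  fixes a :: "'i \<Rightarrow> 'a::field"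
  assumes "finite I"
  shows "fps_deriv (\<Prod>i\<in>I. 1 - fps_const (a i) * fps_X)
    = - (\<Prod>i\<in>I. 1 - fps_const (a i) * fps_X) * Abs_fps (\<lambda>k. \<Sum>i\<in>I. a i ^ Suc k)"
  using assms
proof (induction I rule: finite_induct)
  case empty
  then show ?case by (simp add: fps_zero_def[symmetric])
next
  case (insert j I)
  let ?F = "\<Prod>i\<in>I. 1 - fps_const (a i) * fps_X"
  let ?P = "Abs_fps (\<lambda>k. \<Sum>i\<in>I. a i ^ Suc k)"
  let ?G = "Abs_fps (\<lambda>k. a j ^ Suc k)"
  have split: "Abs_fps (\<lambda>k. \<Sum>i\<in>insert j I. a i ^ Suc k) = ?G + ?P"
    using insert by (simp add: fps_eq_iff)
  \<comment> \<open>Each factor contributes the logarithmic derivative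
    \<open>- a j / (1 - a j * X)\<close>, which is minus the geometric series
    \<open>?G\<close>.\<close>
  have geo: "(1 - fps_const (a j) * fps_X) * ?G = fps_const (a j)"
  proof (rule fps_ext)
    fix n show "((1 - fps_const (a j) * fps_X) * ?G) $ n = fps_const (a j) $ n"
      by (cases n) (simp_all add: algebra_simps)
  qed
  have "fps_deriv (\<Prod>i\<in>insert j I. 1 - fps_const (a i) * fps_X)
      = (1 - fps_const (a j) * fps_X) * fps_deriv ?F - fps_const (a j) * ?F"
    using insert by (simp add: algebra_simps)
  also have "\<dots> = - ((1 - fps_const (a j) * fps_X) * ?F) * ?P - ((1 - fps_const (a j) * fps_X) * ?G) * ?F"
    by (subst insert.IH, subst geo) (simp add: algebra_simps)
  finally show ?case
    using insert by (subst split) (simp add: algebra_simps)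
qed

text \<open>Newton's identities express \<open>n\<close> times the \<open>n\<close>-th coefficient
  through earlier coefficients and power sums, and conversely. Closure under division by naturals
  lets them be solved in both directions. With \<open>S\<close> the base field, this tests whether a
  product has its coefficients there without using symmetric polynomials.\<close>

lemma newton_coeffs:
  fixes a :: "'i \<Rightarrow> 'a::field_char_0" and S :: "'a set"
  assumes fin: "finite I" and zero: "0 \<in> S" and one: "1 \<in> S"
    and add: "\<And>x y. x \<in> S \<Longrightarrow> y \<in> S \<Longrightarrow> x + y \<in> S"
    and mult: "\<And>x y. x \<in> S \<Longrightarrow> y \<in> S \<Longrightarrow> x * y \<in> S"
    and neg: "\<And>x. x \<in> S \<Longrightarrow> - x \<in> S"
    and div: "\<And>x n. x \<in> S \<Longrightarrow> x / of_nat n \<in> S"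
  shows "(\<forall>k. (\<Sum>i\<in>I. a i ^ Suc k) \<in> S) \<longleftrightarrow> (\<forall>k. coeff (\<Prod>i\<in>I. [:1, - a i:]) k \<in> S)"
proof -
  define F where "F = (\<Prod>i\<in>I. 1 - fps_const (a i) * fps_X)"
  define P where "P = (\<lambda>k. \<Sum>i\<in>I. a i ^ Suc k)"
  have FF: "fps_of_poly (\<Prod>i\<in>I. [:1, - a i:]) = F"
  proof -
    have "fps_of_poly [:1, - c:] = 1 - fps_const c * fps_X" for c :: 'a
      by (simp add: fps_of_poly_pCons fps_const_neg[symmetric] del: fps_const_neg)
    then show ?thesis unfolding F_def by (simp only: fps_of_poly_prod)
  qed
  have co: "coeff (\<Prod>i\<in>I. [:1, - a i:]) k = F $ k" for k
    by (simp add: FF[symmetric])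
  have rec: "of_nat (Suc n) * F $ Suc n = - (\<Sum>k=0..n. F $ k * P (n - k))" for n
  proof -
    have "fps_deriv F $ n = (- F * Abs_fps P) $ n"
      unfolding F_def P_def using fps_power_sum[OF fin, of a] by (simp only:)
    then show ?thesis by (simp add: fps_mult_nth sum_negf)
  qed
  have F0: "F $ 0 = 1"
    by (simp add: co[symmetric] poly_0_coeff_0[symmetric] poly_prod)
  have sumS: "(\<And>i. i \<in> A \<Longrightarrow> f i \<in> S) \<Longrightarrow> sum f A \<in> S" for f :: "nat \<Rightarrow> 'a" and A
    by (induction A rule: infinite_finite_induct) (auto intro: zero add)
  have 1: "F $ n \<in> S" if "\<forall>k. P k \<in> S" for n
  proof (induction n rule: less_induct)
    case (less n)
    show ?case
    proof (cases n)
      case 0 then show ?thesis by (simp add: F0 one)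
    next
      case (Suc m)
      have "(\<Sum>k=0..m. F $ k * P (m - k)) \<in> S"
        using less Suc that by (intro sumS mult) auto
      then have "(- (\<Sum>k=0..m. F $ k * P (m - k))) / of_nat (Suc m) \<in> S"
        by (intro div neg)
      then show ?thesis
        unfolding rec[symmetric] Suc by (simp del: of_nat_Suc)
    qed
  qed
  have 2: "P n \<in> S" if "\<forall>k. F $ k \<in> S" for n
  proof (induction n rule: less_induct)
    case (less n)
    have "(\<Sum>k=0..n. F $ k * P (n - k)) = P n + (\<Sum>k=Suc 0..n. F $ k * P (n - k))"
      by (subst sum.atLeast_Suc_atMost) (auto simp: F0)
    then have eq: "P n = - (of_nat (Suc n) * F $ Suc n) + - (\<Sum>k=Suc 0..n. F $ k * P (n - k))"
      by (simp only: rec) simp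
    have nat: "of_nat m \<in> S" for m :: nat
      by (induction m) (auto intro: zero one add)
    have "(\<Sum>k=Suc 0..n. F $ k * P (n - k)) \<in> S"
      using less that by (intro sumS mult) auto
    then show ?case
      unfolding eq using that nat[of "Suc n"] by (intro add neg mult) (auto simp del: of_nat_Suc)
  qed
  from 1 2 show ?thesis unfolding co P_def by blast
qed

text \<open>Reversing the coefficients turns \<open>1 - a X\<close> into \<open>X - a\<close>:
  Newton's identities suit the former, prescribed roots the latter.\<close>

lemma prod_linear_reflect_coeffs:
  fixes a :: "'i \<Rightarrow> 'a::field" and S :: "'a set"
  assumes fin: "finite I" and zero: "0 \<in> S"
  shows "(\<forall>k. coeff (\<Prod>i\<in>I. [:1, - a i:]) k \<in> S) \<longleftrightarrow> (\<forall>k. coeff (\<Prod>i\<in>I. [:- a i, 1:]) k \<in> S)"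
proof -
  have r: "reflect_poly [:- a i, 1:] = [:1, - a i:]" for i
    by (simp add: reflect_poly_pCons' monom_altdef)
  have "(\<Prod>i\<in>I. [:1, - a i:]) = reflect_poly (\<Prod>i\<in>I. [:- a i, 1:])"
    by (simp add: reflect_poly_prod r)
  moreover have "(\<forall>k. coeff (reflect_poly p) k \<in> S) \<longleftrightarrow> (\<forall>k. coeff p k \<in> S)" for p :: "'a poly"
  proof
    assume *: "\<forall>k. coeff (reflect_poly p) k \<in> S"
    show "\<forall>k. coeff p k \<in> S"
    proof
      fix k show "coeff p k \<in> S"
      proof (cases "k \<le> degree p")
        case True
        then have "coeff (reflect_poly p) (degree p - k) = coeff p k"
          by (auto simp: coeff_reflect_poly)
        with * show ?thesis by metis
      qed (use zero in \<open>auto simp: coeff_eq_0\<close>)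
    qed
  qed (use zero in \<open>auto simp: coeff_reflect_poly\<close>)
  ultimately show ?thesis by simp
qed

lemma range_map_poly_to_ac:
  assumes "\<And>k. coeff q k \<in> range to_ac"
  shows "\<exists>p. q = map_poly to_ac p"
proof
  show "q = map_poly to_ac (map_poly of_ac q)"
    by (rule poly_eqI) (simp add: coeff_map_poly to_ac_of_ac assms)
qed

text \<open>Squaring a power sum of the \<open>a i\<close> yields, up to the diagonal, twice a power sum of the
  products of pairs.\<close>

lemma pair_products_poly:
  fixes p :: "'a::field_char_0 poly" and a :: "nat \<Rightarrow> 'a alg_closure"
  assumes p: "map_poly to_ac p = (\<Prod>i<n. [:- a i, 1:])"
  shows "\<exists>q :: 'a poly. degree q = n * (n - 1) div 2 \<and>
    map_poly to_ac q = (\<Prod>(i, j)\<in>{(i, j). i < j \<and> j < n}. [:- (a i * a j), 1:])"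
proof -
  define I where "I = {(i, j). i < j \<and> j < n}"
  define c where "c x = a (fst x) * a (snd x)" for x
  define S where "S = range (to_ac :: 'a \<Rightarrow> 'a alg_closure)"
  have S: "0 \<in> S" "1 \<in> S" "\<And>x y. x \<in> S \<Longrightarrow> y \<in> S \<Longrightarrow> x + y \<in> S"
    "\<And>x y. x \<in> S \<Longrightarrow> y \<in> S \<Longrightarrow> x * y \<in> S" "\<And>x. x \<in> S \<Longrightarrow> - x \<in> S"
    "\<And>x m. x \<in> S \<Longrightarrow> x / of_nat m \<in> S"
    unfolding S_def
    by (metis rangeI to_ac_0) (metis rangeI to_ac_1, auto simp flip: to_ac_add to_ac_mult
        to_ac_minus to_ac_of_nat to_ac_divide)
  have finI: "finite I"
    by (rule finite_subset[of _ "{..<n} \<times> {..<n}"]) (auto simp: I_def)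
  have "coeff (\<Prod>i<n. [:- a i, 1:]) k \<in> S" for k
    by (simp add: p[symmetric] coeff_map_poly S_def)
  then have ps: "(\<Sum>i<n. a i ^ Suc k) \<in> S" for k
    using newton_coeffs[OF finite_lessThan S, of a n] prod_linear_reflect_coeffs[of "{..<n}" S a] S(1)
    by auto
  have "(\<Sum>x\<in>I. (case x of (i, j) \<Rightarrow> a i * a j) ^ Suc k) \<in> S" for k
  proof -
    define b where "b i = a i ^ Suc k" for i
    have sq: "b i * b i = a i ^ Suc (Suc (2 * k))" for i
      unfolding b_def power_add[symmetric] by (simp add: mult_2)
    define I' where "I' = {(i, j). j < i \<and> i < n}"
    define J where "J = {(i, j). i = j \<and> i < n}"
    have fin': "finite I'" "finite J"
      by (rule finite_subset[of _ "{..<n} \<times> {..<n}"]; auto simp: I'_def J_def)+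
    have "(\<Sum>i<n. b i) * (\<Sum>i<n. b i) = (\<Sum>(i, j)\<in>{..<n} \<times> {..<n}. b i * b j)"
      by (simp add: sum_product sum.cartesian_product)
    also have "{..<n} \<times> {..<n} = I \<union> (I' \<union> J)"
      by (auto simp: I_def I'_def J_def)
    also have "(\<Sum>(i, j)\<in>I \<union> (I' \<union> J). b i * b j)
        = (\<Sum>(i, j)\<in>I. b i * b j) + ((\<Sum>(i, j)\<in>I'. b i * b j) + (\<Sum>(i, j)\<in>J. b i * b j))"
      using finI fin'
      by (subst sum.union_disjoint, simp, simp, force simp: I_def I'_def J_def,
          subst sum.union_disjoint, simp, simp, force simp: I_def I'_def J_def, simp)
    also have "(\<Sum>(i, j)\<in>I'. b i * b j) = (\<Sum>(i, j)\<in>I. b i * b j)"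
      by (rule sum.reindex_bij_witness[of _ "\<lambda>(i, j). (j, i)" "\<lambda>(i, j). (j, i)"])
        (auto simp: I_def I'_def)
    also have "(\<Sum>(i, j)\<in>J. b i * b j) = (\<Sum>i<n. b i * b i)"
      by (rule sum.reindex_bij_witness[of _ "\<lambda>i. (i, i)" fst]) (auto simp: J_def)
    finally have "(\<Sum>(i, j)\<in>I. b i * b j)
        = ((\<Sum>i<n. b i) * (\<Sum>i<n. b i) + - (\<Sum>i<n. b i * b i)) / of_nat 2"
      by simp
    moreover have b1: "(\<Sum>i<n. b i) \<in> S"
      using ps[of k] by (simp add: b_def)
    moreover have b2: "(\<Sum>i<n. b i * b i) \<in> S"
      using ps[of "Suc (2 * k)"] by (simp only: sq)
    ultimately have "(\<Sum>(i, j)\<in>I. b i * b j) \<in> S"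
      using S(6)[OF S(3)[OF S(4)[OF b1 b1] S(5)[OF b2]], of 2] by (simp only:)
    then show ?thesis
      by (simp add: b_def power_mult_distrib case_prod_beta ac_simps)
  qed
  then have "\<forall>k. (\<Sum>x\<in>I. c x ^ Suc k) \<in> S"
    by (simp add: c_def case_prod_beta)
  then have "\<forall>k. coeff (\<Prod>x\<in>I. [:1, - c x:]) k \<in> S"
    using newton_coeffs[of I S c] finI S by simp
  then have "\<forall>k. coeff (\<Prod>x\<in>I. [:- c x, 1:]) k \<in> S"
    using prod_linear_reflect_coeffs[of I S c] finI S(1) by simp
  then obtain q where q: "(\<Prod>x\<in>I. [:- c x, 1:]) = map_poly to_ac q"
    using range_map_poly_to_ac[of "\<Prod>x\<in>I. [:- c x, 1:]"] unfolding S_def by blast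
  have "degree q = degree (map_poly to_ac q)"
    by (simp add: degree_map_poly)
  also have "\<dots> = (\<Sum>x\<in>I. degree [:- c x, 1:])"
    unfolding q[symmetric] by (subst degree_prod_eq_sum_degree) auto
  also have "\<dots> = card I" by simp
  also have "card I = card (SIGMA j:{..<n}. {..<j})"
    by (rule bij_betw_same_card[of "\<lambda>(i, j). (j, i)"])
      (auto simp: I_def bij_betw_def inj_on_def image_iff)
  also have "\<dots> = (\<Sum>j<n. j)"
    by simp
  also have "\<dots> = n * (n - 1) div 2"
    using Sum_Ico_nat[of 0 n] by (simp add: atLeast0LessThan)
  finally have "degree q = n * (n - 1) div 2" .
  moreover have "map_poly to_ac q = (\<Prod>(i, j)\<in>I. [:- (a i * a j), 1:])"
    by (simp add: q[symmetric] c_def case_prod_beta)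
  ultimately show ?thesis unfolding I_def by blast
qed

section \<open>Roots of real polynomials in K(i)\<close>

lemma poly_map_poly_to_ac [simp]: "poly (map_poly to_ac p) (to_ac x) = to_ac (poly p x)"
  by (induction p) (simp_all add: map_poly_pCons)

lemma map_poly_to_ac_add: "map_poly to_ac (p + q) = map_poly to_ac p + map_poly to_ac q"
  by (rule poly_eqI) (simp add: coeff_map_poly)

lemma map_poly_to_ac_mult: "map_poly to_ac (p * q) = map_poly to_ac p * map_poly to_ac q"
  by (rule poly_eqI) (simp add: coeff_map_poly coeff_mult to_ac_sum)

lemma map_poly_to_ac_pcompose:
  "map_poly to_ac (pcompose p q) = pcompose (map_poly to_ac p) (map_poly to_ac q)"
  by (induction p)
    (simp_all add: pcompose_pCons map_poly_pCons map_poly_to_ac_add map_poly_to_ac_mult)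

definition ac_i :: "'a::field alg_closure" where
  "ac_i = (SOME z. z\<^sup>2 = -1)"

lemma ac_i_mult_self: "ac_i * ac_i = -1"
proof -
  have "ac_i\<^sup>2 = (-1 :: 'a alg_closure)"
    unfolding ac_i_def by (rule someI_ex, rule nth_root_exists) (rule pos2)
  then show ?thesis by (simp add: power2_eq_square)
qed

definition gauss :: "'a::field \<Rightarrow> 'a \<Rightarrow> 'a alg_closure" where
  "gauss x y = to_ac x + ac_i * to_ac y"

lemma gauss_add: "gauss x y + gauss u w = gauss (x + u) (y + w)"
  by (simp add: gauss_def algebra_simps)

lemma gauss_diff: "gauss x y - gauss u w = gauss (x - u) (y - w)"
  by (simp add: gauss_def algebra_simps)

lemma gauss_mult: "gauss x y * gauss u w = gauss (x * u - y * w) (x * w + y * u)"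
proof -
  have "gauss x y * gauss u w
      = to_ac x * to_ac u + (ac_i * ac_i) * (to_ac y * to_ac w)
        + ac_i * (to_ac x * to_ac w + to_ac y * to_ac u)"
    by (simp add: gauss_def algebra_simps)
  then show ?thesis by (simp add: gauss_def ac_i_mult_self)
qed

lemma gauss_divide: "gauss x y / to_ac r = gauss (x / r) (y / r)"
  by (simp add: gauss_def add_divide_distrib)

lemma to_ac_eq_gauss: "to_ac x = gauss x 0"
  by (simp add: gauss_def)

lemma real_closed_sqrt:
  assumes "real_closed TYPE('k::linordered_field)" and "0 \<le> (x::'k)"
  obtains y where "0 \<le> y" "y\<^sup>2 = x"
proof -
  from assms obtain y where "y\<^sup>2 = x" unfolding real_closed_def by blast
  then show ?thesis by (intro that[of "\<bar>y\<bar>"]) auto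
qed

text \<open>The half-angle formulas: with \<open>r\<close> the modulus, the parts of a root are
  square roots of \<open>(r + x) / 2\<close> and \<open>(r - x) / 2\<close>, and the sign of
  \<open>y\<close> decides their relative sign.\<close>

lemma gauss_sqrt:
  assumes rc: "real_closed TYPE('k::linordered_field)"
  shows "\<exists>u w. (gauss u w)\<^sup>2 = gauss (x::'k) y"
proof -
  obtain r where r: "0 \<le> r" "r\<^sup>2 = x\<^sup>2 + y\<^sup>2"
    using real_closed_sqrt[OF rc, of "x\<^sup>2 + y\<^sup>2"] by auto
  have "\<bar>x\<bar> \<le> r"
    by (rule power2_le_imp_le) (use r in auto)
  then have "0 \<le> (r + x) / 2" "0 \<le> (r - x) / 2" by auto
  then obtain s t where st: "0 \<le> s" "s\<^sup>2 = (r + x) / 2" "0 \<le> t" "t\<^sup>2 = (r - x) / 2"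
    using real_closed_sqrt[OF rc] by metis
  have "(2 * s * t)\<^sup>2 = 4 * s\<^sup>2 * t\<^sup>2"
    by (simp add: power_mult_distrib)
  also have "\<dots> = r\<^sup>2 - x\<^sup>2"
    by (simp add: st) (simp add: power2_eq_square field_simps)
  finally have "(2 * s * t)\<^sup>2 = y\<^sup>2" using r by simp
  then have *: "2 * s * t = \<bar>y\<bar>"
    using st by (intro power2_eq_imp_eq[of "2 * s * t"]) auto
  have sq: "s * s - t * t = x"
    using st by (simp add: power2_eq_square[symmetric] field_simps)
  show ?thesis
  proof (cases "0 \<le> y")
    case True
    then have "(gauss s t)\<^sup>2 = gauss x y"
      using * sq by (simp add: power2_eq_square gauss_mult algebra_simps)
    then show ?thesis by blast
  next
    case False
    then have "(gauss s (- t))\<^sup>2 = gauss x y"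
      using * sq by (simp add: power2_eq_square gauss_mult algebra_simps)
    then show ?thesis by blast
  qed
qed

text \<open>Laplace's argument, by induction on the power of 2 dividing the degree; exponent 0 is
  the case of odd degree. Otherwise the products of pairs of roots are the roots of a polynomial of
  degree \<open>n * (n - 1) div 2\<close>, which contains one factor 2 less. One product in K(i)
  does not determine the two roots, which is why all integer shifts of the roots are
  considered.\<close>

lemma real_closed_root_gauss:
  fixes p :: "'k::linordered_field poly"
  assumes rc: "real_closed TYPE('k)" and deg: "degree p > 0"
  shows "\<exists>x y. poly (map_poly to_ac p) (gauss x y) = 0"
proof -
  obtain e m where "degree p = 2 ^ e * m" "odd m"
  proof -
    have "\<exists>e m. n = 2 ^ e * m \<and> odd m" if "n > 0" for n :: nat
      using that
    proof (induction n rule: less_induct)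
      case (less n)
      show ?case
      proof (cases "even n")
        case True
        then obtain k where k: "n = 2 * k" ..
        then have "k < n" "k > 0" using less.prems by auto
        then obtain e m where "k = 2 ^ e * m" "odd m" using less.IH by blast
        with k have "n = 2 ^ Suc e * m" by simp
        with \<open>odd m\<close> show ?thesis by blast
      next
        case False
        then have "n = 2 ^ 0 * n" by simp
        with False show ?thesis by blast
      qed
    qed
    with deg that show ?thesis by blast
  qed
  then show ?thesis
  proof (induction e arbitrary: m p)
    case 0
    then have "odd (degree p)" by simp
    with rc obtain x where "poly p x = 0" unfolding real_closed_def by blast
    then have "poly (map_poly to_ac p) (gauss x 0) = 0"
      by (simp add: to_ac_eq_gauss[symmetric])
    then show ?case by blast
  next
    case (Suc e)
    define n where "n = degree p"
    have n: "n = 2 * (2 ^ e * m)" using Suc.prems by (simp add: n_def)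
    have npos: "n > 0" using Suc.prems by (auto simp: n_def intro: odd_pos)
    have p0: "p \<noteq> 0" using npos by (auto simp: n_def)
    define r where "r = smult (1 / lead_coeff p) p"
    have r: "map_poly to_ac r = smult (1 / to_ac (lead_coeff p)) (map_poly to_ac p)"
      by (rule poly_eqI) (simp add: r_def coeff_map_poly)
    have d: "degree (map_poly to_ac p) = n"
      by (simp add: degree_map_poly n_def)
    have "map_poly to_ac p \<noteq> 0" using d npos by auto
    from alg_closed_imp_factorization[OF this] d
    obtain A where A: "size A = n"
      "map_poly to_ac p = smult (lead_coeff (map_poly to_ac p)) (\<Prod>x\<in>#A. [:-x, 1:])" by auto
    obtain xs where xs: "mset xs = A" using ex_mset by blast
    define a where "a = nth xs"
    have len: "length xs = n" using A(1) xs by (metis size_mset)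
    have prodA: "(\<Prod>x\<in>#A. [:-x, 1:]) = (\<Prod>i<n. [:- a i, 1:])"
      unfolding xs[symmetric] a_def
      by (simp add: prod_mset_prod_list prod.list_conv_set_nth len atLeast0LessThan flip: mset_map)
    have lc: "lead_coeff (map_poly to_ac p) = to_ac (lead_coeff p)"
      by (simp add: coeff_map_poly d n_def)
    have rp: "map_poly to_ac r = (\<Prod>i<n. [:- a i, 1:])"
      unfolding r by (subst A(2), subst lc) (use p0 prodA in auto)
    have pz: "poly (map_poly to_ac p) z = 0" if "z \<in> a ` {..<n}" for z
      using that by (subst A(2)) (auto simp: prodA poly_prod)
    \<comment> \<open>Composing with \<open>X - c\<close> adds \<open>c\<close> to every root, so
      for each \<open>c\<close> the induction hypothesis yields a pair whose shifted product lies in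
      K(i).\<close>
    have ex: "\<exists>i j. i < j \<and> j < n \<and> (\<exists>x y. (a i + of_nat c) * (a j + of_nat c) = gauss x y)" for c :: nat
    proof -
      have "map_poly to_ac (pcompose r [:- of_nat c, 1:]) = (\<Prod>i<n. [:- (a i + of_nat c), 1:])"
        by (simp add: map_poly_to_ac_pcompose rp pcompose_prod pcompose_pCons map_poly_pCons algebra_simps)
      from pair_products_poly[OF this] obtain q :: "'k poly" where
        q: "degree q = n * (n - 1) div 2" "map_poly to_ac q = (\<Prod>(i, j)\<in>{(i, j). i < j \<and> j < n}.
          [:- ((a i + of_nat c) * (a j + of_nat c)), 1:])" by blast
      have "degree q = 2 ^ e * (m * (n - 1))" by (simp add: q(1)) (simp add: n)
      moreover have "odd (m * (n - 1))" using Suc.prems npos n by simp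
      ultimately obtain x y where "poly (map_poly to_ac q) (gauss x y) = 0"
        using Suc.IH by blast
      moreover have "finite {(i, j). i < j \<and> j < n}"
        by (rule finite_subset[of _ "{..<n} \<times> {..<n}"]) auto
      ultimately show ?thesis
        by (auto simp: q(2) poly_prod prod_zero_iff split_beta) metis
    qed
    then obtain f g where fg: "\<And>c. f c < g c \<and> g c < n \<and>
        (\<exists>x y. (a (f c) + of_nat c) * (a (g c) + of_nat c) = gauss x y)"
      by metis
    \<comment> \<open>There are finitely many pairs but infinitely many shifts, so two shifts share
      a pair.\<close>
    have "finite (range (\<lambda>c. (f c, g c)))"
      by (rule finite_subset[of _ "{..<n} \<times> {..<n}"]) (use fg in \<open>auto intro: less_trans\<close>)
    then have "\<not> inj (\<lambda>c::nat. (f c, g c))"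
      using finite_imageD infinite_UNIV_nat by blast
    then obtain c c' where cc: "c \<noteq> c'" "f c = f c'" "g c = g c'"
      by (auto simp: inj_on_def)
    define u w where "u = a (f c)" and "w = a (g c)"
    obtain x y where xy: "(u + of_nat c) * (w + of_nat c) = gauss x y"
      using fg[of c] by (auto simp: u_def w_def)
    obtain x' y' where xy': "(u + of_nat c') * (w + of_nat c') = gauss x' y'"
      using fg[of c'] cc by (auto simp: u_def w_def)
    define k :: 'k where "k = of_nat c - of_nat c'"
    have k0: "to_ac k \<noteq> 0" using cc by (simp add: k_def)
    \<comment> \<open>Subtracting the two products eliminates \<open>u * w\<close> and leaves a
      multiple of \<open>u + w\<close> plus a constant of the base field.\<close>
    have "to_ac k * (u + w) = gauss x y - gauss x' y' - to_ac (of_nat c ^ 2 - of_nat c' ^ 2)"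
      unfolding xy[symmetric] xy'[symmetric] by (simp add: k_def algebra_simps power2_eq_square)
    then have "u + w = (gauss x y - gauss x' y' - to_ac (of_nat c ^ 2 - of_nat c' ^ 2)) / to_ac k"
      using k0 by (simp add: field_simps)
    then obtain s1 s2 where s: "u + w = gauss s1 s2"
      by (simp only: to_ac_eq_gauss[of "_ - _"] gauss_diff gauss_divide)
    have "u * w = gauss x y - to_ac (of_nat c) * (u + w) - to_ac (of_nat c ^ 2)"
      unfolding xy[symmetric] by (simp add: algebra_simps power2_eq_square)
    then obtain t1 t2 where t: "u * w = gauss t1 t2"
      by (simp only: s to_ac_eq_gauss gauss_mult gauss_diff)
    \<comment> \<open>The left side is the square of \<open>u - w\<close>, the discriminant of the
      quadratic with roots \<open>u\<close> and \<open>w\<close>. Its square root in K(i) gives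
      \<open>u\<close>.\<close>
    have "(2 * u - (u + w))\<^sup>2 = (u + w) * (u + w) - to_ac 4 * (u * w)"
      by (simp add: algebra_simps power2_eq_square)
    then obtain d1 d2 where dd: "(2 * u - (u + w))\<^sup>2 = gauss d1 d2"
      by (simp only: s t to_ac_eq_gauss gauss_mult gauss_diff)
    obtain h1 h2 where h: "(gauss h1 h2)\<^sup>2 = gauss d1 d2" using gauss_sqrt[OF rc] by blast
    then have "2 * u - (u + w) = gauss h1 h2 \<or> 2 * u - (u + w) = - gauss h1 h2"
      using dd by (metis power2_eq_iff)
    moreover have "- gauss h1 h2 = gauss (- h1) (- h2)" by (simp add: gauss_def)
    ultimately obtain k1 k2 where "2 * u - (u + w) = gauss k1 k2" by metis
    then have "u = (gauss k1 k2 + gauss s1 s2) / to_ac 2"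
      unfolding s[symmetric] by (simp add: field_simps)
    then obtain l1 l2 where "u = gauss l1 l2"
      by (simp only: gauss_add gauss_divide)
    moreover have "poly (map_poly to_ac p) u = 0"
      using fg[of c] by (intro pz) (auto simp: u_def)
    ultimately show ?case by blast
  qed
qed

section \<open>Signs, zeros and mean values of polynomials over a real closed field\<close>

lemma gauss_eq_0_iff: "gauss x y = 0 \<longleftrightarrow> x = 0 \<and> y = (0::'k::linordered_field)"
proof
  assume "gauss x y = 0"
  then have "gauss x y * gauss x (- y) = 0" by simp
  then have "to_ac (x * x + y * y) = 0"
    unfolding gauss_mult by (simp add: gauss_def del: to_ac_add to_ac_mult)
  then show "x = 0 \<and> y = 0" by (simp only: to_ac_eq_0_iff sum_squares_eq_zero_iff)
qed (simp add: gauss_def)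

text \<open>Division by the minimal polynomial of a root \<open>a + i b\<close> with
  \<open>b\<close> nonzero leaves a remainder of degree below 2. Its imaginary part at that root is
  \<open>b * r1\<close>, so the remainder vanishes.\<close>

lemma real_closed_poly_factor:
  fixes p :: "'k::linordered_field poly"
  assumes rc: "real_closed TYPE('k)" and deg: "degree p > 0"
  shows "\<exists>a q. p = [:- a, 1:] * q \<or> (\<exists>b. b \<noteq> 0 \<and> p = [:a\<^sup>2 + b\<^sup>2, - 2 * a, 1:] * q)"
proof -
  obtain a b where ab: "poly (map_poly to_ac p) (gauss a b) = 0"
    using real_closed_root_gauss[OF rc deg] by blast
  show ?thesis
  proof (cases "b = 0")
    case True
    then have "poly p a = 0" using ab by (simp add: to_ac_eq_gauss[symmetric])
    then show ?thesis by (auto simp: poly_eq_0_iff_dvd dvd_def)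
  next
    case False
    define d where "d = [:a\<^sup>2 + b\<^sup>2, - 2 * a, 1:]"
    define r where "r = p mod d"
    have "degree r < 2"
      using degree_mod_less[of d p] by (auto simp: d_def r_def)
    then have "r = [:coeff r 0, coeff r 1:]"
      by (intro poly_eqI) (auto simp: coeff_pCons coeff_eq_0 split: nat.split)
    then obtain r0 r1 where r01: "r = [:r0, r1:]" by metis
    have p: "p = d * (p div d) + r" by (simp add: r_def)
    have d0: "poly (map_poly to_ac d) (gauss a b) = 0"
    proof -
      have "poly (map_poly to_ac d) (gauss a b)
          = gauss (a\<^sup>2 + b\<^sup>2) 0 + gauss a b * (gauss (- 2 * a) 0 + gauss a b)"
        by (simp add: d_def map_poly_pCons to_ac_eq_gauss[symmetric])
      also have "\<dots> = gauss 0 0"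
        by (simp add: gauss_add gauss_mult power2_eq_square algebra_simps)
      finally show ?thesis by (simp add: gauss_def)
    qed
    have "poly (map_poly to_ac r) (gauss a b) = 0"
      using ab by (subst (asm) p) (simp add: map_poly_to_ac_add map_poly_to_ac_mult d0)
    moreover have "poly (map_poly to_ac r) (gauss a b) = gauss (r0 + a * r1) (b * r1)"
      by (simp add: r01 map_poly_pCons gauss_def algebra_simps)
    ultimately have "r = 0" using False by (auto simp: gauss_eq_0_iff r01)
    then show ?thesis using False p unfolding d_def by auto
  qed
qed

text \<open>Factors are split off one at a time. A linear factor has its root outside the interval
  and keeps its sign there; a quadratic one is \<open>(z - a)\<^sup>2 + b\<^sup>2\<close>, positive
  everywhere.\<close>

lemma real_closed_poly_same_sign:
  fixes p :: "'k::linordered_field poly"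
  assumes rc: "real_closed TYPE('k)" and "x \<le> y" and "\<And>z. x \<le> z \<Longrightarrow> z \<le> y \<Longrightarrow> poly p z \<noteq> 0"
  shows "0 < poly p x * poly p y"
  using assms(3)
proof (induction "degree p" arbitrary: p rule: less_induct)
  case less
  show ?case
  proof (cases "degree p = 0")
    case True
    then obtain c where c: "p = [:c:]" by (rule degree_eq_zeroE)
    then have "c \<noteq> 0" using less.prems[of x] \<open>x \<le> y\<close> by simp
    then have "c < 0 \<or> 0 < c" by linarith
    then have "0 < c * c" using mult_pos_pos[of c c] mult_neg_neg[of c c] by blast
    then show ?thesis by (simp add: c)
  next
    case False
    then have "degree p > 0" by simp
    from real_closed_poly_factor[OF rc this] obtain a q
      where aq: "p = [:- a, 1:] * q \<or> (\<exists>b. b \<noteq> 0 \<and> p = [:a\<^sup>2 + b\<^sup>2, - 2 * a, 1:] * q)"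
      by (elim exE)
    have p0: "p \<noteq> 0" using False by auto
    have "\<exists>d. p = d * q \<and> degree d > 0 \<and> 0 < poly d x * poly d y"
      using aq
    proof (elim disjE exE conjE)
      assume p: "p = [:- a, 1:] * q"
      then have "\<not> (x \<le> a \<and> a \<le> y)" using less.prems[of a] by auto
      then have "0 < (x - a) * (y - a)"
        using \<open>x \<le> y\<close> by (auto simp: zero_less_mult_iff)
      with p show ?thesis by (intro exI[of _ "[:- a, 1:]"]) auto
    next
      fix b assume b: "b \<noteq> 0" "p = [:a\<^sup>2 + b\<^sup>2, - 2 * a, 1:] * q"
      have "poly [:a\<^sup>2 + b\<^sup>2, - 2 * a, 1:] z = (z - a)\<^sup>2 + b\<^sup>2" for z
        by (simp add: power2_eq_square algebra_simps)
      then have "0 < poly [:a\<^sup>2 + b\<^sup>2, - 2 * a, 1:] z" for z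
        using b(1) by (simp only: sum_power2_gt_zero_iff) auto
      with b(2) show ?thesis
        by (intro exI[of _ "[:a\<^sup>2 + b\<^sup>2, - 2 * a, 1:]"]) (auto intro!: mult_pos_pos simp del: poly_pCons)
    qed
    then obtain d where d: "p = d * q" "degree d > 0" "0 < poly d x * poly d y" by blast
    have "degree q < degree p" using d p0 by (auto simp: degree_mult_eq)
    moreover have "poly q z \<noteq> 0" if "x \<le> z" "z \<le> y" for z
      using less.prems[OF that] d(1) by auto
    ultimately have "0 < poly q x * poly q y" by (rule less.hyps)
    with d(3) have "0 < (poly d x * poly d y) * (poly q x * poly q y)" by (rule mult_pos_pos)
    then show ?thesis by (simp add: d(1) ac_simps)
  qed
qed

lemma real_closed_poly_IVT:
  fixes p :: "'k::linordered_field poly"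
  assumes rc: "real_closed TYPE('k)" and "x \<le> y" and "poly p x * poly p y \<le> 0"
  obtains z where "x \<le> z" "z \<le> y" "poly p z = 0"
  using real_closed_poly_same_sign[OF rc assms(2), of p] assms(3) by (meson not_less)

text \<open>Take the next root \<open>d\<close> of \<open>p\<close> after \<open>a\<close> and split
  off both roots with their multiplicities. The cofactor \<open>g\<close> has constant sign from
  \<open>a\<close> to \<open>d\<close>, which makes the cofactor \<open>H\<close> of the derivative
  take opposite signs at \<open>a\<close> and \<open>d\<close>.\<close>

lemma real_closed_poly_Rolle:
  fixes p :: "'k::linordered_field poly"
  assumes rc: "real_closed TYPE('k)" and "a < b" and "poly p a = 0" "poly p b = 0" and "p \<noteq> 0"
  obtains c where "a < c" "c < b" "poly (pderiv p) c = 0"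
proof -
  define T where "T = {z. poly p z = 0 \<and> a < z}"
  have T: "finite T" "b \<in> T"
    using poly_roots_finite[OF \<open>p \<noteq> 0\<close>] assms by (auto simp: T_def)
  define d where "d = Min T"
  have d: "d \<in> T" using T unfolding d_def by (intro Min_in) auto
  then have ad: "a < d" "poly p d = 0" by (auto simp: T_def)
  have db: "d \<le> b" using T by (simp add: d_def)
  have nr: "poly p z \<noteq> 0" if "a < z" "z < d" for z
    using Min_le[OF T(1), of z] that unfolding T_def d_def by force
  from order_decomp[OF \<open>p \<noteq> 0\<close>, of a] obtain q where
    q: "p = [:- a, 1:] ^ order a p * q" "\<not> [:- a, 1:] dvd q" by blast
  have oa: "order a p \<noteq> 0" using assms by (simp add: order_root)
  have q0: "q \<noteq> 0" using q by auto
  have "poly ([:- a, 1:] ^ order a p * q) d = 0" using ad q(1) by simp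
  then have "poly q d = 0" using ad(1) by simp
  from order_decomp[OF q0, of d] obtain g where
    g: "q = [:- d, 1:] ^ order d q * g" "\<not> [:- d, 1:] dvd g" by blast
  have ob: "order d q \<noteq> 0" using \<open>poly q d = 0\<close> q0 by (simp add: order_root)
  obtain m n where mn: "order a p = Suc m" "order d q = Suc n"
    using oa ob not0_implies_Suc by metis
  define A B where "A = [:- a, 1:]" and "B = [:- d, 1:]"
  have peq: "p = A ^ Suc m * (B ^ Suc n * g)"
    using q(1) g(1) mn by (simp add: A_def B_def)
  have ga: "poly g a \<noteq> 0"
  proof
    assume "poly g a = 0"
    then have "poly q a = 0" by (subst g(1)) simp
    with q(2) show False by (simp add: poly_eq_0_iff_dvd)
  qed
  have gd: "poly g d \<noteq> 0" using g(2) by (simp add: poly_eq_0_iff_dvd)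
  have gsign: "0 < poly g a * poly g d"
  proof (rule real_closed_poly_same_sign[OF rc])
    fix z assume "a \<le> z" "z \<le> d"
    then consider "z = a" | "z = d" | "a < z" "z < d" by force
    then show "poly g z \<noteq> 0"
      using ga gd nr[of z] by cases (auto simp: peq)
  qed (use ad in simp)
  define H where "H = smult (of_nat (Suc m)) (B * g) + smult (of_nat (Suc n)) (A * g) + A * B * pderiv g"
  have pd: "pderiv p = A ^ m * B ^ n * H"
  proof -
    have "pderiv A = 1" "pderiv B = 1" by (simp_all add: A_def B_def pderiv_pCons)
    then have "pderiv p = A ^ Suc m * (B ^ Suc n * pderiv g + g * smult (of_nat (Suc n)) (B ^ n))
        + B ^ Suc n * g * smult (of_nat (Suc m)) (A ^ m)"
      unfolding peq by (simp only: pderiv_mult pderiv_power_Suc mult_1_right)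
    then show ?thesis
      unfolding H_def by (simp add: algebra_simps smult_add_right del: of_nat_Suc)
  qed
  have Ha: "poly H a = of_nat (Suc m) * (a - d) * poly g a"
    by (simp add: H_def A_def B_def algebra_simps)
  have Hd: "poly H d = of_nat (Suc n) * (d - a) * poly g d"
    by (simp add: H_def A_def B_def algebra_simps)
  have "poly H a * poly H d = - ((of_nat (Suc m) * of_nat (Suc n)) * ((d - a) * (d - a)) * (poly g a * poly g d))"
    by (simp add: Ha Hd algebra_simps del: of_nat_Suc)
  also have "\<dots> < 0"
    unfolding neg_less_0_iff_less
    by (rule mult_pos_pos[OF mult_pos_pos gsign]) (use ad in \<open>auto simp del: of_nat_Suc\<close>)
  finally have neg: "poly H a * poly H d < 0" .
  then obtain c where c: "a \<le> c" "c \<le> d" "poly H c = 0"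
    using real_closed_poly_IVT[OF rc, of a d H] ad by (metis less_imp_le)
  have "c \<noteq> a" "c \<noteq> d" using neg c by auto
  then show ?thesis using that[of c] c db pd by auto
qed

lemma real_closed_poly_MVT:
  fixes p :: "'k::linordered_field poly"
  assumes rc: "real_closed TYPE('k)" and "a < b"
  obtains c where "a < c" "c < b" "poly p b - poly p a = (b - a) * poly (pderiv p) c"
proof -
  define s where "s = (poly p b - poly p a) / (b - a)"
  define q where "q = p - [:poly p a - s * a, s:]"
  have q: "poly q a = 0" "poly q b = 0"
  proof -
    have "s * (b - a) = poly p b - poly p a" using \<open>a < b\<close> by (simp add: s_def)
    then show "poly q a = 0" "poly q b = 0"
      by (simp_all add: q_def algebra_simps)
  qed
  have dq: "pderiv q = pderiv p - [:s:]"
    by (simp add: q_def pderiv_diff pderiv_pCons)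
  have "\<exists>c. a < c \<and> c < b \<and> poly (pderiv q) c = 0"
  proof (cases "q = 0")
    case True
    \<comment> \<open>Here \<open>p\<close> coincides with its secant line, and any point in between
      serves.\<close>
    then show ?thesis using dense[OF \<open>a < b\<close>] by auto
  next
    case False
    show ?thesis by (rule real_closed_poly_Rolle[OF rc \<open>a < b\<close> q False]) blast
  qed
  then obtain c where "a < c" "c < b" "poly (pderiv p) c = s" by (auto simp: dq)
  then show ?thesis using that \<open>a < b\<close> by (auto simp: s_def)
qed

section \<open>Polynomials without critical points nearby\<close>

lemma pderiv_funpow_pcompose_linear:
  fixes p :: "'a::field_char_0 poly"
  shows "(pderiv ^^ k) (pcompose p [:a, b:]) = smult (b ^ k) (pcompose ((pderiv ^^ k) p) [:a, b:])"
  by (induction k)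
    (simp_all add: pderiv_smult pderiv_pcompose pderiv_pCons mult.commute)

lemma poly_eq_sum_upto:
  fixes p :: "'a::comm_semiring_1 poly"
  assumes "degree p \<le> n"
  shows "poly p x = (\<Sum>k\<le>n. coeff p k * x ^ k)"
  unfolding poly_altdef using assms
  by (intro sum.mono_neutral_left) (auto simp: coeff_eq_0)

text \<open>A crude Lipschitz bound at 1; all that matters is that the constant depends on
  \<open>k\<close> alone.\<close>

lemma abs_power_diff_one_le:
  fixes t :: "'k::linordered_field"
  assumes "0 \<le> t" "t \<le> 2"
  shows "\<bar>t ^ k - 1\<bar> \<le> of_nat (k * 2 ^ k) * \<bar>t - 1\<bar>"
proof (induction k)
  case (Suc k)
  have "t ^ Suc k - 1 = t * (t ^ k - 1) + (t - 1)" by (simp add: algebra_simps)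
  then have "\<bar>t ^ Suc k - 1\<bar> \<le> \<bar>t * (t ^ k - 1)\<bar> + \<bar>t - 1\<bar>" by (metis abs_triangle_ineq)
  moreover have "\<bar>t * (t ^ k - 1)\<bar> \<le> 2 * (of_nat (k * 2 ^ k) * \<bar>t - 1\<bar>)"
    unfolding abs_mult using assms Suc.IH by (intro mult_mono) auto
  moreover have "\<bar>t - 1\<bar> \<le> of_nat (2 ^ Suc k) * \<bar>t - 1\<bar>"
    using mult_right_mono[of 1 "of_nat (2 ^ Suc k)" "\<bar>t - 1\<bar>"]
    by (simp del: power_Suc add: one_le_power)
  moreover have "of_nat (Suc k * 2 ^ Suc k) * \<bar>t - 1\<bar>
      = 2 * (of_nat (k * 2 ^ k) * \<bar>t - 1\<bar>) + of_nat (2 ^ Suc k) * \<bar>t - 1\<bar>"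
    by (simp add: algebra_simps)
  ultimately show ?case by linarith
qed simp

text \<open>To be applied with \<open>y\<close> a neighbouring value of a polynomial: if passing
  from \<open>y\<close> to \<open>x\<close> leads away from 0 without a change of sign, then the
  increment bounds the size of \<open>x\<close> from below.\<close>

lemma same_sign_increment:
  fixes x y e d :: "'k::linordered_field"
  assumes "0 < x * y" "x - y = e" "\<bar>e\<bar> = d" "0 < x * e"
  shows "d \<le> \<bar>x\<bar>"
  using assms by (auto simp: zero_less_mult_iff)

text \<open>A polynomial none of whose derivatives vanishes on \<open>(0, 2)\<close> cannot exhibit cancellation at
  the midpoint. The slope is nearly constant near \<open>1\<close> by induction, and if \<open>q\<close> were much smaller
  than its slope, it would change sign nearby.\<close>

lemma coeff_sum_le_at_1:
  assumes rc: "real_closed TYPE('k::linordered_field)"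
  shows "\<exists>m. \<forall>q :: 'k poly. degree q \<le> n \<longrightarrow>
    (\<forall>k z. 0 < z \<and> z < 2 \<and> (pderiv ^^ k) q \<noteq> 0 \<longrightarrow> poly ((pderiv ^^ k) q) z \<noteq> 0) \<longrightarrow>
    (\<Sum>k\<le>n. \<bar>coeff q k\<bar>) \<le> of_nat m * \<bar>poly q 1\<bar>"
proof (induction n)
  case 0
  show ?case
  proof (intro exI[of _ 1] allI impI)
    fix q :: "'k poly" assume "degree q \<le> 0"
    then have "degree q = 0" by simp
    then obtain c where "q = [:c:]" by (rule degree_eq_zeroE)
    then show "(\<Sum>k\<le>0. \<bar>coeff q k\<bar>) \<le> of_nat 1 * \<bar>poly q 1\<bar>" by simp
  qed
next
  case (Suc n)
  then obtain m where m: "\<And>q :: 'k poly. degree q \<le> n \<Longrightarrow>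
    (\<forall>k z. 0 < z \<and> z < 2 \<and> (pderiv ^^ k) q \<noteq> 0 \<longrightarrow> poly ((pderiv ^^ k) q) z \<noteq> 0) \<Longrightarrow>
    (\<Sum>k\<le>n. \<bar>coeff q k\<bar>) \<le> of_nat m * \<bar>poly q 1\<bar>" by auto
  \<comment> \<open>\<open>B\<close> bounds the constants of \<open>abs_power_diff_one_le\<close>
    for all \<open>k \<le> n\<close>. \<open>M\<close> is chosen such that
    \<open>m * B / M \<le> 1 / 2\<close>: over a step of \<open>1 / M\<close> the slope changes by
    at most half of its size.\<close>
  define B where "B = n * 2 ^ n"
  define M where "M = 2 * (B + 1) * (m + 1)"
  show ?case
  \<comment> \<open>The constant comes from the final bound
    \<open>\<bar>poly q 1\<bar> + 2 * S\<close> together with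
    \<open>S \<le> m * (2 * M * \<bar>poly q 1\<bar>)\<close>.\<close>
  proof (intro exI[of _ "1 + 4 * m * M"] allI impI)
    fix q :: "'k poly"
    assume deg: "degree q \<le> Suc n"
      and nz: "\<forall>k z. 0 < z \<and> z < 2 \<and> (pderiv ^^ k) q \<noteq> 0 \<longrightarrow> poly ((pderiv ^^ k) q) z \<noteq> 0"
    define r where "r = pderiv q"
    define S where "S = (\<Sum>k\<le>n. \<bar>coeff r k\<bar>)"
    have degr: "degree r \<le> n" using deg by (simp add: r_def degree_pderiv)
    have S: "S \<le> of_nat m * \<bar>poly r 1\<bar>"
      unfolding S_def
    proof (rule m[OF degr], intro allI impI)
      fix k and z :: 'k assume "0 < z \<and> z < 2 \<and> (pderiv ^^ k) r \<noteq> 0"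
      then show "poly ((pderiv ^^ k) r) z \<noteq> 0"
        using nz[rule_format, of z "Suc k"] by (simp add: r_def funpow_swap1)
    qed
    have S0: "0 \<le> S" unfolding S_def by (rule sum_nonneg) simp
    have slope: "\<bar>poly r 1\<bar> \<le> of_nat (2 * M) * \<bar>poly q 1\<bar>"
    proof (cases "poly r 1 = 0")
      case False
      define e :: 'k where "e = 1 / of_nat M"
      have M1: "2 \<le> M" unfolding M_def by simp
      then have e: "0 < e" "e \<le> 1 / 2"
        by (auto simp: e_def field_simps)
      have q0: "q \<noteq> 0" using False by (auto simp: r_def)
      have near: "\<bar>poly r t - poly r 1\<bar> \<le> \<bar>poly r 1\<bar> / 2" if t: "\<bar>t - 1\<bar> \<le> e" for t
      proof -
        have t02: "0 \<le> t" "t \<le> 2" using t e by (auto simp: abs_le_iff)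
        have "poly r t - poly r 1 = (\<Sum>k\<le>n. coeff r k * (t ^ k - 1))"
          by (simp add: poly_eq_sum_upto[OF degr] algebra_simps sum_subtractf)
        also have "\<bar>\<dots>\<bar> \<le> (\<Sum>k\<le>n. \<bar>coeff r k\<bar> * (of_nat B * \<bar>t - 1\<bar>))"
        proof (rule order_trans[OF sum_abs sum_mono])
          fix k assume k: "k \<in> {..n}"
          have "k * 2 ^ k \<le> B" using k by (auto simp: B_def intro!: mult_mono power_increasing)
          then have "of_nat (k * 2 ^ k) * \<bar>t - 1\<bar> \<le> of_nat B * \<bar>t - 1\<bar>"
            by (intro mult_right_mono of_nat_mono) auto
          with abs_power_diff_one_le[OF t02, of k] show
            "\<bar>coeff r k * (t ^ k - 1)\<bar> \<le> \<bar>coeff r k\<bar> * (of_nat B * \<bar>t - 1\<bar>)"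
            unfolding abs_mult by (intro mult_left_mono) auto
        qed
        also have "\<dots> = S * (of_nat B * \<bar>t - 1\<bar>)" by (simp add: S_def sum_distrib_right)
        also have "\<dots> \<le> (of_nat m * \<bar>poly r 1\<bar>) * (of_nat B * e)"
          using S S0 t by (intro mult_mono) auto
        also have "\<dots> = \<bar>poly r 1\<bar> * (of_nat (m * B) / of_nat M)"
          by (simp add: e_def)
        also have "\<dots> \<le> \<bar>poly r 1\<bar> * (1 / 2)"
        proof (rule mult_left_mono)
          have "m * B * 2 \<le> M" by (simp add: M_def algebra_simps)
          then have "of_nat (m * B) * 2 \<le> (of_nat M :: 'k)"
            by (metis of_nat_le_iff of_nat_mult of_nat_numeral)
          then show "of_nat (m * B) / of_nat M \<le> (1 / 2 :: 'k)"
            using M1 by (simp add: field_simps)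
        qed simp
        finally show ?thesis by simp
      qed
      have rs: "0 < poly r 1 * poly r t \<and> \<bar>poly r 1\<bar> / 2 \<le> \<bar>poly r t\<bar>" if "\<bar>t - 1\<bar> \<le> e" for t
        using near[OF that] False by (auto simp: zero_less_mult_iff abs_if split: if_splits)
      have qs: "0 < poly q x * poly q y" if "0 < x" "x \<le> y" "y < 2" for x y
        using nz[rule_format, of _ 0] that q0
        by (intro real_closed_poly_same_sign[OF rc]) (auto simp: )
      \<comment> \<open>The step goes to the side on which \<open>\<bar>q\<bar>\<close> decreases:
        left if value and slope at 1 have the same sign, right otherwise. As \<open>q\<close> has no
        zero between 0 and 2, the decrease cannot exceed
        \<open>\<bar>poly q 1\<bar>\<close>.\<close>
      have "\<exists>y c. 0 < poly q 1 * poly q y \<and> \<bar>c - 1\<bar> \<le> e \<and> \<bar>poly q 1 - poly q y\<bar> = e * \<bar>poly r c\<bar>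
          \<and> 0 < poly q 1 * (poly q 1 - poly q y)"
      proof (cases "0 < poly q 1 * poly r 1")
        case True
        obtain c where c: "1 - e < c" "c < 1" "poly q 1 - poly q (1 - e) = (1 - (1 - e)) * poly r c"
          using real_closed_poly_MVT[OF rc, of "1 - e" 1 q] e unfolding r_def by auto
        have "\<bar>c - 1\<bar> \<le> e" using c by (auto simp: abs_le_iff)
        moreover have "\<bar>poly q 1 - poly q (1 - e)\<bar> = e * \<bar>poly r c\<bar>"
          using c e by (simp add: abs_mult)
        moreover have "0 < poly q 1 * (poly q 1 - poly q (1 - e))"
        proof -
          have "0 < poly q 1 * poly r c"
            using True rs[OF \<open>\<bar>c - 1\<bar> \<le> e\<close>] by (auto simp: zero_less_mult_iff)
          then have "0 < e * (poly q 1 * poly r c)" using e by simp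
          then show ?thesis by (simp only: c(3)) (simp add: ac_simps)
        qed
        moreover have "0 < poly q 1 * poly q (1 - e)"
          using qs[of "1 - e" 1] e by (simp add: mult.commute)
        ultimately show ?thesis by blast
      next
        case False
        have "poly q 1 \<noteq> 0" using qs[of 1 1] by auto
        with False have neg: "poly q 1 * poly r 1 < 0"
          using \<open>poly r 1 \<noteq> 0\<close> by (simp add: not_less le_less)
        obtain c where c: "1 < c" "c < 1 + e" "poly q (1 + e) - poly q 1 = (1 + e - 1) * poly r c"
          using real_closed_poly_MVT[OF rc, of 1 "1 + e" q] e unfolding r_def by auto
        have ce: "\<bar>c - 1\<bar> \<le> e" using c by (auto simp: abs_le_iff)
        moreover have "\<bar>poly q 1 - poly q (1 + e)\<bar> = e * \<bar>poly r c\<bar>"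
          using c e by (subst abs_minus_commute) (simp add: abs_mult)
        moreover have "0 < poly q 1 * (poly q 1 - poly q (1 + e))"
        proof -
          have *: "poly q 1 - poly q (1 + e) = - (e * poly r c)" using c(3) by (simp add: algebra_simps)
          have "poly q 1 * poly r c < 0"
            using neg rs[OF ce] by (auto simp: zero_less_mult_iff mult_less_0_iff)
          then have "0 < e * (- (poly q 1 * poly r c))" using e by (intro mult_pos_pos) auto
          then show ?thesis by (simp only: *) (simp add: ac_simps)
        qed
        moreover have "0 < poly q 1 * poly q (1 + e)"
          using qs[of 1 "1 + e"] e by simp
        ultimately show ?thesis by blast
      qed
      then obtain y c where yc: "0 < poly q 1 * poly q y" "\<bar>c - 1\<bar> \<le> e"
        "\<bar>poly q 1 - poly q y\<bar> = e * \<bar>poly r c\<bar>" "0 < poly q 1 * (poly q 1 - poly q y)" by blast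
      have "e * \<bar>poly r c\<bar> \<le> \<bar>poly q 1\<bar>"
        by (rule same_sign_increment[OF yc(1) refl yc(3) yc(4)])
      moreover have "e * (\<bar>poly r 1\<bar> / 2) \<le> e * \<bar>poly r c\<bar>"
        using rs[OF yc(2)] e by (intro mult_left_mono) auto
      ultimately have "e * (\<bar>poly r 1\<bar> / 2) \<le> \<bar>poly q 1\<bar>" by linarith
      then show ?thesis using M1 by (simp add: e_def field_simps)
    qed simp
    have c1: "\<bar>coeff q (Suc k)\<bar> \<le> \<bar>coeff r k\<bar>" for k
    proof -
      have "\<bar>coeff r k\<bar> = of_nat (Suc k) * \<bar>coeff q (Suc k)\<bar>"
        by (simp add: r_def coeff_pderiv abs_mult del: of_nat_Suc)
      moreover have "1 * \<bar>coeff q (Suc k)\<bar> \<le> of_nat (Suc k) * \<bar>coeff q (Suc k)\<bar>"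
        by (intro mult_right_mono) auto
      ultimately show ?thesis by simp
    qed
    have T: "(\<Sum>k\<le>n. \<bar>coeff q (Suc k)\<bar>) \<le> S"
      unfolding S_def by (intro sum_mono c1)
    have "poly q 1 = (\<Sum>k\<le>Suc n. coeff q k)"
      by (simp add: poly_eq_sum_upto[OF deg])
    then have "coeff q 0 = poly q 1 - (\<Sum>k\<le>n. coeff q (Suc k))"
      by (simp add: sum.atMost_Suc_shift del: sum.atMost_Suc)
    then have "\<bar>coeff q 0\<bar> \<le> \<bar>poly q 1\<bar> + (\<Sum>k\<le>n. \<bar>coeff q (Suc k)\<bar>)"
      using abs_triangle_ineq4[of "poly q 1" "\<Sum>k\<le>n. coeff q (Suc k)"]
        sum_abs[of "\<lambda>k. coeff q (Suc k)" "{..n}"] by linarith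
    then have "(\<Sum>k\<le>Suc n. \<bar>coeff q k\<bar>) \<le> \<bar>poly q 1\<bar> + 2 * S"
      using T by (simp add: sum.atMost_Suc_shift del: sum.atMost_Suc)
    also have "S \<le> of_nat m * (of_nat (2 * M) * \<bar>poly q 1\<bar>)"
      using S mult_left_mono[OF slope, of "of_nat m"] by simp
    finally show "(\<Sum>k\<le>Suc n. \<bar>coeff q k\<bar>) \<le> of_nat (1 + 4 * m * M) * \<bar>poly q 1\<bar>"
      by (simp add: algebra_simps)
  qed
qed

text \<open>Substituting \<open>z * X\<close> for \<open>X\<close> moves the point \<open>z\<close>
  to 1 and the root-free interval to the one from 0 to 2.\<close>

lemma coeff_sum_le:
  assumes rc: "real_closed TYPE('k::linordered_field)"
  obtains m where "\<And>(q :: 'k poly) z. degree q \<le> n \<Longrightarrow> 0 < z \<Longrightarrow>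
    (\<And>k y. 0 < y \<Longrightarrow> y < 2 * z \<Longrightarrow> (pderiv ^^ k) q \<noteq> 0 \<Longrightarrow> poly ((pderiv ^^ k) q) y \<noteq> 0) \<Longrightarrow>
    (\<Sum>k\<le>n. \<bar>coeff q k\<bar> * z ^ k) \<le> of_nat m * \<bar>poly q z\<bar>"
proof -
  obtain m where m: "\<And>q :: 'k poly. degree q \<le> n \<Longrightarrow>
    (\<forall>k z. 0 < z \<and> z < 2 \<and> (pderiv ^^ k) q \<noteq> 0 \<longrightarrow> poly ((pderiv ^^ k) q) z \<noteq> 0) \<Longrightarrow>
    (\<Sum>k\<le>n. \<bar>coeff q k\<bar>) \<le> of_nat m * \<bar>poly q 1\<bar>"
    using coeff_sum_le_at_1[OF rc, of n] by auto
  show ?thesis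
  proof (rule that[of m])
    fix q :: "'k poly" and z
    assume deg: "degree q \<le> n" and z: "0 < z"
      and nz: "\<And>k y. 0 < y \<Longrightarrow> y < 2 * z \<Longrightarrow> (pderiv ^^ k) q \<noteq> 0 \<Longrightarrow> poly ((pderiv ^^ k) q) y \<noteq> 0"
    define p where "p = pcompose q [:0, z:]"
    have "degree p \<le> n" using deg z by (simp add: p_def degree_pcompose)
    moreover have "\<forall>k y. 0 < y \<and> y < 2 \<and> (pderiv ^^ k) p \<noteq> 0 \<longrightarrow> poly ((pderiv ^^ k) p) y \<noteq> 0"
    proof (intro allI impI)
      fix k and y :: 'k assume y: "0 < y \<and> y < 2 \<and> (pderiv ^^ k) p \<noteq> 0"
      then have "(pderiv ^^ k) q \<noteq> 0"
        by (auto simp: p_def pderiv_funpow_pcompose_linear)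
      with y z nz[of "y * z" k] show "poly ((pderiv ^^ k) p) y \<noteq> 0"
        by (simp add: p_def pderiv_funpow_pcompose_linear poly_pcompose)
    qed
    ultimately have "(\<Sum>k\<le>n. \<bar>coeff p k\<bar>) \<le> of_nat m * \<bar>poly p 1\<bar>" by (rule m)
    then show "(\<Sum>k\<le>n. \<bar>coeff q k\<bar> * z ^ k) \<le> of_nat m * \<bar>poly q z\<bar>"
      using z by (simp add: p_def coeff_pcompose_linear poly_pcompose abs_mult mult.commute)
  qed
qed

text \<open>After division by the largest possible power of the variable no zero is left between 0
  and \<open>z\<close> inclusive, so the quotient has the same sign at \<open>z\<close> as at
  0.\<close>

lemma poly_pos_iff_first_coeff:
  fixes q :: "'k::linordered_field poly"
  assumes rc: "real_closed TYPE('k)" and deg: "degree q \<le> n" and z: "0 < z"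
    and nz: "\<And>y. 0 < y \<Longrightarrow> y \<le> z \<Longrightarrow> q \<noteq> 0 \<Longrightarrow> poly q y \<noteq> 0"
  shows "0 < poly q z \<longleftrightarrow> (\<exists>k\<le>n. 0 < coeff q k \<and> (\<forall>j<k. coeff q j = 0))"
proof (cases "q = 0")
  case False
  define k where "k = (LEAST k. coeff q k \<noteq> 0)"
  have "\<exists>k. coeff q k \<noteq> 0" using False by (simp add: poly_eq_iff)
  then have k: "coeff q k \<noteq> 0" unfolding k_def by (rule LeastI_ex)
  have lt: "coeff q j = 0" if "j < k" for j
    using not_less_Least[of j "\<lambda>k. coeff q k \<noteq> 0"] that by (auto simp: k_def)
  define h where "h = poly_shift k q"
  have q: "q = monom 1 k * h"
    by (rule poly_eqI) (auto simp: h_def coeff_monom_mult coeff_poly_shift lt)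
  have h0: "poly h 0 = coeff q k" by (simp add: h_def poly_0_coeff_0 coeff_poly_shift)
  have "0 < poly h 0 * poly h z"
  proof (rule real_closed_poly_same_sign[OF rc])
    fix y assume "0 \<le> y" "y \<le> z"
    then show "poly h y \<noteq> 0"
      using nz[of y] False k h0 q by (cases "y = 0") (auto simp: poly_monom)
  qed (use z in simp)
  moreover have "poly q z = z ^ k * poly h z" by (subst q) (simp add: poly_monom)
  ultimately have 1: "0 < poly q z \<longleftrightarrow> 0 < coeff q k"
    using z h0 by (auto simp: zero_less_mult_iff)
  have "k \<le> n" using k deg le_degree[of q k] by linarith
  moreover have "i = k" if "0 < coeff q i" "\<forall>j<i. coeff q j = 0" for i
    using that k lt[of i] by (metis less_irrefl linorder_neqE_nat)
  ultimately show ?thesis using 1 lt by blast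
qed simp

text \<open>Without critical points in between, Rolle's theorem leaves room for one root only. The
  third claim is the one needed with parameters: it locates \<open>u\<close> relative to the root by
  the signs of \<open>p\<close> at \<open>u\<close> and \<open>s\<close>, without mentioning the
  root.\<close>

lemma root_between_critical_points:
  fixes p :: "'k::linordered_field poly"
  assumes rc: "real_closed TYPE('k)" and p0: "p \<noteq> 0"
    and crit: "\<And>y. s < y \<Longrightarrow> y < t \<Longrightarrow> poly (pderiv p) y \<noteq> 0"
    and x: "s < x" "x < t" "poly p x = 0"
  shows "poly p s * poly p t < 0"
    and "\<And>y. s < y \<Longrightarrow> y < t \<Longrightarrow> poly p y = 0 \<Longrightarrow> y = x"
    and "\<And>u. s \<le> u \<Longrightarrow> u \<le> t \<Longrightarrow> u < x \<longleftrightarrow> 0 < poly p u * poly p s"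
proof -
  have uniq: "y = x" if y: "s \<le> y" "y \<le> t" "poly p y = 0" for y
  proof (rule ccontr)
    assume "y \<noteq> x"
    then consider "y < x" | "x < y" by linarith
    then show False
    proof cases
      case 1
      then obtain c where "y < c" "c < x" "poly (pderiv p) c = 0"
        using real_closed_poly_Rolle[OF rc 1 y(3) x(3) p0] by metis
      then show False using crit[of c] y x by auto
    next
      case 2
      then obtain c where "x < c" "c < y" "poly (pderiv p) c = 0"
        using real_closed_poly_Rolle[OF rc 2 x(3) y(3) p0] by metis
      then show False using crit[of c] y x by auto
    qed
  qed
  then show "\<And>y. s < y \<Longrightarrow> y < t \<Longrightarrow> poly p y = 0 \<Longrightarrow> y = x" by auto
  have s0: "poly p s \<noteq> 0" and t0: "poly p t \<noteq> 0" using uniq[of s] uniq[of t] x by auto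
  show st: "poly p s * poly p t < 0"
  proof (rule ccontr)
    assume "\<not> poly p s * poly p t < 0"
    with s0 t0 have pos: "0 < poly p s * poly p t" by (simp add: not_less le_less)
    obtain c where c: "s < c" "c < x" "poly p x - poly p s = (x - s) * poly (pderiv p) c"
      using real_closed_poly_MVT[OF rc x(1)] by metis
    obtain d where d: "x < d" "d < t" "poly p t - poly p x = (t - x) * poly (pderiv p) d"
      using real_closed_poly_MVT[OF rc x(2)] by metis
    have "poly p s = - ((x - s) * poly (pderiv p) c)" "poly p t = (t - x) * poly (pderiv p) d"
      using c d x by (auto simp: algebra_simps)
    with pos x have "poly (pderiv p) c * poly (pderiv p) d \<le> 0"
      by (auto simp: zero_less_mult_iff mult_le_0_iff mult_less_0_iff)
    then obtain y where "c \<le> y" "y \<le> d" "poly (pderiv p) y = 0"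
      using real_closed_poly_IVT[OF rc, of c d "pderiv p"] c d by (metis less_imp_le less_trans)
    then show False using crit[of y] c d by auto
  qed
  fix u assume u: "s \<le> u" "u \<le> t"
  show "u < x \<longleftrightarrow> 0 < poly p u * poly p s"
  proof
    assume "u < x"
    then have "0 < poly p s * poly p u"
      using u x uniq by (intro real_closed_poly_same_sign[OF rc]) force+
    then show "0 < poly p u * poly p s" by (simp add: mult.commute)
  next
    assume pos: "0 < poly p u * poly p s"
    show "u < x"
    proof (rule ccontr)
      assume "\<not> u < x"
      with pos x(3) have "x < u" by (metis less_irrefl linorder_neqE mult_zero_left)
      have "poly p z \<noteq> 0" if "u \<le> z" "z \<le> t" for z
        using uniq[of z] that u \<open>x < u\<close> by auto
      then have "0 < poly p u * poly p t"
        using u by (intro real_closed_poly_same_sign[OF rc]) auto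
      with pos st show False by (auto simp: zero_less_mult_iff mult_less_0_iff)
    qed
  qed
qed

text \<open>The terms add up to 0, so the largest one, with index \<open>j\<close>, is balanced by
  the others, and one of these has at least a \<open>d\<close>-th of its size. As with Newton
  polygons, the two terms determine the size of a power of \<open>x\<close> by a ratio of
  coefficients.\<close>

lemma root_dominant_terms:
  fixes p :: "'k::linordered_field poly"
  assumes deg: "degree p \<le> d" and top: "coeff p d \<noteq> 0" and x: "poly p x = 0" "x \<noteq> 0"
  shows "\<exists>i\<le>d. \<exists>j\<le>d. i \<noteq> j \<and> coeff p i \<noteq> 0 \<and> coeff p j \<noteq> 0 \<and>
    \<bar>coeff p i * x ^ i\<bar> \<le> \<bar>coeff p j * x ^ j\<bar> \<and> \<bar>coeff p j * x ^ j\<bar> \<le> of_nat d * \<bar>coeff p i * x ^ i\<bar>"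
proof -
  define b where "b k = \<bar>coeff p k * x ^ k\<bar>" for k
  obtain j where j: "j \<le> d" "\<And>k. k \<le> d \<Longrightarrow> b k \<le> b j"
  proof -
    have "Max (b ` {..d}) \<in> b ` {..d}" by (intro Max_in) auto
    then obtain j where "j \<le> d" "b j = Max (b ` {..d})" by (metis atMost_iff imageE)
    then show ?thesis using that by (metis Max_ge atMost_iff finite_atMost finite_imageI imageI)
  qed
  have "0 < b d" using top x by (simp add: b_def)
  with j have bj: "0 < b j" by (metis le_refl less_le_trans)
  have "(\<Sum>k\<le>d. coeff p k * x ^ k) = 0"
    using x by (simp add: poly_eq_sum_upto[OF deg])
  then have "coeff p j * x ^ j = - (\<Sum>k\<in>{..d} - {j}. coeff p k * x ^ k)"
    using j sum.remove[of "{..d}" j "\<lambda>k. coeff p k * x ^ k"] by (simp add: eq_neg_iff_add_eq_0)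
  then have le: "b j \<le> (\<Sum>k\<in>{..d} - {j}. b k)"
    unfolding b_def by (simp only: abs_minus_cancel sum_abs)
  have "\<exists>i\<in>{..d} - {j}. b j \<le> of_nat d * b i"
  proof (rule ccontr)
    assume "\<not> ?thesis"
    then have *: "of_nat d * b i < b j" if "i \<in> {..d} - {j}" for i
      using that by (meson not_le)
    have ne: "{..d} - {j} \<noteq> {}"
    proof
      assume "{..d} - {j} = {}"
      with le have "b j \<le> 0" by (simp only: sum.empty)
      with bj show False by simp
    qed
    have "of_nat d * b j \<le> (\<Sum>k\<in>{..d} - {j}. of_nat d * b k)"
      using mult_left_mono[OF le, of "of_nat d"] by (simp add: sum_distrib_left)
    also have "\<dots> < (\<Sum>k\<in>{..d} - {j}. b j)"
      using ne * by (intro sum_strict_mono) auto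
    also have "\<dots> = of_nat d * b j" using j by simp
    finally show False by simp
  qed
  then obtain i where i: "i \<le> d" "i \<noteq> j" "b j \<le> of_nat d * b i" by auto
  have "b i \<noteq> 0" using i bj by auto
  then show ?thesis using i j bj by (intro exI[of _ i] exI[of _ j] conjI) (auto simp: b_def)
qed

section \<open>Scaling cuts and algebras of functions\<close>

text \<open>These are the downward closed unions of archimedean classes of positive elements, that
  is, the cuts in the value group of the natural valuation. The empty set and \<open>{0<..}\<close>
  are among them.\<close>

definition scaling_cut :: "'k::linordered_field set \<Rightarrow> bool" where
  "scaling_cut C \<longleftrightarrow> C \<subseteq> {0<..} \<and> (\<forall>z\<in>C. \<forall>y. 0 < y \<and> y \<le> 2 * z \<longrightarrow> y \<in> C)"

lemma scaling_cutI:
  assumes "\<And>z. z \<in> C \<Longrightarrow> 0 < z" and "\<And>y z. z \<in> C \<Longrightarrow> 0 < y \<Longrightarrow> y \<le> 2 * z \<Longrightarrow> y \<in> C"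
  shows "scaling_cut C"
  unfolding scaling_cut_def
proof (intro conjI subsetI ballI allI impI)
  fix z y assume "z \<in> C" "0 < y \<and> y \<le> 2 * z"
  then show "y \<in> C" using assms(2)[of z y] by simp
qed (simp add: assms(1))

lemma scaling_cut_pos: "scaling_cut C \<Longrightarrow> z \<in> C \<Longrightarrow> 0 < z"
  by (auto simp: scaling_cut_def)

lemma scaling_cut_le:
  assumes C: "scaling_cut C" and z: "z \<in> C" and y: "0 < y" "y \<le> of_nat m * z"
  shows "y \<in> C"
proof -
  have pow: "2 ^ n * z \<in> C" for n
  proof (induction n)
    case (Suc n)
    have "0 < 2 ^ Suc n * z" using scaling_cut_pos[OF C z] by simp
    then show ?case using C Suc unfolding scaling_cut_def by (simp add: mult.assoc)
  qed (simp add: z)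
  have "m \<le> 2 ^ m" by simp
  then have "of_nat m \<le> (of_nat (2 ^ m) :: 'a)" by (rule of_nat_mono)
  then have "of_nat m * z \<le> 2 ^ m * z"
    using scaling_cut_pos[OF C z] by (intro mult_right_mono) auto
  then have "y \<le> 2 * (2 ^ m * z)" using y scaling_cut_pos[OF C pow, of m] by linarith
  then show ?thesis using C pow[of m] y unfolding scaling_cut_def by blast
qed

lemma scaling_cut_greaterThan [simp]: "scaling_cut {0<..}"
  by (rule scaling_cutI) auto

section \<open>Comparability up to an integer factor\<close>

definition cmp :: "nat \<Rightarrow> 'k::linordered_field \<Rightarrow> 'k \<Rightarrow> bool" where
  "cmp m a b \<longleftrightarrow> 0 \<le> a \<and> 0 \<le> b \<and> a \<le> of_nat m * b \<and> b \<le> of_nat m * a"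

lemma cmp_zero_iff: "cmp m a b \<Longrightarrow> a = 0 \<longleftrightarrow> b = 0"
  by (auto simp: cmp_def)

lemma cmp_sym: "cmp m a b \<Longrightarrow> cmp m b a"
  by (auto simp: cmp_def)

lemma cmp_mult:
  assumes "cmp m a b" "cmp n c d"
  shows "cmp (m * n) (a * c) (b * d)"
proof -
  have "a * c \<le> (of_nat m * b) * (of_nat n * d)" "b * d \<le> (of_nat m * a) * (of_nat n * c)"
    using assms by (auto simp: cmp_def intro!: mult_mono)
  then show ?thesis using assms by (auto simp: cmp_def algebra_simps)
qed

lemma cmp_power: "cmp m a b \<Longrightarrow> cmp (m ^ n) (a ^ n) (b ^ n)"
proof (induction n)
  case 0
  show ?case by (simp add: cmp_def)
next
  case (Suc n)
  from cmp_mult[OF Suc.prems Suc.IH[OF Suc.prems]] show ?case by simp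
qed

lemma cmp_trans:
  assumes "cmp m a b" "cmp n b c"
  shows "cmp (m * n) a c"
proof -
  have "of_nat m * b \<le> of_nat m * (of_nat n * c)" "of_nat n * b \<le> of_nat n * (of_nat m * a)"
    using assms by (auto simp: cmp_def intro!: mult_left_mono)
  then show ?thesis using assms unfolding cmp_def by (simp add: algebra_simps)
qed

text \<open>A quotient by 0 is 0 and lies in no scaling cut. As \<open>cmp\<close> preserves
  vanishing, denominators need no separate treatment.\<close>

lemma cmp_divide_iff:
  assumes C: "scaling_cut C" and "cmp m a b" "cmp n c d"
  shows "a / c \<in> C \<longleftrightarrow> b / d \<in> C"
proof -
  have *: "b / d \<in> C" if "a / c \<in> C" "cmp m a b" "cmp n c d" for a b c d
  proof -
    have ac: "0 < a / c" using scaling_cut_pos[OF C that(1)] .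
    with that have pos: "0 < a" "0 < c" "0 < b" "0 < d"
      using cmp_zero_iff[OF that(2)] cmp_zero_iff[OF that(3)]
      by (auto simp: cmp_def zero_less_divide_iff order_le_less)
    have "b / d \<le> of_nat (m * n) * (a / c)"
    proof -
      have "b * c \<le> (of_nat m * a) * (of_nat n * d)"
        using that pos by (intro mult_mono) (auto simp: cmp_def)
      then show ?thesis using pos by (simp add: field_simps)
    qed
    moreover have "0 < b / d" using pos by simp
    ultimately show ?thesis by (intro scaling_cut_le[OF C that(1)])
  qed
  show ?thesis using *[of a c b d] *[of b d a c] assms cmp_sym by blast
qed

text \<open>The image of a cut under \<open>n\<close>-th powers, closed downwards. It allows a
  condition on \<open>g\<close> to be tested on \<open>g ^ n\<close>.\<close>

lemma scaling_cut_power_image: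
  assumes C: "scaling_cut C" and n: "n \<ge> 1"
  shows "scaling_cut {z. 0 < z \<and> (\<exists>u\<in>C. z \<le> u ^ n)}"
proof (rule scaling_cutI)
  fix y z assume z: "z \<in> {z. 0 < z \<and> (\<exists>u\<in>C. z \<le> u ^ n)}" and y: "0 < y" "y \<le> 2 * z"
  then obtain u where u: "u \<in> C" "z \<le> u ^ n" by blast
  have u0: "0 < u" using scaling_cut_pos[OF C u(1)] .
  have "2 * u \<in> C" using scaling_cut_le[OF C u(1), of "2 * u" 2] u0 by simp
  moreover have "2 * z \<le> (2 * u) ^ n"
  proof -
    have "(2::'a) ^ 1 \<le> 2 ^ n" using n by (intro power_increasing) auto
    then have "2 * z \<le> 2 ^ n * u ^ n" using z u u0 by (intro mult_mono) auto
    then show ?thesis by (simp add: power_mult_distrib)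
  qed
  ultimately show "y \<in> {z. 0 < z \<and> (\<exists>u\<in>C. z \<le> u ^ n)}" using y by force
qed simp

lemma power_mem_cut_iff:
  assumes C: "scaling_cut C" and n: "n \<ge> 1" and g: "0 \<le> g"
  shows "g ^ n \<in> {z. 0 < z \<and> (\<exists>u\<in>C. z \<le> u ^ n)} \<longleftrightarrow> g \<in> C"
proof
  assume "g ^ n \<in> {z. 0 < z \<and> (\<exists>u\<in>C. z \<le> u ^ n)}"
  then obtain u where u: "u \<in> C" "g ^ n \<le> u ^ n" "0 < g ^ n" by blast
  have "0 < u" using scaling_cut_pos[OF C u(1)] .
  have "g \<le> u"
    using u n \<open>0 < u\<close> power_mono_iff[OF g, of u n] by auto
  moreover have "0 < g" using u(3) g n by (cases "g = 0") (auto simp: zero_power)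
  ultimately show "g \<in> C" using scaling_cut_le[OF C u(1), of g 1] by simp
next
  assume "g \<in> C"
  then show "g ^ n \<in> {z. 0 < z \<and> (\<exists>u\<in>C. z \<le> u ^ n)}"
    using scaling_cut_pos[OF C] by force
qed

section \<open>Algebras of functions and the sets they define\<close>

definition fun_algebra :: "('x \<Rightarrow> 'k::linordered_field) set \<Rightarrow> bool" where
  "fun_algebra R \<longleftrightarrow> (\<forall>c. (\<lambda>_. c) \<in> R) \<and>
     (\<forall>f\<in>R. \<forall>g\<in>R. (\<lambda>x. f x + g x) \<in> R \<and> (\<lambda>x. f x * g x) \<in> R)"

text \<open>One kind of atom suffices: denominator 1 and the cut \<open>{0<..}\<close> give the
  order, and with it equality. An atom is false wherever its denominator vanishes.\<close>

inductive_set cut_sets :: "('x \<Rightarrow> 'k::linordered_field) set \<Rightarrow> 'x set set"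
  for R :: "('x \<Rightarrow> 'k) set" where
  atom: "f \<in> R \<Longrightarrow> g \<in> R \<Longrightarrow> scaling_cut C \<Longrightarrow> {x. f x / g x \<in> C} \<in> cut_sets R"
| compl: "A \<in> cut_sets R \<Longrightarrow> - A \<in> cut_sets R"
| inter: "A \<in> cut_sets R \<Longrightarrow> B \<in> cut_sets R \<Longrightarrow> A \<inter> B \<in> cut_sets R"

text \<open>Polynomials over \<open>R\<close> in one further variable, taken pointwise. The uniform
  degree bound makes evaluation a sum of fixed length, which stays in \<open>R\<close>.\<close>

definition pols :: "('x \<Rightarrow> 'k::linordered_field) set \<Rightarrow> ('x \<Rightarrow> 'k poly) set" where
  "pols R = {P. (\<forall>k. (\<lambda>x. coeff (P x) k) \<in> R) \<and> (\<exists>d. \<forall>x. degree (P x) \<le> d)}"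

lemma cut_sets_subset:
  assumes "\<And>f g C. f \<in> S \<Longrightarrow> g \<in> S \<Longrightarrow> scaling_cut C \<Longrightarrow> {x. f x / g x \<in> C} \<in> cut_sets R"
  shows "cut_sets S \<subseteq> cut_sets R"
proof
  fix A assume "A \<in> cut_sets S"
  then show "A \<in> cut_sets R"
    by induction (auto intro: assms cut_sets.intros)
qed

lemma cut_sets_mono: "S \<subseteq> R \<Longrightarrow> cut_sets S \<subseteq> cut_sets R"
  by (intro cut_sets_subset cut_sets.atom) auto

locale fun_alg =
  fixes R :: "('x \<Rightarrow> 'k::linordered_field) set"
  assumes alg: "fun_algebra R"
begin

named_theorems R_intros

lemma R_const [R_intros]: "(\<lambda>_. c) \<in> R"
  and R_add [R_intros]: "f \<in> R \<Longrightarrow> g \<in> R \<Longrightarrow> (\<lambda>x. f x + g x) \<in> R"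
  and R_mult [R_intros]: "f \<in> R \<Longrightarrow> g \<in> R \<Longrightarrow> (\<lambda>x. f x * g x) \<in> R"
  using alg by (auto simp: fun_algebra_def)

lemma R_uminus [R_intros]: "f \<in> R \<Longrightarrow> (\<lambda>x. - f x) \<in> R"
  using R_mult[OF R_const[of "-1"], of f] by simp

lemma R_diff [R_intros]: "f \<in> R \<Longrightarrow> g \<in> R \<Longrightarrow> (\<lambda>x. f x - g x) \<in> R"
  using R_add[OF _ R_uminus, of f g] by simp

lemma R_power [R_intros]: "f \<in> R \<Longrightarrow> (\<lambda>x. f x ^ n) \<in> R"
  by (induction n) (auto intro: R_intros)

lemma R_sum [R_intros]: "(\<And>i. i \<in> I \<Longrightarrow> f i \<in> R) \<Longrightarrow> (\<lambda>x. \<Sum>i\<in>I. f i x) \<in> R"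
  by (induction I rule: infinite_finite_induct) (auto intro: R_intros)

lemma pols_coeff [R_intros]: "P \<in> pols R \<Longrightarrow> (\<lambda>x. coeff (P x) k) \<in> R"
  by (auto simp: pols_def)

lemma pols_degree: "P \<in> pols R \<Longrightarrow> \<exists>d. \<forall>x. degree (P x) \<le> d"
  by (auto simp: pols_def)

lemma polsI: "(\<And>k. (\<lambda>x. coeff (P x) k) \<in> R) \<Longrightarrow> (\<And>x. degree (P x) \<le> d) \<Longrightarrow> P \<in> pols R"
  by (auto simp: pols_def)

lemma R_poly [R_intros]:
  assumes P: "P \<in> pols R" and f: "f \<in> R"
  shows "(\<lambda>x. poly (P x) (f x)) \<in> R"
proof -
  obtain d where d: "\<And>x. degree (P x) \<le> d" using pols_degree[OF P] by auto
  have "(\<lambda>x. poly (P x) (f x)) = (\<lambda>x. \<Sum>k\<le>d. coeff (P x) k * f x ^ k)"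
    using d by (intro ext poly_eq_sum_upto)
  then show ?thesis using P f by (auto intro!: R_intros)
qed

named_theorems P_intros

lemma pols_pCons [P_intros]:
  assumes "f \<in> R" "P \<in> pols R"
  shows "(\<lambda>x. pCons (f x) (P x)) \<in> pols R"
proof -
  obtain d where d: "\<And>x. degree (P x) \<le> d" using pols_degree[OF assms(2)] by auto
  show ?thesis
  proof (rule polsI)
    fix k show "(\<lambda>x. coeff (pCons (f x) (P x)) k) \<in> R"
      using assms by (cases k) (auto intro: R_intros)
    fix x show "degree (pCons (f x) (P x)) \<le> Suc d"
      using d[of x] degree_pCons_le[of "f x" "P x"] by linarith
  qed
qed

lemma pols_const [P_intros]: "(\<lambda>_. p) \<in> pols R"
  by (rule polsI) (auto intro: R_intros)

lemma pols_add [P_intros]: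
  assumes "P \<in> pols R" "Q \<in> pols R"
  shows "(\<lambda>x. P x + Q x) \<in> pols R"
proof -
  obtain d e where d: "\<And>x. degree (P x) \<le> d" and e: "\<And>x. degree (Q x) \<le> e"
    using assms pols_degree by metis
  show ?thesis
  proof (rule polsI)
    fix k show "(\<lambda>x. coeff (P x + Q x) k) \<in> R"
      using assms by (auto intro: R_intros)
    fix x show "degree (P x + Q x) \<le> max d e"
      using d[of x] e[of x] by (intro degree_add_le) auto
  qed
qed

lemma pols_mult [P_intros]:
  assumes "P \<in> pols R" "Q \<in> pols R"
  shows "(\<lambda>x. P x * Q x) \<in> pols R"
proof -
  obtain d e where d: "\<And>x. degree (P x) \<le> d" and e: "\<And>x. degree (Q x) \<le> e"
    using assms pols_degree by metis
  show ?thesis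
  proof (rule polsI)
    fix k show "(\<lambda>x. coeff (P x * Q x) k) \<in> R"
      using assms by (auto simp: coeff_mult intro!: R_intros)
    fix x show "degree (P x * Q x) \<le> d + e"
      using d[of x] e[of x] degree_mult_le[of "P x" "Q x"] by linarith
  qed
qed

lemma pols_of_R [P_intros]: "f \<in> R \<Longrightarrow> (\<lambda>x. [:f x:]) \<in> pols R"
  by (rule pols_pCons) (auto intro: pols_const)

lemma pols_linear [P_intros]: "f \<in> R \<Longrightarrow> g \<in> R \<Longrightarrow> (\<lambda>x. [:f x, g x:]) \<in> pols R"
  by (intro pols_pCons pols_of_R)

lemma pols_uminus [P_intros]: "P \<in> pols R \<Longrightarrow> (\<lambda>x. - P x) \<in> pols R"
  using pols_mult[OF pols_const[of "-1"], of P] by simp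

lemma pols_diff [P_intros]: "P \<in> pols R \<Longrightarrow> Q \<in> pols R \<Longrightarrow> (\<lambda>x. P x - Q x) \<in> pols R"
  using pols_add[OF _ pols_uminus, of P Q] by simp

lemma pols_power [P_intros]: "P \<in> pols R \<Longrightarrow> (\<lambda>x. P x ^ n) \<in> pols R"
  by (induction n) (auto intro: P_intros)

lemma pols_pderiv [P_intros]:
  assumes "P \<in> pols R"
  shows "(\<lambda>x. pderiv (P x)) \<in> pols R"
proof -
  obtain d where d: "\<And>x. degree (P x) \<le> d" using pols_degree[OF assms] by auto
  show ?thesis
  proof (rule polsI)
    fix k show "(\<lambda>x. coeff (pderiv (P x)) k) \<in> R"
      unfolding coeff_pderiv using assms by (intro R_intros)
    fix x show "degree (pderiv (P x)) \<le> d"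
      using d[of x] by (simp add: degree_pderiv)
  qed
qed

lemma pols_pderiv_funpow [P_intros]: "P \<in> pols R \<Longrightarrow> (\<lambda>x. (pderiv ^^ k) (P x)) \<in> pols R"
  by (induction k) (auto intro: P_intros)

lemma pols_pcompose [P_intros]:
  assumes P: "P \<in> pols R" and Q: "Q \<in> pols R"
  shows "(\<lambda>x. pcompose (P x) (Q x)) \<in> pols R"
proof -
  have "(\<lambda>x. pcompose (P x) (Q x)) \<in> pols R" if "\<And>x. degree (P x) \<le> d" "P \<in> pols R" for d P
    using that
  proof (induction d arbitrary: P)
    case 0
    have "pcompose (P x) (Q x) = [:coeff (P x) 0:]" for x
    proof -
      obtain c where "P x = [:c:]" using 0(1)[of x] degree_eq_zeroE[of "P x"] by auto
      then show ?thesis by simp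
    qed
    then show ?case using 0(2) by (auto intro!: P_intros R_intros)
  next
    case (Suc d)
    define S where "S x = poly_shift 1 (P x)" for x
    have eq: "P x = pCons (coeff (P x) 0) (S x)" for x
      by (rule poly_eqI) (auto simp: S_def coeff_pCons coeff_poly_shift split: nat.split)
    have dS: "degree (S x) \<le> d" for x
    proof (rule degree_le, intro allI impI)
      fix i assume "d < i"
      then show "coeff (S x) i = 0"
        using Suc.prems(1)[of x] by (auto simp: S_def coeff_poly_shift intro!: coeff_eq_0)
    qed
    have "S \<in> pols R"
    proof (rule polsI[OF _ dS])
      fix k show "(\<lambda>x. coeff (S x) k) \<in> R"
        unfolding S_def coeff_poly_shift using Suc.prems(2) by (intro R_intros)
    qed
    then have "(\<lambda>x. pcompose (S x) (Q x)) \<in> pols R" by (intro Suc.IH dS)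
    then have "(\<lambda>x. [:coeff (P x) 0:] + Q x * pcompose (S x) (Q x)) \<in> pols R"
      using Q Suc.prems(2) by (intro P_intros R_intros)
    moreover have "pcompose (P x) (Q x) = [:coeff (P x) 0:] + Q x * pcompose (S x) (Q x)" for x
      by (subst eq) (rule pcompose_pCons)
    ultimately show ?case by simp
  qed
  then show ?thesis using P pols_degree[OF P] by blast
qed

text \<open>Division with remainder, uniformly in the parameter. The leading coefficient 1 makes
  each reduction a ring operation, so no inverses are required of \<open>R\<close>.\<close>

lemma pols_mod_monic:
  assumes P: "P \<in> pols R" and M: "M \<in> pols R"
    and monic: "\<And>x. degree (M x) \<le> d" "\<And>x. coeff (M x) d = 1" and d: "d \<ge> 1"
  shows "\<exists>Q\<in>pols R. (\<forall>x. degree (Q x) < d) \<and>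
    (\<forall>x y. poly (M x) y = 0 \<longrightarrow> poly (P x) y = poly (Q x) y)"
proof -
  have "\<exists>Q\<in>pols R. (\<forall>x. degree (Q x) < d) \<and>
      (\<forall>x y. poly (M x) y = 0 \<longrightarrow> poly (P x) y = poly (Q x) y)"
    if "\<And>x. degree (P x) < n + d" "P \<in> pols R" for n P
    using that
  proof (induction n arbitrary: P)
    case 0
    then show ?case by (intro bexI[of _ P]) auto
  next
    case (Suc n)
    define S where "S x = P x - [:coeff (P x) (n + d):] * (monom 1 n * M x)" for x
    have "S \<in> pols R"
      unfolding S_def using Suc.prems(2) M by (intro P_intros R_intros)
    moreover have "degree (S x) < n + d" for x
    proof -
      have c: "coeff (S x) i = coeff (P x) i
          - (if i < n then 0 else coeff (P x) (n + d) * coeff (M x) (i - n))" for i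
        by (simp add: S_def coeff_monom_mult)
      have "degree (S x) \<le> n + d - 1"
      proof (rule degree_le, intro allI impI)
        fix i assume "n + d - 1 < i"
        then consider "i = n + d" | "n + d < i" using d by linarith
        then show "coeff (S x) i = 0"
        proof cases
          case 1
          then show ?thesis by (simp add: c monic)
        next
          case 2
          then have "coeff (P x) i = 0" "coeff (M x) (i - n) = 0"
            using Suc.prems(1)[of x] monic(1)[of x] by (auto intro!: coeff_eq_0)
          then show ?thesis by (simp add: c)
        qed
      qed
      then show ?thesis using d by linarith
    qed
    ultimately obtain Q where Q: "Q \<in> pols R" "\<forall>x. degree (Q x) < d"
      "\<forall>x y. poly (M x) y = 0 \<longrightarrow> poly (S x) y = poly (Q x) y"
      using Suc.IH by blast
    moreover have "poly (S x) y = poly (P x) y" if "poly (M x) y = 0" for x y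
      using that by (simp add: S_def)
    ultimately show ?case by (intro bexI[of _ Q]) auto
  qed
  moreover obtain n where "\<And>x. degree (P x) \<le> n" using pols_degree[OF P] by auto
  then have "degree (P x) < Suc n + d" for x
    by (metis add.commute add_Suc_right le_imp_less_Suc trans_le_add2)
  ultimately show ?thesis using P by blast
qed

named_theorems cs_intros

lemma cs_mem [cs_intros]: "A \<in> cut_sets R \<Longrightarrow> {x. x \<in> A} \<in> cut_sets R"
  by simp

lemma cs_atom [cs_intros]:
  "f \<in> R \<Longrightarrow> g \<in> R \<Longrightarrow> scaling_cut C \<Longrightarrow> {x. f x / g x \<in> C} \<in> cut_sets R"
  by (rule cut_sets.atom)

lemma cs_not [cs_intros]: "{x. P x} \<in> cut_sets R \<Longrightarrow> {x. \<not> P x} \<in> cut_sets R"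
  using cut_sets.compl[of "{x. P x}" R] by (simp add: Collect_neg_eq)

lemma cs_conj [cs_intros]:
  "{x. P x} \<in> cut_sets R \<Longrightarrow> {x. Q x} \<in> cut_sets R \<Longrightarrow> {x. P x \<and> Q x} \<in> cut_sets R"
  using cut_sets.inter[of "{x. P x}" R "{x. Q x}"] by (simp add: Collect_conj_eq)

lemma cs_disj [cs_intros]:
  "{x. P x} \<in> cut_sets R \<Longrightarrow> {x. Q x} \<in> cut_sets R \<Longrightarrow> {x. P x \<or> Q x} \<in> cut_sets R"
  using cs_not[OF cs_conj[OF cs_not cs_not], of P Q] by simp

lemma cs_imp [cs_intros]:
  "{x. P x} \<in> cut_sets R \<Longrightarrow> {x. Q x} \<in> cut_sets R \<Longrightarrow> {x. P x \<longrightarrow> Q x} \<in> cut_sets R"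
  unfolding imp_conv_disj by (rule cs_disj[OF cs_not])

lemma cs_less [cs_intros]: "f \<in> R \<Longrightarrow> g \<in> R \<Longrightarrow> {x. f x < g x} \<in> cut_sets R"
  using cut_sets.atom[OF R_diff R_const[of 1] scaling_cut_greaterThan, of g f] by simp

lemma cs_le [cs_intros]: "f \<in> R \<Longrightarrow> g \<in> R \<Longrightarrow> {x. f x \<le> g x} \<in> cut_sets R"
  using cs_not[OF cs_less, of g f] by (simp add: not_less)

lemma cs_eq [cs_intros]: "f \<in> R \<Longrightarrow> g \<in> R \<Longrightarrow> {x. f x = g x} \<in> cut_sets R"
  using cs_conj[OF cs_le cs_le, of f g g f] by (simp add: order_eq_iff)

lemma cs_const [cs_intros]: "{x. p} \<in> cut_sets R"
  using cs_eq[OF R_const[of 0] R_const[of "if p then 0 else 1"]] by (cases p) auto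

lemma cs_ball [cs_intros]:
  "finite I \<Longrightarrow> (\<And>i. i \<in> I \<Longrightarrow> {x. P i x} \<in> cut_sets R) \<Longrightarrow> {x. \<forall>i\<in>I. P i x} \<in> cut_sets R"
proof (induction I rule: finite_induct)
  case empty
  show ?case using cs_const[of True] by simp
next
  case (insert i I)
  then have "{x. P i x \<and> (\<forall>i\<in>I. P i x)} \<in> cut_sets R" by (intro cs_conj) auto
  then show ?case by simp
qed

lemma cs_bex [cs_intros]:
  "finite I \<Longrightarrow> (\<And>i. i \<in> I \<Longrightarrow> {x. P i x} \<in> cut_sets R) \<Longrightarrow> {x. \<exists>i\<in>I. P i x} \<in> cut_sets R"
proof -
  assume "finite I" "\<And>i. i \<in> I \<Longrightarrow> {x. P i x} \<in> cut_sets R"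
  then have "{x. \<not> (\<forall>i\<in>I. \<not> P i x)} \<in> cut_sets R" by (intro cs_not cs_ball)
  then show ?thesis by simp
qed

end

definition adjoin :: "('x \<Rightarrow> 'k::linordered_field) set \<Rightarrow> ('x \<Rightarrow> 'k) \<Rightarrow> ('x \<Rightarrow> 'k) set" where
  "adjoin R f = {\<lambda>x. poly (P x) (f x) |P. P \<in> pols R}"

text \<open>The assumption \<open>full\<close> expresses maximality among the algebras defining the same sets.\<close>

locale full_alg = fun_alg R for R :: "('x \<Rightarrow> 'k::linordered_field) set" +
  assumes rc: "real_closed TYPE('k)"
    and full: "\<And>f. (\<And>P Q C. P \<in> pols R \<Longrightarrow> Q \<in> pols R \<Longrightarrow> scaling_cut C \<Longrightarrow>
      {x. poly (P x) (f x) / poly (Q x) (f x) \<in> C} \<in> cut_sets R) \<Longrightarrow> f \<in> R"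

text \<open>Zorn's lemma applies because an atom involves two functions, which already lie in a
  single member of a chain. At a maximal algebra, a function satisfying the premise of
  \<open>full\<close> can be adjoined without creating cut sets, and hence already belongs to
  it.\<close>

lemma full_alg_exists:
  fixes R :: "('x \<Rightarrow> 'k::linordered_field) set"
  assumes rc: "real_closed TYPE('k)" and R: "fun_algebra R"
  obtains S where "R \<subseteq> S" "cut_sets S = cut_sets R" "full_alg S"
proof -
  define \<A> where "\<A> = {S. fun_algebra S \<and> R \<subseteq> S \<and> cut_sets S \<subseteq> cut_sets R}"
  have "\<exists>M\<in>\<A>. \<forall>T\<in>\<A>. M \<subseteq> T \<longrightarrow> T = M"
  proof (rule subset_Zorn_nonempty)
    show "\<A> \<noteq> {}" using R by (auto simp: \<A>_def)
    fix \<C> assume ne: "\<C> \<noteq> {}" and ch: "subset.chain \<A> \<C>"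
    have sub: "\<C> \<subseteq> \<A>" using ch by (auto simp: subset.chain_def)
    have two: "\<exists>S\<in>\<C>. f \<in> S \<and> g \<in> S" if "f \<in> \<Union>\<C>" "g \<in> \<Union>\<C>" for f g
      using that ch unfolding subset_chain_def by blast
    have "fun_algebra (\<Union>\<C>)"
      unfolding fun_algebra_def
    proof (intro conjI allI ballI)
      fix c
      obtain S where "S \<in> \<C>" using ne by blast
      moreover from this have "fun_algebra S" using sub by (auto simp: \<A>_def)
      ultimately show "(\<lambda>_. c) \<in> \<Union>\<C>" by (auto simp: fun_algebra_def)
    next
      fix f g assume "f \<in> \<Union>\<C>" "g \<in> \<Union>\<C>"
      then obtain S where S: "S \<in> \<C>" "f \<in> S" "g \<in> S" using two by blast
      then have "fun_algebra S" using sub by (auto simp: \<A>_def)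
      with S show "(\<lambda>x. f x + g x) \<in> \<Union>\<C>" "(\<lambda>x. f x * g x) \<in> \<Union>\<C>"
        by (auto simp: fun_algebra_def)
    qed
    moreover have "R \<subseteq> \<Union>\<C>" using ne sub by (auto simp: \<A>_def)
    moreover have "cut_sets (\<Union>\<C>) \<subseteq> cut_sets R"
    proof (rule cut_sets_subset)
      fix f g and C :: "'k set" assume "f \<in> \<Union>\<C>" "g \<in> \<Union>\<C>" and C: "scaling_cut C"
      then obtain S where S: "S \<in> \<C>" "f \<in> S" "g \<in> S" using two by blast
      then have "{x. f x / g x \<in> C} \<in> cut_sets S" using C by (intro cut_sets.atom)
      then show "{x. f x / g x \<in> C} \<in> cut_sets R" using S sub by (auto simp: \<A>_def)
    qed
    ultimately show "\<Union>\<C> \<in> \<A>" by (auto simp: \<A>_def)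
  qed
  then obtain M where M: "M \<in> \<A>" "\<And>T. T \<in> \<A> \<Longrightarrow> M \<subseteq> T \<Longrightarrow> T = M" by blast
  then have alg: "fun_algebra M" and RM: "R \<subseteq> M" and cM: "cut_sets M \<subseteq> cut_sets R"
    by (auto simp: \<A>_def)
  interpret fun_alg M by standard (rule alg)
  have "full_alg M"
  proof (standard, rule rc)
    fix f
    assume f: "\<And>P Q C. P \<in> pols M \<Longrightarrow> Q \<in> pols M \<Longrightarrow> scaling_cut C \<Longrightarrow>
      {x. poly (P x) (f x) / poly (Q x) (f x) \<in> C} \<in> cut_sets M"
    have "fun_algebra (adjoin M f)"
      unfolding fun_algebra_def
    proof (intro conjI allI ballI)
      fix c show "(\<lambda>_. c) \<in> adjoin M f"
        unfolding adjoin_def using pols_const[of "[:c:]"] by force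
    next
      fix g h assume "g \<in> adjoin M f" "h \<in> adjoin M f"
      then obtain P Q where PQ: "P \<in> pols M" "Q \<in> pols M"
        "g = (\<lambda>x. poly (P x) (f x))" "h = (\<lambda>x. poly (Q x) (f x))"
        unfolding adjoin_def by auto
      show "(\<lambda>x. g x + h x) \<in> adjoin M f"
        unfolding adjoin_def using pols_add[OF PQ(1,2)] by (force simp: PQ)
      show "(\<lambda>x. g x * h x) \<in> adjoin M f"
        unfolding adjoin_def using pols_mult[OF PQ(1,2)] by (force simp: PQ)
    qed
    moreover have Madj: "M \<subseteq> adjoin M f"
    proof
      fix g assume "g \<in> M"
      then have "(\<lambda>x. [:g x:]) \<in> pols M" by (rule pols_of_R)
      then show "g \<in> adjoin M f" unfolding adjoin_def by force
    qed
    moreover have "cut_sets (adjoin M f) \<subseteq> cut_sets M"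
      by (rule cut_sets_subset) (auto simp: adjoin_def intro: f)
    ultimately have "adjoin M f \<in> \<A>" using RM cM by (auto simp: \<A>_def)
    with M(2) Madj have "adjoin M f = M" by blast
    moreover have "f \<in> adjoin M f"
      unfolding adjoin_def using pols_const[of "[:0, 1:]"] by force
    ultimately show "f \<in> M" by simp
  qed
  moreover have "cut_sets M = cut_sets R" using cM cut_sets_mono[OF RM] by blast
  ultimately show ?thesis using that RM by blast
qed

context full_alg
begin

text \<open>For a function given by cases, the premise of \<open>full\<close> splits into the same
  conditions for its two pieces.\<close>

lemma R_if [R_intros]:
  assumes A: "{x. p x} \<in> cut_sets R" and f: "f \<in> R" and g: "g \<in> R"
  shows "(\<lambda>x. if p x then f x else g x) \<in> R"
proof (rule full)
  fix P Q and C :: "'k set" assume "P \<in> pols R" "Q \<in> pols R" "scaling_cut C"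
  then have "{x. p x \<and> poly (P x) (f x) / poly (Q x) (f x) \<in> C
      \<or> \<not> p x \<and> poly (P x) (g x) / poly (Q x) (g x) \<in> C} \<in> cut_sets R"
    using assms by (intro cs_intros R_intros)
  also have "{x. p x \<and> poly (P x) (f x) / poly (Q x) (f x) \<in> C
      \<or> \<not> p x \<and> poly (P x) (g x) / poly (Q x) (g x) \<in> C}
      = {x. poly (P x) (if p x then f x else g x) / poly (Q x) (if p x then f x else g x) \<in> C}"
    by auto
  finally show "{x. poly (P x) (if p x then f x else g x) / poly (Q x) (if p x then f x else g x) \<in> C}
    \<in> cut_sets R" .
qed

lemma R_abs [R_intros]: "f \<in> R \<Longrightarrow> (\<lambda>x. \<bar>f x\<bar>) \<in> R"
  unfolding abs_if by (intro R_intros cs_intros)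

text \<open>Evaluation at \<open>1 / f\<close> amounts to evaluating a reversed polynomial at
  \<open>f\<close>. Numerator and denominator are cleared with the same power \<open>d + e\<close>,
  which then cancels in the quotient.\<close>

lemma R_inverse [R_intros]:
  assumes f: "f \<in> R"
  shows "(\<lambda>x. inverse (f x)) \<in> R"
proof (rule full)
  fix P Q and C :: "'k set" assume P: "P \<in> pols R" and Q: "Q \<in> pols R" and C: "scaling_cut C"
  obtain d e where d: "\<And>x. degree (P x) \<le> d" and e: "\<And>x. degree (Q x) \<le> e"
    using P Q pols_degree by metis
  define h where "h P x = (\<Sum>k\<le>d + e. coeff (P x) k * f x ^ (d + e - k))" for P :: "'x \<Rightarrow> 'k poly" and x
  have h: "poly (P x) (inverse (f x)) = h P x / f x ^ (d + e)"
    if "f x \<noteq> 0" "\<And>x. degree (P x) \<le> d + e" for P x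
  proof -
    have "poly (P x) (inverse (f x)) = (\<Sum>k\<le>d + e. coeff (P x) k * inverse (f x) ^ k)"
      using that(2) by (rule poly_eq_sum_upto)
    also have "\<dots> = (\<Sum>k\<le>d + e. coeff (P x) k * f x ^ (d + e - k) / f x ^ (d + e))"
      using that(1) by (intro sum.cong refl) (simp add: power_diff power_inverse field_simps)
    finally show ?thesis by (simp add: h_def sum_divide_distrib)
  qed
  have hR: "h P \<in> R" "h Q \<in> R"
    unfolding h_def using P Q f by (auto intro!: R_intros)
  have "{x. f x = 0 \<and> poly (P x) 0 / poly (Q x) 0 \<in> C \<or> f x \<noteq> 0 \<and> h P x / h Q x \<in> C} \<in> cut_sets R"
    using P Q f C hR by (intro cs_intros R_intros)
  also have "{x. f x = 0 \<and> poly (P x) 0 / poly (Q x) 0 \<in> C \<or> f x \<noteq> 0 \<and> h P x / h Q x \<in> C}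
      = {x. poly (P x) (inverse (f x)) / poly (Q x) (inverse (f x)) \<in> C}"
  proof (intro Collect_cong)
    fix x
    have "poly (P x) (inverse (f x)) / poly (Q x) (inverse (f x)) = h P x / h Q x" if "f x \<noteq> 0"
      using h[OF that, of P] h[OF that, of Q] d e that by (simp add: trans_le_add1 trans_le_add2)
    then show "(f x = 0 \<and> poly (P x) 0 / poly (Q x) 0 \<in> C \<or> f x \<noteq> 0 \<and> h P x / h Q x \<in> C)
      = (poly (P x) (inverse (f x)) / poly (Q x) (inverse (f x)) \<in> C)"
      by (cases "f x = 0") auto
  qed
  finally show "{x. poly (P x) (inverse (f x)) / poly (Q x) (inverse (f x)) \<in> C} \<in> cut_sets R" .
qed

lemma R_divide [R_intros]: "f \<in> R \<Longrightarrow> g \<in> R \<Longrightarrow> (\<lambda>x. f x / g x) \<in> R"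
  unfolding divide_inverse by (intro R_intros)

lemma pols_if [P_intros]:
  assumes A: "{x. p x} \<in> cut_sets R" and P: "P \<in> pols R" and Q: "Q \<in> pols R"
  shows "(\<lambda>x. if p x then P x else Q x) \<in> pols R"
proof -
  obtain d e where d: "\<And>x. degree (P x) \<le> d" and e: "\<And>x. degree (Q x) \<le> e"
    using P Q pols_degree by metis
  show ?thesis
  proof (rule polsI)
    fix k
    have "(\<lambda>x. coeff (if p x then P x else Q x) k) = (\<lambda>x. if p x then coeff (P x) k else coeff (Q x) k)"
      by auto
    then show "(\<lambda>x. coeff (if p x then P x else Q x) k) \<in> R"
      using assms by (auto intro!: R_intros)
    fix x show "degree (if p x then P x else Q x) \<le> max d e"
      using d[of x] e[of x] by auto
  qed
qed

end

section \<open>Tame functions\<close>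

lemma cmp_mono: "cmp m a b \<Longrightarrow> m \<le> n \<Longrightarrow> cmp n a b"
proof -
  assume c: "cmp m a b" and mn: "m \<le> n"
  have "of_nat m * b \<le> of_nat n * b" "of_nat m * a \<le> of_nat n * a"
    using c mn by (auto simp: cmp_def intro!: mult_right_mono of_nat_mono)
  then show ?thesis using c unfolding cmp_def by linarith
qed

text \<open>Powers are additive on nonnegative elements up to a bounded factor, since both
  \<open>(g + h) ^ N\<close> and \<open>g ^ N + h ^ N\<close> are comparable with
  \<open>max g h ^ N\<close>.\<close>

lemma cmp_power_add:
  assumes g: "0 \<le> g" and h: "0 \<le> h" and N: "N \<ge> 1"
    and gf: "cmp m (g ^ N) f" and hf: "cmp m (h ^ N) f'"
  shows "cmp (2 ^ N * m) ((g + h) ^ N) (f + f')"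
proof -
  have nn: "0 \<le> f" "0 \<le> f'" using gf hf by (auto simp: cmp_def)
  have "(g + h) ^ N \<le> 2 ^ N * (g ^ N + h ^ N)"
  proof -
    have "(g + h) ^ N \<le> (2 * max g h) ^ N"
      using g h by (intro power_mono) (auto simp: max_def)
    also have "\<dots> = 2 ^ N * max g h ^ N" by (simp add: power_mult_distrib)
    also have "\<dots> \<le> 2 ^ N * (g ^ N + h ^ N)"
      using g h by (intro mult_left_mono) (auto simp: max_def)
    finally show ?thesis .
  qed
  also have "\<dots> \<le> 2 ^ N * (of_nat m * f + of_nat m * f')"
    using gf hf by (intro mult_left_mono add_mono) (auto simp: cmp_def)
  finally have 1: "(g + h) ^ N \<le> of_nat (2 ^ N * m) * (f + f')"
    by (simp add: algebra_simps)
  have "f + f' \<le> of_nat m * (g ^ N) + of_nat m * (h ^ N)"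
    using gf hf by (intro add_mono) (auto simp: cmp_def)
  also have "\<dots> \<le> of_nat m * ((g + h) ^ N) + of_nat m * ((g + h) ^ N)"
    using g h by (intro add_mono mult_left_mono power_mono) auto
  also have "\<dots> = of_nat (2 ^ 1 * m) * (g + h) ^ N" by simp
  also have "\<dots> \<le> of_nat (2 ^ N * m) * (g + h) ^ N"
    using g h N by (intro mult_right_mono of_nat_mono mult_le_mono1 power_increasing) auto
  finally have 2: "f + f' \<le> of_nat (2 ^ N * m) * (g + h) ^ N" .
  show ?thesis using 1 2 g h nn by (simp add: cmp_def)
qed

context full_alg
begin

text \<open>A function is tame if some power of it agrees with elements of \<open>R\<close>, up to a bounded factor
  and piecewise. Scaling cuts do not see the bounded factor, and powers only transform them.\<close>

definition tame_piece :: "'x set \<Rightarrow> ('x \<Rightarrow> 'k) \<Rightarrow> bool" where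
  "tame_piece D g \<longleftrightarrow> (\<exists>N\<ge>1. \<exists>m. \<exists>f\<in>R. \<forall>x\<in>D. 0 \<le> g x \<and> cmp m (g x ^ N) (f x))"

definition tame :: "'x set \<Rightarrow> ('x \<Rightarrow> 'k) \<Rightarrow> bool" where
  "tame D g \<longleftrightarrow> (\<exists>\<E>. finite \<E> \<and> \<E> \<subseteq> cut_sets R \<and> D \<subseteq> \<Union>\<E> \<and> (\<forall>E\<in>\<E>. tame_piece (D \<inter> E) g))"

lemma tame_pieceI:
  "N \<ge> 1 \<Longrightarrow> f \<in> R \<Longrightarrow> (\<And>x. x \<in> D \<Longrightarrow> 0 \<le> g x) \<Longrightarrow> (\<And>x. x \<in> D \<Longrightarrow> cmp m (g x ^ N) (f x)) \<Longrightarrow>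
    tame_piece D g"
  unfolding tame_piece_def by (intro exI[of _ N] exI[of _ m] conjI bexI[of _ f] ballI) auto

lemma tame_pieceE:
  assumes "tame_piece D g"
  obtains N m f where "N \<ge> 1" "f \<in> R" "\<forall>x\<in>D. 0 \<le> g x" "\<forall>x\<in>D. cmp m (g x ^ N) (f x)"
proof -
  from assms obtain N m f where "N \<ge> 1" "f \<in> R" "\<forall>x\<in>D. 0 \<le> g x \<and> cmp m (g x ^ N) (f x)"
    unfolding tame_piece_def by auto
  then show ?thesis by (intro that[of N f m]) auto
qed

lemma tame_piece_subset:
  assumes "tame_piece D g" "D' \<subseteq> D"
  shows "tame_piece D' g"
proof (rule tame_pieceE[OF assms(1)])
  fix N m f assume "N \<ge> 1" "f \<in> R" "\<forall>x\<in>D. 0 \<le> g x" "\<forall>x\<in>D. cmp m (g x ^ N) (f x)"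
  then show ?thesis using assms(2) by (intro tame_pieceI[of N f D' g m]) auto
qed

lemma UNIV_cs: "UNIV \<in> cut_sets R"
  using cs_const[of True] by simp

lemma tame_of_piece: "tame_piece D g \<Longrightarrow> tame D g"
  unfolding tame_def by (intro exI[of _ "{UNIV}"]) (auto simp: UNIV_cs)

lemma tame_cases:
  assumes fin: "finite I" and E: "\<And>i. i \<in> I \<Longrightarrow> E i \<in> cut_sets R" and cov: "D \<subseteq> (\<Union>i\<in>I. E i)"
    and t: "\<And>i. i \<in> I \<Longrightarrow> tame (D \<inter> E i) g"
  shows "tame D g"
proof -
  have "\<forall>i\<in>I. \<exists>\<E>. finite \<E> \<and> \<E> \<subseteq> cut_sets R \<and> D \<inter> E i \<subseteq> \<Union>\<E> \<and>
      (\<forall>F\<in>\<E>. tame_piece ((D \<inter> E i) \<inter> F) g)"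
    using t unfolding tame_def by blast
  from bchoice[OF this] obtain F where F': "\<forall>i\<in>I. finite (F i) \<and> F i \<subseteq> cut_sets R \<and>
      D \<inter> E i \<subseteq> \<Union>(F i) \<and> (\<forall>G\<in>F i. tame_piece ((D \<inter> E i) \<inter> G) g)"
    by (elim exE)
  note F = F'[rule_format]
  define \<E> where "\<E> = (\<Union>i\<in>I. (\<inter>) (E i) ` F i)"
  have "finite \<E>" using fin F by (auto simp: \<E>_def)
  moreover have "\<E> \<subseteq> cut_sets R"
  proof
    fix G assume "G \<in> \<E>"
    then obtain i H where "i \<in> I" "H \<in> F i" "G = E i \<inter> H" by (auto simp: \<E>_def)
    then show "G \<in> cut_sets R" using E[of i] F[of i] by (auto intro!: cut_sets.inter)
  qed
  moreover have "D \<subseteq> \<Union>\<E>"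
  proof
    fix x assume x: "x \<in> D"
    then obtain i where i: "i \<in> I" "x \<in> E i" using cov by blast
    then obtain G where "G \<in> F i" "x \<in> G" using F[OF i(1)] x by blast
    then show "x \<in> \<Union>\<E>" using i by (auto simp: \<E>_def)
  qed
  moreover have "tame_piece (D \<inter> G) g" if G: "G \<in> \<E>" for G
  proof -
    from G obtain i H where "i \<in> I" "H \<in> F i" "G = E i \<inter> H" by (auto simp: \<E>_def)
    then show ?thesis using F[of i] by (auto simp: Int_assoc)
  qed
  ultimately show ?thesis unfolding tame_def by blast
qed

definition tame_pair :: "'x set \<Rightarrow> ('x \<Rightarrow> 'k) \<Rightarrow> ('x \<Rightarrow> 'k) \<Rightarrow> bool" where
  "tame_pair D g h \<longleftrightarrow> (\<exists>N\<ge>1. \<exists>m. \<exists>f\<in>R. \<exists>f'\<in>R. \<forall>x\<in>D.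
     0 \<le> g x \<and> 0 \<le> h x \<and> cmp m (g x ^ N) (f x) \<and> cmp m (h x ^ N) (f' x))"

lemma tame_pairE:
  assumes "tame_pair D g h"
  obtains N m f f' where "N \<ge> 1" "f \<in> R" "f' \<in> R"
    "\<forall>x\<in>D. 0 \<le> g x \<and> 0 \<le> h x \<and> cmp m (g x ^ N) (f x) \<and> cmp m (h x ^ N) (f' x)"
  using assms unfolding tame_pair_def by (elim exE conjE bexE) (rule that; assumption)

text \<open>Raising to the product of the two exponents yields a common exponent, which sums and
  quotients of tame functions require.\<close>

lemma tame_common:
  assumes "tame D g" "tame D h"
  obtains \<E> where "finite \<E>" "\<E> \<subseteq> cut_sets R" "D \<subseteq> \<Union>\<E>"
    "\<And>E. E \<in> \<E> \<Longrightarrow> tame_pair (D \<inter> E) g h"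
proof -
  obtain \<E>1 where 1: "finite \<E>1" "\<E>1 \<subseteq> cut_sets R" "D \<subseteq> \<Union>\<E>1" "\<And>E. E \<in> \<E>1 \<Longrightarrow> tame_piece (D \<inter> E) g"
    using assms(1) unfolding tame_def by blast
  obtain \<E>2 where 2: "finite \<E>2" "\<E>2 \<subseteq> cut_sets R" "D \<subseteq> \<Union>\<E>2" "\<And>E. E \<in> \<E>2 \<Longrightarrow> tame_piece (D \<inter> E) h"
    using assms(2) unfolding tame_def by blast
  define \<E> where "\<E> = (\<lambda>(A, B). A \<inter> B) ` (\<E>1 \<times> \<E>2)"
  show ?thesis
  proof (rule that[of \<E>])
    show "finite \<E>" using 1 2 by (simp add: \<E>_def)
    show "\<E> \<subseteq> cut_sets R" using 1 2 by (auto simp: \<E>_def intro!: cut_sets.inter)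
    show "D \<subseteq> \<Union>\<E>"
    proof
      fix x assume "x \<in> D"
      then obtain A B where "A \<in> \<E>1" "x \<in> A" "B \<in> \<E>2" "x \<in> B" using 1 2 by blast
      then show "x \<in> \<Union>\<E>" by (auto simp: \<E>_def)
    qed
    fix E assume "E \<in> \<E>"
    then obtain A B where AB: "E = A \<inter> B" "A \<in> \<E>1" "B \<in> \<E>2" by (auto simp: \<E>_def)
    obtain N m f where g: "N \<ge> 1" "f \<in> R" "\<forall>x\<in>D \<inter> A. 0 \<le> g x"
      "\<forall>x\<in>D \<inter> A. cmp m (g x ^ N) (f x)"
      using 1(4)[OF AB(2)] by (rule tame_pieceE)
    obtain N' m' f' where h: "N' \<ge> 1" "f' \<in> R" "\<forall>x\<in>D \<inter> B. 0 \<le> h x"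
      "\<forall>x\<in>D \<inter> B. cmp m' (h x ^ N') (f' x)"
      using 2(4)[OF AB(3)] by (rule tame_pieceE)
    define n where "n = max (m ^ N') (m' ^ N)"
    have r: "(\<lambda>x. f x ^ N') \<in> R" "(\<lambda>x. f' x ^ N) \<in> R" using g h by (auto intro: R_intros)
    have body: "\<forall>x\<in>D \<inter> E. 0 \<le> g x \<and> 0 \<le> h x \<and> cmp n (g x ^ (N * N')) (f x ^ N') \<and>
      cmp n (h x ^ (N * N')) (f' x ^ N)"
    proof (intro ballI conjI)
      fix x assume x: "x \<in> D \<inter> E"
      show "0 \<le> g x" "0 \<le> h x" using x g h AB by auto
      have "cmp (m ^ N') ((g x ^ N) ^ N') (f x ^ N')" using x g AB by (intro cmp_power) auto
      then show "cmp n (g x ^ (N * N')) (f x ^ N')"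
        unfolding power_mult by (rule cmp_mono) (simp add: n_def)
      have "cmp (m' ^ N) ((h x ^ N') ^ N) (f' x ^ N)" using x h AB by (intro cmp_power) auto
      then show "cmp n (h x ^ (N * N')) (f' x ^ N)"
        unfolding mult.commute[of N] power_mult by (rule cmp_mono) (simp add: n_def)
    qed
    have N: "1 \<le> N * N'" using g(1) h(1) by simp
    show "tame_pair (D \<inter> E) g h"
      unfolding tame_pair_def
      by (rule exI[of _ "N * N'"], rule conjI[OF N], rule exI[of _ n],
          rule bexI[OF _ r(1)], rule bexI[OF _ r(2)], rule body)
  qed
qed

lemma tame_mult:
  assumes "tame D g" "tame D h"
  shows "tame D (\<lambda>x. g x * h x)"
proof (rule tame_common[OF assms])
  fix \<E> assume \<E>: "finite \<E>" "\<E> \<subseteq> cut_sets R" "D \<subseteq> \<Union>\<E>" and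
    p: "\<And>E. E \<in> \<E> \<Longrightarrow> tame_pair (D \<inter> E) g h"
  have "tame_piece (D \<inter> E) (\<lambda>x. g x * h x)" if E: "E \<in> \<E>" for E
  proof -
    obtain N m f f' where *: "N \<ge> 1" "f \<in> R" "f' \<in> R" "\<forall>x\<in>D \<inter> E.
       0 \<le> g x \<and> 0 \<le> h x \<and> cmp m (g x ^ N) (f x) \<and> cmp m (h x ^ N) (f' x)"
      using p[OF E] by (rule tame_pairE)
    show ?thesis
    proof (rule tame_pieceI[OF *(1) R_mult[OF *(2,3)]])
      fix x assume "x \<in> D \<inter> E"
      from *(4)[rule_format, OF this] show "0 \<le> g x * h x" "cmp (m * m) ((g x * h x) ^ N) (f x * f' x)"
        by (auto simp: power_mult_distrib intro: cmp_mult)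
    qed
  qed
  with \<E> show ?thesis unfolding tame_def by blast
qed

lemma tame_add:
  assumes "tame D g" "tame D h"
  shows "tame D (\<lambda>x. g x + h x)"
proof (rule tame_common[OF assms])
  fix \<E> assume \<E>: "finite \<E>" "\<E> \<subseteq> cut_sets R" "D \<subseteq> \<Union>\<E>" and
    p: "\<And>E. E \<in> \<E> \<Longrightarrow> tame_pair (D \<inter> E) g h"
  have "tame_piece (D \<inter> E) (\<lambda>x. g x + h x)" if E: "E \<in> \<E>" for E
  proof -
    obtain N m f f' where *: "N \<ge> 1" "f \<in> R" "f' \<in> R" "\<forall>x\<in>D \<inter> E.
       0 \<le> g x \<and> 0 \<le> h x \<and> cmp m (g x ^ N) (f x) \<and> cmp m (h x ^ N) (f' x)"
      using p[OF E] by (rule tame_pairE)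
    show ?thesis
    proof (rule tame_pieceI[OF *(1) R_add[OF *(2,3)]])
      fix x assume "x \<in> D \<inter> E"
      from *(4)[rule_format, OF this] show "0 \<le> g x + h x" "cmp (2 ^ N * m) ((g x + h x) ^ N) (f x + f' x)"
        using *(1) by (auto intro: cmp_power_add)
    qed
  qed
  with \<E> show ?thesis unfolding tame_def by blast
qed

lemma tame_R:
  assumes "f \<in> R" "\<And>x. x \<in> D \<Longrightarrow> 0 \<le> f x"
  shows "tame D f"
  by (rule tame_of_piece, rule tame_pieceI[of 1 f _ _ 1]) (auto simp: assms cmp_def)

lemma tame_power: "tame D g \<Longrightarrow> tame D (\<lambda>x. g x ^ n)"
  by (induction n) (auto intro: tame_mult tame_R R_intros)

lemma tame_sum:
  "finite I \<Longrightarrow> (\<And>i. i \<in> I \<Longrightarrow> tame D (g i)) \<Longrightarrow> tame D (\<lambda>x. \<Sum>i\<in>I. g i x)"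
  by (induction I rule: finite_induct) (auto intro: tame_add tame_R R_intros)

lemma tame_cmp:
  assumes "tame D h" and "\<And>x. x \<in> D \<Longrightarrow> cmp m (g x) (h x)"
  shows "tame D g"
proof -
  obtain \<E> where \<E>: "finite \<E>" "\<E> \<subseteq> cut_sets R" "D \<subseteq> \<Union>\<E>" "\<And>E. E \<in> \<E> \<Longrightarrow> tame_piece (D \<inter> E) h"
    using assms(1) unfolding tame_def by blast
  have "tame_piece (D \<inter> E) g" if E: "E \<in> \<E>" for E
  proof -
    obtain N n f where *: "N \<ge> 1" "f \<in> R" "\<forall>x\<in>D \<inter> E. 0 \<le> h x"
      "\<forall>x\<in>D \<inter> E. cmp n (h x ^ N) (f x)"
      using \<E>(4)[OF E] by (rule tame_pieceE)
    show ?thesis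
    proof (rule tame_pieceI[OF *(1,2)])
      fix x assume x: "x \<in> D \<inter> E"
      show "0 \<le> g x" using assms(2) x by (auto simp: cmp_def)
      show "cmp (m ^ N * n) (g x ^ N) (f x)"
        using assms(2) x *(4) by (auto intro!: cmp_trans cmp_power)
    qed
  qed
  with \<E> show ?thesis unfolding tame_def by blast
qed

lemma tame_subset:
  assumes "tame D g" "D' \<subseteq> D"
  shows "tame D' g"
proof -
  obtain \<E> where \<E>: "finite \<E>" "\<E> \<subseteq> cut_sets R" "D \<subseteq> \<Union>\<E>" "\<And>E. E \<in> \<E> \<Longrightarrow> tame_piece (D \<inter> E) g"
    using assms(1) unfolding tame_def by blast
  have "tame_piece (D' \<inter> E) g" if "E \<in> \<E>" for E
    using \<E>(4)[OF that] by (rule tame_piece_subset) (use assms(2) in auto)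
  moreover have "D' \<subseteq> \<Union>\<E>" using \<E>(3) assms(2) by (rule subset_trans[rotated])
  ultimately show ?thesis using \<E>(1,2) unfolding tame_def by (intro exI[of _ \<E>]) simp
qed

text \<open>The purpose of tameness: \<open>g / h\<close> is tested against \<open>C\<close> by
  testing its \<open>N\<close>-th power, comparable with \<open>f / f'\<close>, against the power
  image of \<open>C\<close>.\<close>

lemma cs_tame_quotient:
  assumes D: "D \<in> cut_sets R" and t: "tame D g" "tame D h" and C: "scaling_cut C"
  shows "{x. x \<in> D \<and> g x / h x \<in> C} \<in> cut_sets R"
proof (rule tame_common[OF t])
  fix \<E> assume \<E>: "finite \<E>" "\<E> \<subseteq> cut_sets R" "D \<subseteq> \<Union>\<E>" and
    p: "\<And>E. E \<in> \<E> \<Longrightarrow> tame_pair (D \<inter> E) g h"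
  have "{x. x \<in> D \<and> x \<in> E \<and> g x / h x \<in> C} \<in> cut_sets R" if E: "E \<in> \<E>" for E
  proof -
    obtain N m f f' where *: "N \<ge> 1" "f \<in> R" "f' \<in> R" "\<forall>x\<in>D \<inter> E.
       0 \<le> g x \<and> 0 \<le> h x \<and> cmp m (g x ^ N) (f x) \<and> cmp m (h x ^ N) (f' x)"
      using p[OF E] by (rule tame_pairE)
    define C' where "C' = {z. 0 < z \<and> (\<exists>u\<in>C. z \<le> u ^ N)}"
    have C': "scaling_cut C'" unfolding C'_def by (rule scaling_cut_power_image[OF C *(1)])
    have "{x. x \<in> D \<and> x \<in> E \<and> f x / f' x \<in> C'} \<in> cut_sets R"
      using D E \<E>(2) *(2,3) C' by (intro cs_intros) auto
    also have "{x. x \<in> D \<and> x \<in> E \<and> f x / f' x \<in> C'} = {x. x \<in> D \<and> x \<in> E \<and> g x / h x \<in> C}"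
    proof (intro Collect_cong conj_cong refl)
      fix x assume "x \<in> D" "x \<in> E"
      then have x: "0 \<le> g x" "0 \<le> h x" "cmp m (g x ^ N) (f x)" "cmp m (h x ^ N) (f' x)"
        using *(4) by auto
      have "f x / f' x \<in> C' \<longleftrightarrow> g x ^ N / h x ^ N \<in> C'"
        using cmp_divide_iff[OF C' x(3,4)] by simp
      also have "\<dots> \<longleftrightarrow> g x / h x \<in> C"
        unfolding C'_def power_divide[symmetric] using x by (intro power_mem_cut_iff[OF C *(1)]) auto
      finally show "f x / f' x \<in> C' \<longleftrightarrow> g x / h x \<in> C" .
    qed
    finally show ?thesis .
  qed
  then have "{x. \<exists>E\<in>\<E>. x \<in> D \<and> x \<in> E \<and> g x / h x \<in> C} \<in> cut_sets R"
    using \<E>(1) by (intro cs_bex)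
  also have "{x. \<exists>E\<in>\<E>. x \<in> D \<and> x \<in> E \<and> g x / h x \<in> C} = {x. x \<in> D \<and> g x / h x \<in> C}"
    using \<E>(3) by auto
  finally show ?thesis .
qed

text \<open>The functions in \<open>F\<close> may also take values that are not roots. Nothing is
  asked where \<open>P x\<close> is zero, as every element is a root there.\<close>

definition root_cover :: "('x \<Rightarrow> 'k poly) \<Rightarrow> ('x \<Rightarrow> 'k) set \<Rightarrow> bool" where
  "root_cover P F \<longleftrightarrow> finite F \<and> F \<subseteq> R \<and> (\<forall>x y. P x \<noteq> 0 \<longrightarrow> poly (P x) y = 0 \<longrightarrow> (\<exists>f\<in>F. f x = y))"

lemma root_coverD: "root_cover P F \<Longrightarrow> P x \<noteq> 0 \<Longrightarrow> poly (P x) y = 0 \<Longrightarrow> \<exists>f\<in>F. f x = y"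
  unfolding root_cover_def by blast

end

section \<open>Roots of polynomials with coefficients in a full algebra\<close>

lemma degree_pderiv_funpow: "degree ((pderiv ^^ k) (p :: 'a::field_char_0 poly)) = degree p - k"
  by (induction k) (auto simp: degree_pderiv)

lemma pderiv_funpow_eq_0:
  fixes p :: "'a::field_char_0 poly"
  assumes "degree p < k"
  shows "(pderiv ^^ k) p = 0"
proof -
  obtain j where k: "k = Suc j" "degree p \<le> j" using assms by (cases k) auto
  then have "degree ((pderiv ^^ j) p) = 0" by (simp add: degree_pderiv_funpow)
  then show ?thesis by (simp add: k pderiv_eq_0_iff)
qed

text \<open>The upper estimate is the triangle inequality, the lower one is
  \<open>coeff_sum_le\<close> for the expansion at \<open>c\<close> in direction \<open>e\<close>.
  The points \<open>c + e * y\<close> with \<open>0 < y < 2 * z\<close> form the open ball of radius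
  \<open>z\<close> around the evaluation point, so the condition holds whenever no root of a
  derivative is closer to that point than \<open>c\<close>.\<close>

lemma poly_near_cmp:
  assumes rc: "real_closed TYPE('k::linordered_field)"
  obtains m where "\<And>(p :: 'k poly) c e z. degree p \<le> n \<Longrightarrow> \<bar>e\<bar> = 1 \<Longrightarrow> 0 < z \<Longrightarrow>
    (\<And>k y. 0 < y \<Longrightarrow> y < 2 * z \<Longrightarrow> (pderiv ^^ k) p \<noteq> 0 \<Longrightarrow> poly ((pderiv ^^ k) p) (c + e * y) \<noteq> 0) \<Longrightarrow>
    cmp m \<bar>poly p (c + e * z)\<bar> (\<Sum>k\<le>n. \<bar>coeff (pcompose p [:c, e:]) k\<bar> * z ^ k)"
proof -
  obtain m where m: "\<And>(q :: 'k poly) z. degree q \<le> n \<Longrightarrow> 0 < z \<Longrightarrow>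
    (\<And>k y. 0 < y \<Longrightarrow> y < 2 * z \<Longrightarrow> (pderiv ^^ k) q \<noteq> 0 \<Longrightarrow> poly ((pderiv ^^ k) q) y \<noteq> 0) \<Longrightarrow>
    (\<Sum>k\<le>n. \<bar>coeff q k\<bar> * z ^ k) \<le> of_nat m * \<bar>poly q z\<bar>"
    by (fact coeff_sum_le[OF rc, of n])
  show ?thesis
  proof (rule that[of "max m 1"])
    fix p :: "'k poly" and c e z :: 'k
    assume deg: "degree p \<le> n" and e: "\<bar>e\<bar> = 1" and z: "0 < z"
      and nz: "\<And>k y. 0 < y \<Longrightarrow> y < 2 * z \<Longrightarrow> (pderiv ^^ k) p \<noteq> 0 \<Longrightarrow> poly ((pderiv ^^ k) p) (c + e * y) \<noteq> 0"
    define q where "q = pcompose p [:c, e:]"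
    define S where "S = (\<Sum>k\<le>n. \<bar>coeff q k\<bar> * z ^ k)"
    have e0: "e \<noteq> 0" using e by auto
    have degq: "degree q \<le> n" using deg e0 by (simp add: q_def degree_pcompose)
    have le: "S \<le> of_nat m * \<bar>poly q z\<bar>"
      unfolding S_def
    proof (rule m[OF degq z])
      fix k y assume y: "0 < y" "y < 2 * z" and nq: "(pderiv ^^ k) q \<noteq> 0"
      then have "(pderiv ^^ k) p \<noteq> 0" by (auto simp: q_def pderiv_funpow_pcompose_linear)
      with nz[OF y] e0 show "poly ((pderiv ^^ k) q) y \<noteq> 0"
        by (simp add: q_def pderiv_funpow_pcompose_linear poly_pcompose mult.commute)
    qed
    have "\<bar>poly q z\<bar> \<le> S"
      unfolding poly_eq_sum_upto[OF degq] S_def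
      by (rule order_trans[OF sum_abs]) (use z in \<open>simp add: abs_mult\<close>)
    then have "cmp (max m 1) \<bar>poly q z\<bar> S"
    proof -
      assume a: "\<bar>poly q z\<bar> \<le> S"
      then have S0: "0 \<le> S" by linarith
      have "of_nat 1 * S \<le> of_nat (max m 1) * S"
        by (intro mult_right_mono of_nat_mono S0) simp
      moreover have "of_nat m * \<bar>poly q z\<bar> \<le> of_nat (max m 1) * \<bar>poly q z\<bar>"
        by (intro mult_right_mono of_nat_mono) simp_all
      moreover have "0 \<le> \<bar>poly q z\<bar>" by simp
      ultimately show ?thesis using a le S0 unfolding cmp_def of_nat_1 mult_1 by linarith
    qed
    moreover have "poly q z = poly p (c + e * z)" by (simp add: q_def poly_pcompose mult.commute)
    ultimately show "cmp (max m 1) \<bar>poly p (c + e * z)\<bar> (\<Sum>k\<le>n. \<bar>coeff (pcompose p [:c, e:]) k\<bar> * z ^ k)"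
      by (simp add: S_def q_def)
  qed
qed

text \<open>Hence one Taylor expansion serves both sides of \<open>c\<close>.\<close>

lemma abs_coeff_pcompose_reflect:
  fixes p :: "'k::linordered_field poly"
  assumes "\<bar>e\<bar> = 1"
  shows "\<bar>coeff (pcompose p [:c, e:]) k\<bar> = \<bar>coeff (pcompose p [:c, 1:]) k\<bar>"
proof -
  have "[:c, e:] = pcompose [:c, 1:] [:0, e:]" by (simp add: pcompose_pCons)
  then have "pcompose p [:c, e:] = pcompose (pcompose p [:c, 1:]) [:0, e:]"
    by (simp add: pcompose_assoc)
  then show ?thesis
    using assms by (simp add: coeff_pcompose_linear abs_mult power_abs)
qed

lemma finite_neighbours:
  fixes G :: "'k::linorder set"
  assumes fin: "finite G" and ab: "a \<in> G" "b \<in> G" "a < y" "y < b" and y: "y \<notin> G"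
  shows "\<exists>g\<in>G. \<exists>h\<in>G. g < y \<and> y < h \<and> (\<forall>k\<in>G. \<not> (g < k \<and> k < h))"
proof -
  define L U where "L = {k \<in> G. k < y}" and "U = {k \<in> G. y < k}"
  have LU: "finite L" "finite U" "L \<noteq> {}" "U \<noteq> {}" using fin ab by (auto simp: L_def U_def)
  have 1: "Max L \<in> L" "Min U \<in> U" using LU by auto
  have "\<not> (Max L < k \<and> k < Min U)" if k: "k \<in> G" for k
  proof
    assume *: "Max L < k \<and> k < Min U"
    have "k \<noteq> y" using k y by auto
    then have "k \<in> L \<or> k \<in> U" using k by (auto simp: L_def U_def)
    then have "k \<le> Max L \<or> Min U \<le> k" using LU by auto
    with * show False by auto
  qed
  then show ?thesis using 1 by (intro bexI[of _ "Max L"] bexI[of _ "Min U"]) (auto simp: L_def U_def)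
qed

lemma poly_pos_iff_between:
  fixes q :: "'k::linordered_field poly"
  assumes rc: "real_closed TYPE('k)" and nz: "\<And>z. g < z \<Longrightarrow> z < h \<Longrightarrow> poly q z \<noteq> 0"
    and y: "g < y" "y < h" and y': "g < y'" "y' < h"
  shows "0 < poly q y \<longleftrightarrow> 0 < poly q y'"
proof -
  have "0 < poly q (min y y') * poly q (max y y')"
    using y y' by (intro real_closed_poly_same_sign[OF rc] nz) (auto simp: min_def max_def split: if_splits)
  then show ?thesis by (auto simp: min_def max_def zero_less_mult_iff split: if_splits)
qed

text \<open>Cauchy's bound. It supplies end points for the outermost intervals between critical
  points.\<close>

lemma monic_root_bound:
  fixes p :: "'k::linordered_field poly"
  assumes deg: "degree p \<le> d" and monic: "coeff p d = 1" and d: "d \<ge> 1" and y: "poly p y = 0"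
  shows "\<bar>y\<bar> < 1 + (\<Sum>k\<le>d. \<bar>coeff p k\<bar>)"
proof (rule ccontr)
  define S where "S = (\<Sum>k\<le>d. \<bar>coeff p k\<bar>)"
  assume "\<not> \<bar>y\<bar> < 1 + (\<Sum>k\<le>d. \<bar>coeff p k\<bar>)"
  then have yS: "1 + S \<le> \<bar>y\<bar>" by (simp add: S_def)
  have S0: "0 \<le> S" unfolding S_def by (rule sum_nonneg) simp
  obtain n where n: "d = Suc n" using d by (cases d) auto
  have y1: "1 \<le> \<bar>y\<bar>" using yS S0 by linarith
  have "(\<Sum>k\<le>n. coeff p k * y ^ k) + y ^ Suc n = 0"
    using y poly_eq_sum_upto[OF deg, of y] monic by (simp add: n)
  then have "y ^ Suc n = - (\<Sum>k\<le>n. coeff p k * y ^ k)" by (simp only: eq_neg_iff_add_eq_0 add.commute)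
  then have "\<bar>y\<bar> ^ Suc n = \<bar>\<Sum>k\<le>n. coeff p k * y ^ k\<bar>"
    unfolding power_abs[symmetric] by (simp only: abs_minus_cancel)
  also have "\<dots> \<le> (\<Sum>k\<le>n. \<bar>coeff p k\<bar> * \<bar>y\<bar> ^ n)"
    by (rule order_trans[OF sum_abs], rule sum_mono)
      (use y1 in \<open>auto simp: abs_mult power_abs intro!: mult_left_mono power_increasing\<close>)
  also have "\<dots> = (\<Sum>k\<le>n. \<bar>coeff p k\<bar>) * \<bar>y\<bar> ^ n" by (simp add: sum_distrib_right)
  also have "\<dots> \<le> S * \<bar>y\<bar> ^ n"
    by (rule mult_right_mono) (auto simp: S_def n)
  finally have "\<bar>y\<bar> * \<bar>y\<bar> ^ n \<le> S * \<bar>y\<bar> ^ n" by simp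
  moreover have "0 < \<bar>y\<bar> ^ n" using y1 by (intro zero_less_power) linarith
  ultimately have "\<bar>y\<bar> \<le> S" by (simp only: mult_le_cancel_right_pos)
  with yS show False by linarith
qed

context full_alg
begin

lemma derivs_cover:
  assumes P: "\<And>x. degree (P x) \<le> n"
    and cov: "\<And>k. k \<le> n \<Longrightarrow> \<exists>F. root_cover (\<lambda>x. (pderiv ^^ k) (P x)) F"
  obtains G where "finite G" "G \<subseteq> R" "G \<noteq> {}"
    "\<And>x k y. (pderiv ^^ k) (P x) \<noteq> 0 \<Longrightarrow> poly ((pderiv ^^ k) (P x)) y = 0 \<Longrightarrow> \<exists>g\<in>G. g x = y"
proof -
  have "\<forall>k\<in>{..n}. \<exists>F. root_cover (\<lambda>x. (pderiv ^^ k) (P x)) F" using cov by simp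
  from bchoice[OF this] obtain F where F: "\<forall>k\<in>{..n}. root_cover (\<lambda>x. (pderiv ^^ k) (P x)) (F k)"
    by (elim exE)
  \<comment> \<open>The zero function makes \<open>G\<close> nonempty, so that a nearest member
    exists.\<close>
  define G where "G = insert (\<lambda>_. 0) (\<Union>k\<le>n. F k)"
  show ?thesis
  proof (rule that[of G])
    show "finite G" "G \<subseteq> R" "G \<noteq> {}" using F R_const by (auto simp: G_def root_cover_def)
    fix x k y assume k: "(pderiv ^^ k) (P x) \<noteq> 0" "poly ((pderiv ^^ k) (P x)) y = 0"
    have "k \<le> n" using k(1) pderiv_funpow_eq_0[of "P x" k] P[of x] by (metis leI le_less_trans)
    then have "\<exists>f\<in>F k. f x = y"
      using root_coverD[of "\<lambda>x. (pderiv ^^ k) (P x)" "F k" x y] k F by auto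
    then show "\<exists>g\<in>G. g x = y" using \<open>k \<le> n\<close> by (auto simp: G_def)
  qed
qed

end

text \<open>One step of Cohen's induction. Over \<open>A\<close>, \<open>r x\<close> is the only
  root of the monic \<open>M x\<close> between two functions of \<open>R\<close> that enclose no
  critical point, and polynomials of degree below \<open>d\<close> already have root covers. The
  value 0 off \<open>A\<close> makes \<open>r\<close> a total function, to which fullness can be
  applied.\<close>

locale root_step = full_alg R for R :: "('x \<Rightarrow> 'k::linordered_field) set" +
  fixes d :: nat and M :: "'x \<Rightarrow> 'k poly" and A :: "'x set" and s t r :: "'x \<Rightarrow> 'k"
  assumes IH: "\<And>Q. Q \<in> pols R \<Longrightarrow> (\<And>x. degree (Q x) < d) \<Longrightarrow> \<exists>F. root_cover Q F"
    and M: "M \<in> pols R" and d: "d \<ge> 1" and deg: "\<And>x. degree (M x) \<le> d" and monic: "\<And>x. coeff (M x) d = 1"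
    and A: "A \<in> cut_sets R" and s: "s \<in> R" and t: "t \<in> R"
    and r_between: "\<And>x. x \<in> A \<Longrightarrow> s x < r x" "\<And>x. x \<in> A \<Longrightarrow> r x < t x"
    and r_root: "\<And>x. x \<in> A \<Longrightarrow> poly (M x) (r x) = 0"
    and crit: "\<And>x y. x \<in> A \<Longrightarrow> s x < y \<Longrightarrow> y < t x \<Longrightarrow> poly (pderiv (M x)) y \<noteq> 0"
    and off: "\<And>x. x \<notin> A \<Longrightarrow> r x = 0"
begin

definition below :: "('x \<Rightarrow> 'k) \<Rightarrow> 'x set" where "below u = {x. x \<in> A \<and> u x < r x}"
definition hits :: "('x \<Rightarrow> 'k) \<Rightarrow> 'x set" where "hits u = {x. x \<in> A \<and> u x = r x}"
definition above :: "('x \<Rightarrow> 'k) \<Rightarrow> 'x set" where "above u = {x. x \<in> A \<and> r x < u x}"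
definition pos :: "('x \<Rightarrow> 'k poly) \<Rightarrow> 'x set" where "pos Q = {x. x \<in> A \<and> 0 < poly (Q x) (r x)}"

lemma M_nz: "M x \<noteq> 0" using monic[of x] by auto

text \<open>Between \<open>s\<close> and \<open>t\<close>, the position of \<open>u\<close> relative
  to the root is decided by whether \<open>M\<close> has the same sign at \<open>u\<close> as at
  \<open>s\<close>.\<close>

lemma below_cs [cs_intros]:
  assumes u: "u \<in> R"
  shows "below u \<in> cut_sets R"
proof -
  have "{x. x \<in> A \<and> (u x \<le> s x \<or> s x \<le> u x \<and> u x \<le> t x \<and>
      0 < poly (M x) (u x) * poly (M x) (s x))} \<in> cut_sets R" (is "?S \<in> _")
    using A s t u M by (intro cs_intros R_intros)
  also have "?S = below u"
    unfolding below_def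
  proof (intro Collect_cong conj_cong refl)
    fix x assume x: "x \<in> A"
    have "u x < r x \<longleftrightarrow> 0 < poly (M x) (u x) * poly (M x) (s x)" if "s x \<le> u x" "u x \<le> t x"
      using root_between_critical_points(3)[OF rc M_nz crit[OF x] r_between[OF x] r_root[OF x] that] .
    then show "(u x \<le> s x \<or> s x \<le> u x \<and> u x \<le> t x \<and> 0 < poly (M x) (u x) * poly (M x) (s x))
      = (u x < r x)"
      using r_between[OF x] by (meson le_less_trans less_imp_le less_le_trans not_le)
  qed
  finally show ?thesis .
qed

lemma hits_cs [cs_intros]:
  assumes u: "u \<in> R"
  shows "hits u \<in> cut_sets R"
proof -
  have "{x. x \<in> A \<and> (s x < u x \<and> u x < t x \<and> poly (M x) (u x) = 0)} \<in> cut_sets R" (is "?S \<in> _")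
    using A s t u M by (intro cs_intros R_intros)
  also have "?S = hits u"
    unfolding hits_def
  proof (intro Collect_cong conj_cong refl)
    fix x assume x: "x \<in> A"
    have "u x = r x" if "s x < u x" "u x < t x" "poly (M x) (u x) = 0"
      using root_between_critical_points(2)[OF rc M_nz crit[OF x] r_between[OF x] r_root[OF x] that] .
    then show "(s x < u x \<and> u x < t x \<and> poly (M x) (u x) = 0) = (u x = r x)"
      using r_between[OF x] r_root[OF x] by metis
  qed
  finally show ?thesis .
qed

lemma above_cs [cs_intros]:
  assumes u: "u \<in> R"
  shows "above u \<in> cut_sets R"
proof -
  have "{x. x \<in> A \<and> \<not> x \<in> below u \<and> \<not> x \<in> hits u} \<in> cut_sets R" (is "?S \<in> _")
    using A u by (intro cs_intros)
  also have "?S = above u" by (auto simp: above_def below_def hits_def)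
  finally show ?thesis .
qed

lemma reduce:
  assumes "P \<in> pols R"
  obtains Q where "Q \<in> pols R" "\<And>x. degree (Q x) < d" "\<And>x. x \<in> A \<Longrightarrow> poly (P x) (r x) = poly (Q x) (r x)"
proof -
  from pols_mod_monic[OF assms M deg monic d] obtain Q where
    Q: "Q \<in> pols R" "\<forall>x. degree (Q x) < d" "\<forall>x y. poly (M x) y = 0 \<longrightarrow> poly (P x) y = poly (Q x) y"
    by (elim bexE conjE)
  then show ?thesis using that[of Q] r_root by auto
qed

text \<open>Modulo \<open>M\<close> the degree drops below \<open>d\<close>, so the roots of the
  remainder \<open>Q\<close> are covered by functions in \<open>R\<close>. Unless \<open>r\<close>
  meets one of them, the sign of \<open>Q\<close> at \<open>r\<close> is its sign throughout the gap
  containing \<open>r\<close>, tested at the midpoint.\<close>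

lemma pos_cs [cs_intros]:
  assumes P: "P \<in> pols R"
  shows "pos P \<in> cut_sets R"
proof -
  obtain Q where Q: "Q \<in> pols R" "\<And>x. degree (Q x) < d"
    "\<And>x. x \<in> A \<Longrightarrow> poly (P x) (r x) = poly (Q x) (r x)" by (fact reduce[OF P])
  obtain F where F: "root_cover Q F" using IH[OF Q(1,2)] by auto
  \<comment> \<open>With \<open>s\<close> and \<open>t\<close> included, \<open>r\<close> always
    lies between two members of \<open>G\<close>.\<close>
  define G where "G = insert s (insert t F)"
  have G: "finite G" "\<And>g. g \<in> G \<Longrightarrow> g \<in> R" using F s t by (auto simp: G_def root_cover_def)
  have "{x. (\<exists>g\<in>G. x \<in> hits g \<and> 0 < poly (Q x) (g x)) \<or>
      (\<exists>g\<in>G. \<exists>h\<in>G. x \<in> below g \<and> x \<in> above h \<and> (\<forall>k\<in>G. \<not> (g x < k x \<and> k x < h x)) \<and>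
        0 < poly (Q x) ((g x + h x) / 2))} \<in> cut_sets R" (is "?S \<in> _")
    using Q(1) G by (intro cs_intros R_intros)
  also have "?S = pos P"
    unfolding pos_def
  proof (intro Collect_cong iffI)
    fix x
    assume *: "(\<exists>g\<in>G. x \<in> hits g \<and> 0 < poly (Q x) (g x)) \<or>
      (\<exists>g\<in>G. \<exists>h\<in>G. x \<in> below g \<and> x \<in> above h \<and> (\<forall>k\<in>G. \<not> (g x < k x \<and> k x < h x)) \<and>
        0 < poly (Q x) ((g x + h x) / 2))"
    then show "x \<in> A \<and> 0 < poly (P x) (r x)"
    proof (elim disjE bexE conjE)
      fix g assume "x \<in> hits g" "0 < poly (Q x) (g x)"
      then show ?thesis using Q(3)[of x] by (auto simp: hits_def)
    next
      fix g h assume gh: "x \<in> below g" "x \<in> above h" "\<forall>k\<in>G. \<not> (g x < k x \<and> k x < h x)"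
        "0 < poly (Q x) ((g x + h x) / 2)"
      then have x: "x \<in> A" "g x < r x" "r x < h x" by (auto simp: below_def above_def)
      have Q0: "Q x \<noteq> 0" using gh(4) by auto
      have nz: "poly (Q x) z \<noteq> 0" if "g x < z" "z < h x" for z
        using root_coverD[OF F Q0, of z] gh(3) that by (auto simp: G_def)
      have "0 < poly (Q x) (r x)"
        using poly_pos_iff_between[OF rc nz, of "g x" "h x" "r x" "(g x + h x) / 2"] gh(4) x by auto
      then show ?thesis using x Q(3) by simp
    qed
  next
    fix x assume x: "x \<in> A \<and> 0 < poly (P x) (r x)"
    then have pQ: "0 < poly (Q x) (r x)" using Q(3)[of x] by simp
    have Q0: "Q x \<noteq> 0" using pQ by auto
    show "(\<exists>g\<in>G. x \<in> hits g \<and> 0 < poly (Q x) (g x)) \<or>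
      (\<exists>g\<in>G. \<exists>h\<in>G. x \<in> below g \<and> x \<in> above h \<and> (\<forall>k\<in>G. \<not> (g x < k x \<and> k x < h x)) \<and>
        0 < poly (Q x) ((g x + h x) / 2))"
    proof (cases "\<exists>g\<in>G. g x = r x")
      case True
      then show ?thesis using x pQ by (auto simp: hits_def)
    next
      case False
      define G' where "G' = (\<lambda>g. g x) ` G"
      have "\<exists>a\<in>G'. \<exists>b\<in>G'. a < r x \<and> r x < b \<and> (\<forall>k\<in>G'. \<not> (a < k \<and> k < b))"
        by (rule finite_neighbours[of G' "s x" "t x"])
          (use G(1) r_between x False in \<open>auto simp: G'_def G_def\<close>)
      then obtain g h where gh: "g \<in> G" "h \<in> G" "g x < r x" "r x < h x" "\<forall>k\<in>G. \<not> (g x < k x \<and> k x < h x)"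
        by (auto simp: G'_def)
      have nz: "poly (Q x) z \<noteq> 0" if "g x < z" "z < h x" for z
        using root_coverD[OF F Q0, of z] gh(5) that by (auto simp: G_def)
      have "0 < poly (Q x) ((g x + h x) / 2)"
        using poly_pos_iff_between[OF rc nz, of "g x" "h x" "r x" "(g x + h x) / 2"] pQ gh(3,4) by auto
      then have "x \<in> below g \<and> x \<in> above h \<and> (\<forall>k\<in>G. \<not> (g x < k x \<and> k x < h x)) \<and>
          0 < poly (Q x) ((g x + h x) / 2)"
        using gh x by (simp add: below_def above_def)
      then show ?thesis using gh(1,2) by blast
    qed
  qed
  finally show ?thesis .
qed

text \<open>\<open>r - u\<close> is a root of the expansion of \<open>M\<close> at \<open>u\<close>,
  two of whose terms then have comparable size. On the piece belonging to the indices
  \<open>i\<close> and \<open>j\<close>, the power of the distance with exponent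
  \<open>\<bar>i - j\<bar>\<close> is comparable with a ratio of coefficients, which lies in
  \<open>R\<close>.\<close>

lemma tame_dist:
  assumes u: "u \<in> R"
  shows "tame A (\<lambda>x. \<bar>r x - u x\<bar>)"
proof -
  define a where "a k x = coeff (pcompose (M x) [:u x, 1:]) k" for k x
  have aR: "a k \<in> R" for k
    unfolding a_def using M u by (intro R_intros P_intros)
  have degM: "degree (M x) = d" for x
    using deg[of x] le_degree[of "M x" d] monic[of x] by simp
  define Z where "Z i x = [:a i x:] * [:- u x, 1:] ^ i" for i x
  have Z: "Z i \<in> pols R" for i
    unfolding Z_def using aR u by (intro P_intros R_intros)
  have polyZ: "poly (Z i x) (r x) = a i x * (r x - u x) ^ i" for i x
    by (simp add: Z_def poly_power)
  \<comment> \<open>Sizes of terms are compared through their squares: these are polynomials in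
    \<open>r\<close>, to which \<open>pos_cs\<close> applies.\<close>
  define W where "W i j = {x. x \<in> A \<and> \<not> x \<in> hits u \<and> \<not> a i x = 0 \<and> \<not> a j x = 0 \<and>
    \<not> x \<in> pos (\<lambda>x. Z i x ^ 2 - Z j x ^ 2) \<and>
    \<not> x \<in> pos (\<lambda>x. Z j x ^ 2 - [:of_nat d ^ 2:] * Z i x ^ 2)}" for i j
  have Wcs: "W i j \<in> cut_sets R" for i j
    unfolding W_def using A u aR[of i] aR[of j] Z[of i] Z[of j] by (intro cs_intros R_intros P_intros)
  have Wiff: "x \<in> W i j \<longleftrightarrow> x \<in> A \<and> u x \<noteq> r x \<and> a i x \<noteq> 0 \<and> a j x \<noteq> 0 \<and>
     \<bar>a i x * (r x - u x) ^ i\<bar> \<le> \<bar>a j x * (r x - u x) ^ j\<bar> \<and>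
     \<bar>a j x * (r x - u x) ^ j\<bar> \<le> of_nat d * \<bar>a i x * (r x - u x) ^ i\<bar>" for i j x
  proof -
    have sq: "\<bar>v\<bar> \<le> of_nat d * \<bar>w\<bar> \<longleftrightarrow> v\<^sup>2 \<le> (of_nat d)\<^sup>2 * w\<^sup>2" for v w :: 'k
      using abs_le_square_iff[of v "of_nat d * w"] by (simp add: abs_mult power_mult_distrib)
    show ?thesis
      unfolding W_def hits_def pos_def sq abs_le_square_iff by (auto simp: polyZ poly_power not_less)
  qed
  \<comment> \<open>The index \<open>None\<close> stands for the case \<open>u = r\<close>, where
    the distance is 0.\<close>
  define I where "I = insert None (Some ` {(i, j). i \<le> d \<and> j \<le> d \<and> i \<noteq> j})"
  define E where "E o' = (case o' of None \<Rightarrow> hits u | Some (i, j) \<Rightarrow> W i j)" for o'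
  show ?thesis
  proof (rule tame_cases[of I E])
    have "finite {(i, j). i \<le> d \<and> j \<le> d \<and> i \<noteq> j}"
      by (rule finite_subset[of _ "{..d} \<times> {..d}"]) auto
    then show "finite I" by (simp add: I_def)
    show "E i \<in> cut_sets R" for i
      using hits_cs[OF u] Wcs by (auto simp: E_def split: option.split)
    show "A \<subseteq> (\<Union>i\<in>I. E i)"
    proof
      fix x assume x: "x \<in> A"
      show "x \<in> (\<Union>i\<in>I. E i)"
      proof (cases "u x = r x")
        case True
        then have "x \<in> E None" using x by (simp add: E_def hits_def)
        then show ?thesis by (auto simp: I_def)
      next
        case False
        define p where "p = pcompose (M x) [:u x, 1:]"
        have dp: "degree p = d" using degM[of x] by (simp add: p_def degree_pcompose)
        have "lead_coeff p = lead_coeff (M x)"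
          unfolding p_def by (subst lead_coeff_comp) auto
        then have top: "coeff p d \<noteq> 0" using monic[of x] degM[of x] dp by simp
        have root: "poly p (r x - u x) = 0" using r_root[OF x] by (simp add: p_def poly_pcompose)
        from root_dominant_terms[of p d, OF _ top root] dp False
        obtain i j where ij: "i \<le> d" "j \<le> d" "i \<noteq> j" "coeff p i \<noteq> 0" "coeff p j \<noteq> 0"
          "\<bar>coeff p i * (r x - u x) ^ i\<bar> \<le> \<bar>coeff p j * (r x - u x) ^ j\<bar>"
          "\<bar>coeff p j * (r x - u x) ^ j\<bar> \<le> of_nat d * \<bar>coeff p i * (r x - u x) ^ i\<bar>"
          by auto
        then have "x \<in> W i j" using x False unfolding Wiff a_def p_def by auto
        then have "x \<in> E (Some (i, j))" by (simp add: E_def)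
        moreover have "Some (i, j) \<in> I" using ij by (simp add: I_def)
        ultimately show ?thesis by blast
      qed
    qed
    fix o' assume "o' \<in> I"
    then consider "o' = None" | i j where "o' = Some (i, j)" "i \<noteq> j" by (auto simp: I_def)
    then show "tame (A \<inter> E o') (\<lambda>x. \<bar>r x - u x\<bar>)"
    proof cases
      case 1
      then show ?thesis
        by (intro tame_of_piece tame_pieceI[of 1 "\<lambda>_. 0" _ _ 1])
          (auto simp: E_def hits_def cmp_def intro: R_intros)
    next
      case 2
      \<comment> \<open>The ratio is oriented such that the exponent \<open>N\<close> of the
        distance is positive.\<close>
      define f where "f x = (if i < j then \<bar>a i x\<bar> / \<bar>a j x\<bar> else \<bar>a j x\<bar> / \<bar>a i x\<bar>)" for x
      have fR: "f \<in> R"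
        unfolding f_def using aR[of i] aR[of j] by (intro R_intros cs_intros)
      define N where "N = (if i < j then j - i else i - j)"
      show ?thesis
      proof (rule tame_of_piece, rule tame_pieceI[of N f _ _ d])
        show "N \<ge> 1" using 2 by (auto simp: N_def)
        fix x assume "x \<in> A \<inter> E o'"
        then have x: "x \<in> W i j" using 2 by (simp add: E_def)
        define z where "z = \<bar>r x - u x\<bar>"
        have z: "0 < z" using x by (simp add: Wiff z_def)
        have ai: "0 < \<bar>a i x\<bar>" "0 < \<bar>a j x\<bar>" using x by (auto simp: Wiff)
        have 1: "\<bar>a i x\<bar> * z ^ i \<le> \<bar>a j x\<bar> * z ^ j" "\<bar>a j x\<bar> * z ^ j \<le> of_nat d * (\<bar>a i x\<bar> * z ^ i)"
          using x by (auto simp: Wiff z_def abs_mult power_abs)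
        have d1: "(1::'k) \<le> of_nat d" using d by simp
        show "cmp d (\<bar>r x - u x\<bar> ^ N) (f x)"
        proof (cases "i < j")
          case True
          then have zj: "z ^ j = z ^ i * z ^ N" by (simp add: N_def power_add[symmetric])
          have zi: "0 < z ^ i" using z by simp
          have "z ^ i * \<bar>a i x\<bar> \<le> z ^ i * (\<bar>a j x\<bar> * z ^ N)"
            "z ^ i * (\<bar>a j x\<bar> * z ^ N) \<le> z ^ i * (of_nat d * \<bar>a i x\<bar>)"
            using 1 by (auto simp: zj ac_simps)
          then have "\<bar>a i x\<bar> \<le> \<bar>a j x\<bar> * z ^ N" "\<bar>a j x\<bar> * z ^ N \<le> of_nat d * \<bar>a i x\<bar>"
            using zi by auto
          then have 3: "f x \<le> z ^ N" "z ^ N \<le> of_nat d * f x"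
            using ai True by (simp_all add: f_def field_simps)
          have "0 \<le> f x" by (simp add: f_def)
          moreover have "0 \<le> z ^ N" using z by simp
          moreover from this have "1 * z ^ N \<le> of_nat d * z ^ N" by (rule mult_right_mono[OF d1])
          ultimately show ?thesis using 3 unfolding cmp_def z_def[symmetric] by linarith
        next
          case False
          then have zi: "z ^ i = z ^ j * z ^ N" using 2 by (simp add: N_def power_add[symmetric])
          have zj: "0 < z ^ j" using z by simp
          have "z ^ j * (\<bar>a i x\<bar> * z ^ N) \<le> z ^ j * \<bar>a j x\<bar>"
            "z ^ j * \<bar>a j x\<bar> \<le> z ^ j * (of_nat d * (\<bar>a i x\<bar> * z ^ N))"
            using 1 by (auto simp: zi ac_simps)
          then have "\<bar>a i x\<bar> * z ^ N \<le> \<bar>a j x\<bar>" "\<bar>a j x\<bar> \<le> of_nat d * (\<bar>a i x\<bar> * z ^ N)"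
            using zj by auto
          then have 3: "z ^ N \<le> f x" "f x \<le> of_nat d * z ^ N"
            using ai False by (simp_all add: f_def field_simps)
          have "0 \<le> f x" by (simp add: f_def)
          then have "1 * f x \<le> of_nat d * f x" by (rule mult_right_mono[OF d1])
          moreover have "0 \<le> z ^ N" using z by simp
          ultimately show ?thesis using 3 \<open>0 \<le> f x\<close> unfolding cmp_def z_def[symmetric] by linarith
        qed
      qed (use fR in auto)
    qed
  qed
qed

text \<open>\<open>A\<close> is divided according to the member \<open>g\<close> of \<open>G\<close>
  nearest to \<open>r\<close>. No root of a derivative of \<open>Q\<close> then lies in the open
  ball of radius \<open>\<bar>r - g\<bar>\<close> around \<open>r\<close>, so the value is
  comparable with the sum of the sizes of its Taylor terms at \<open>g\<close>, and these are tame
  by \<open>tame_dist\<close>.\<close>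

lemma tame_poly:
  assumes Q: "Q \<in> pols R" and dQ: "\<And>x. degree (Q x) < d"
  shows "tame A (\<lambda>x. \<bar>poly (Q x) (r x)\<bar>)"
proof -
  have dQ': "\<And>x. degree (Q x) \<le> d" using dQ less_imp_le by blast
  have cv: "\<exists>F. root_cover (\<lambda>x. (pderiv ^^ k) (Q x)) F" for k
    using Q dQ by (intro IH pols_pderiv_funpow) (auto simp: degree_pderiv_funpow less_imp_diff_less)
  obtain G where G: "finite G" "G \<subseteq> R" "G \<noteq> {}"
    and cov: "\<And>x k y. (pderiv ^^ k) (Q x) \<noteq> 0 \<Longrightarrow> poly ((pderiv ^^ k) (Q x)) y = 0 \<Longrightarrow> \<exists>g\<in>G. g x = y"
    by (fact derivs_cover[of Q d, OF dQ' cv])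
  obtain m where m: "\<And>(p :: 'k poly) c e z. degree p \<le> d \<Longrightarrow> \<bar>e\<bar> = 1 \<Longrightarrow> 0 < z \<Longrightarrow>
    (\<And>k y. 0 < y \<Longrightarrow> y < 2 * z \<Longrightarrow> (pderiv ^^ k) p \<noteq> 0 \<Longrightarrow> poly ((pderiv ^^ k) p) (c + e * y) \<noteq> 0) \<Longrightarrow>
    cmp m \<bar>poly p (c + e * z)\<bar> (\<Sum>k\<le>d. \<bar>coeff (pcompose p [:c, e:]) k\<bar> * z ^ k)"
    by (fact poly_near_cmp[OF rc, of d])
  \<comment> \<open>Being at least as close to \<open>g\<close> as to \<open>h\<close> means lying
    on the right side of their midpoint, a function in \<open>R\<close> whose position relative to
    \<open>r\<close> is definable.\<close>
  define E where "E g = {x. x \<in> A \<and> (\<forall>h\<in>G. g x \<le> h x \<and> \<not> x \<in> below (\<lambda>x. (g x + h x) / 2) \<or>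
    h x \<le> g x \<and> \<not> x \<in> above (\<lambda>x. (g x + h x) / 2))}" for g
  have Ecs: "E g \<in> cut_sets R" if "g \<in> G" for g
    unfolding E_def using A G that by (intro cs_intros R_intros) auto
  have Eiff: "x \<in> E g \<longleftrightarrow> x \<in> A \<and> (\<forall>h\<in>G. \<bar>r x - g x\<bar> \<le> \<bar>r x - h x\<bar>)" for x g
  proof -
    have "(a \<le> b \<and> \<not> (a + b) / 2 < y \<or> b \<le> a \<and> \<not> y < (a + b) / 2) \<longleftrightarrow> \<bar>y - a\<bar> \<le> \<bar>y - b\<bar>"
      for a b y :: 'k by (auto simp: abs_if field_simps)
    then show ?thesis unfolding E_def below_def above_def by (auto simp del: not_less)
  qed
  show ?thesis
  proof (rule tame_cases[of G E])
    show "A \<subseteq> (\<Union>g\<in>G. E g)"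
    proof
      fix x assume x: "x \<in> A"
      obtain g where "g \<in> G" "\<forall>h\<in>G. \<bar>r x - g x\<bar> \<le> \<bar>r x - h x\<bar>"
        using ex_min_if_finite[of "(\<lambda>g. \<bar>r x - g x\<bar>) ` G"] G by (auto simp: not_less)
      then show "x \<in> (\<Union>g\<in>G. E g)" using x by (auto simp: Eiff)
    qed
    fix g assume g: "g \<in> G"
    then have gR: "g \<in> R" using G by auto
    have ta: "tame A (\<lambda>x. \<Sum>k\<le>d. \<bar>coeff (pcompose (Q x) [:g x, 1:]) k\<bar> * \<bar>r x - g x\<bar> ^ k)"
      using Q gR by (intro tame_sum tame_mult tame_power tame_dist tame_R R_intros P_intros) auto
    show "tame (A \<inter> E g) (\<lambda>x. \<bar>poly (Q x) (r x)\<bar>)"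
    proof (rule tame_cmp[OF tame_subset[OF ta]])
      fix x assume "x \<in> A \<inter> E g"
      then have x: "x \<in> A" "\<And>h. h \<in> G \<Longrightarrow> \<bar>r x - g x\<bar> \<le> \<bar>r x - h x\<bar>" by (auto simp: Eiff)
      define z where "z = \<bar>r x - g x\<bar>"
      \<comment> \<open>\<open>m\<close> serves the generic case, 1 the case
        \<open>r x = g x\<close>, where the sum reduces to its constant term.\<close>
      show "cmp (max m 1) \<bar>poly (Q x) (r x)\<bar>
        (\<Sum>k\<le>d. \<bar>coeff (pcompose (Q x) [:g x, 1:]) k\<bar> * \<bar>r x - g x\<bar> ^ k)"
      proof (cases "r x = g x")
        case True
        have "(\<Sum>k\<le>d. \<bar>coeff (pcompose (Q x) [:g x, 1:]) k\<bar> * \<bar>r x - g x\<bar> ^ k)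
            = (\<Sum>k\<in>{0}. \<bar>coeff (pcompose (Q x) [:g x, 1:]) k\<bar> * \<bar>r x - g x\<bar> ^ k)"
          using True by (intro sum.mono_neutral_right) (auto simp: zero_power)
        also have "\<dots> = \<bar>poly (pcompose (Q x) [:g x, 1:]) 0\<bar>" by (simp add: poly_0_coeff_0)
        also have "\<dots> = \<bar>poly (Q x) (r x)\<bar>" using True by (simp add: poly_pcompose)
        finally have "cmp 1 \<bar>poly (Q x) (r x)\<bar>
            (\<Sum>k\<le>d. \<bar>coeff (pcompose (Q x) [:g x, 1:]) k\<bar> * \<bar>r x - g x\<bar> ^ k)"
          by (simp add: cmp_def)
        then show ?thesis by (rule cmp_mono) simp
      next
        case False
        define e where "e = (if g x < r x then 1 else - 1 :: 'k)"
        have e: "\<bar>e\<bar> = 1" "g x + e * z = r x" by (auto simp: e_def z_def)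
        have z: "0 < z" using False by (simp add: z_def)
        have "cmp m \<bar>poly (Q x) (g x + e * z)\<bar> (\<Sum>k\<le>d. \<bar>coeff (pcompose (Q x) [:g x, e:]) k\<bar> * z ^ k)"
        proof (rule m[OF dQ' e(1) z])
          fix k y assume y: "0 < y" "y < 2 * z" and nz: "(pderiv ^^ k) (Q x) \<noteq> 0"
          show "poly ((pderiv ^^ k) (Q x)) (g x + e * y) \<noteq> 0"
          proof
            assume "poly ((pderiv ^^ k) (Q x)) (g x + e * y) = 0"
            from cov[OF nz this] obtain h where h: "h \<in> G" "h x = g x + e * y" by auto
            have "r x - h x = e * (z - y)" using e(2) h(2) by (simp add: algebra_simps)
            then have "\<bar>r x - h x\<bar> = \<bar>z - y\<bar>" by (simp add: abs_mult e(1))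
            also have "\<dots> < z" using y by (auto simp: abs_if)
            finally show False using x(2)[OF h(1)] by (simp add: z_def)
          qed
        qed
        then have "cmp m \<bar>poly (Q x) (r x)\<bar> (\<Sum>k\<le>d. \<bar>coeff (pcompose (Q x) [:g x, 1:]) k\<bar> * z ^ k)"
          by (simp add: e(2) abs_coeff_pcompose_reflect[OF e(1)])
        then show ?thesis unfolding z_def by (rule cmp_mono) simp
      qed
    qed simp
  qed (use G Ecs in auto)
qed

text \<open>By fullness: after reduction modulo \<open>M\<close>, the sign of the product of
  numerator and denominator is definable by \<open>pos_cs\<close>, and their absolute values are
  tame. A scaling cut sees no more than these.\<close>

lemma root_in_R: "r \<in> R"
proof (rule full)
  fix P Q and C :: "'k set" assume P: "P \<in> pols R" and Q: "Q \<in> pols R" and C: "scaling_cut C"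
  obtain P' where P': "P' \<in> pols R" "\<And>x. degree (P' x) < d"
    "\<And>x. x \<in> A \<Longrightarrow> poly (P x) (r x) = poly (P' x) (r x)" by (fact reduce[OF P])
  obtain Q' where Q': "Q' \<in> pols R" "\<And>x. degree (Q' x) < d"
    "\<And>x. x \<in> A \<Longrightarrow> poly (Q x) (r x) = poly (Q' x) (r x)" by (fact reduce[OF Q])
  define T where "T = {x. x \<in> A \<and> \<bar>poly (P' x) (r x)\<bar> / \<bar>poly (Q' x) (r x)\<bar> \<in> C}"
  have T: "T \<in> cut_sets R"
    unfolding T_def by (rule cs_tame_quotient[OF A tame_poly[OF P'(1,2)] tame_poly[OF Q'(1,2)] C])
  have "{x. \<not> x \<in> A \<and> poly (P x) 0 / poly (Q x) 0 \<in> C \<or> x \<in> pos (\<lambda>x. P' x * Q' x) \<and> x \<in> T} \<in> cut_sets R" (is "?S \<in> _")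
    using A P Q P' Q' C T by (intro cs_intros R_intros P_intros)
  also have "?S = {x. poly (P x) (r x) / poly (Q x) (r x) \<in> C}"
  proof (intro Collect_cong)
    fix x
    have key: "p / q \<in> C \<longleftrightarrow> 0 < p * q \<and> \<bar>p\<bar> / \<bar>q\<bar> \<in> C" for p q :: 'k
    proof -
      have "0 < p * q" if "p / q \<in> C"
        using scaling_cut_pos[OF C that] by (auto simp: zero_less_divide_iff zero_less_mult_iff)
      moreover have "\<bar>p\<bar> / \<bar>q\<bar> = p / q" if "0 < p * q"
        using that by (auto simp: zero_less_mult_iff abs_if)
      ultimately show ?thesis by (cases "0 < p * q") auto
    qed
    show "(\<not> x \<in> A \<and> poly (P x) 0 / poly (Q x) 0 \<in> C \<or> x \<in> pos (\<lambda>x. P' x * Q' x) \<and> x \<in> T)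
      = (poly (P x) (r x) / poly (Q x) (r x) \<in> C)"
      using off[of x] P'(3)[of x] Q'(3)[of x] key[of "poly (P' x) (r x)" "poly (Q' x) (r x)"]
      by (cases "x \<in> A") (auto simp: pos_def T_def)
  qed
  finally show "{x. poly (P x) (r x) / poly (Q x) (r x) \<in> C} \<in> cut_sets R" .
qed

end

context full_alg
begin

text \<open>Where the top coefficient vanishes, \<open>P\<close> equals \<open>N\<close>, of smaller
  degree. Elsewhere a root is a critical point or lies between two neighbours among the critical
  points and the root bounds, and there \<open>root_step\<close> shows that it depends on the
  parameter by a function in \<open>R\<close>.\<close>

lemma root_cover_exists_aux:
  assumes "P \<in> pols R" "\<And>x. degree (P x) < d"
  shows "\<exists>F. root_cover P F"
  using assms
proof (induction d arbitrary: P)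
  case 0
  then show ?case by simp
next
  case (Suc d)
  show ?case
  proof (cases "d = 0")
    case True
    have "poly (P x) y \<noteq> 0" if "P x \<noteq> 0" for x y
    proof -
      have "degree (P x) = 0" using Suc.prems(2)[of x] True by simp
      then obtain c where "P x = [:c:]" by (rule degree_eq_zeroE)
      then show ?thesis using that by auto
    qed
    then have "root_cover P {}" by (simp add: root_cover_def)
    then show ?thesis ..
  next
    case False
    define a where "a x = coeff (P x) d" for x
    have aR: "a \<in> R" unfolding a_def using Suc.prems(1) by (intro R_intros)
    \<comment> \<open>Where the top coefficient vanishes, a power of the variable stands in, so that
      \<open>M x\<close> is monic of degree \<open>d\<close> for every \<open>x\<close>.\<close>
    define M where "M x = (if \<not> a x = 0 then [:inverse (a x):] * P x else monom 1 d)" for x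
    have M: "M \<in> pols R"
      unfolding M_def using aR Suc.prems(1) by (intro P_intros R_intros cs_intros)
    have deg: "degree (M x) \<le> d" for x
      using Suc.prems(2)[of x] by (simp add: M_def degree_monom_le)
    have monic: "coeff (M x) d = 1" for x by (simp add: M_def a_def)
    have d1: "d \<ge> 1" using False by simp
    have "\<exists>F. root_cover (\<lambda>x. pderiv (M x)) F"
    proof (rule Suc.IH)
      show "(\<lambda>x. pderiv (M x)) \<in> pols R" using M by (intro P_intros)
      show "degree (pderiv (M x)) < d" for x
        using deg[of x] d1 by (simp add: degree_pderiv)
    qed
    then obtain F1 where F1: "root_cover (\<lambda>x. pderiv (M x)) F1" ..
    define N where "N x = P x - [:a x:] * monom 1 d" for x
    have "\<exists>F. root_cover N F"
    proof (rule Suc.IH)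
      show "N \<in> pols R" unfolding N_def using Suc.prems(1) aR by (intro P_intros)
      fix x
      have "degree (N x) \<le> d - 1"
      proof (rule degree_le, intro allI impI)
        fix i assume "d - 1 < i"
        then consider "i = d" | "d < i" by linarith
        then show "coeff (N x) i = 0"
          using Suc.prems(2)[of x] by cases (auto simp: N_def a_def intro!: coeff_eq_0)
      qed
      then show "degree (N x) < d" using d1 by linarith
    qed
    then obtain F2 where F2: "root_cover N F2" ..
    define b where "b x = 1 + (\<Sum>k\<le>d. \<bar>coeff (M x) k\<bar>)" for x
    have bR: "b \<in> R" unfolding b_def using M by (intro R_intros)
    define G where "G = insert b (insert (\<lambda>x. - b x) F1)"
    have GR: "g \<in> R" if "g \<in> G" for g
      using that bR F1 R_uminus[OF bR] by (auto simp: G_def root_cover_def)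
    have Gfin: "finite G" using F1 by (simp add: G_def root_cover_def)
    \<comment> \<open>The parameters for which \<open>s\<close> and \<open>t\<close> enclose no
      critical point and \<open>M\<close> changes sign between them, so that exactly one root lies
      there.\<close>
    define A where "A s t = {x. s x < t x \<and> (\<forall>g\<in>G. \<not> (s x < g x \<and> g x < t x)) \<and>
      poly (M x) (s x) * poly (M x) (t x) < 0}" for s t
    have pd0: "pderiv (M x) \<noteq> 0" for x
      using le_degree[of "M x" d] monic[of x] d1 by (simp add: pderiv_eq_0_iff)
    have crit: "poly (pderiv (M x)) y \<noteq> 0"
      if "\<forall>g\<in>G. \<not> (s x < g x \<and> g x < t x)" "s x < y" "y < t x" for s t x y
      using root_coverD[OF F1 pd0, of x y] that by (auto simp: G_def)
    define r where "r s t x = (if x \<in> A s t then SOME y. s x < y \<and> y < t x \<and> poly (M x) y = 0 else 0)"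
      for s t x
    have r: "s x < r s t x \<and> r s t x < t x \<and> poly (M x) (r s t x) = 0" if x: "x \<in> A s t" for s t x
    proof -
      have "\<exists>y. s x < y \<and> y < t x \<and> poly (M x) y = 0"
      proof -
        have neg: "poly (M x) (s x) * poly (M x) (t x) < 0" and st: "s x < t x" using x by (auto simp: A_def)
        obtain y where y: "s x \<le> y" "y \<le> t x" "poly (M x) y = 0"
          by (rule real_closed_poly_IVT[OF rc less_imp_le[OF st] less_imp_le[OF neg]])
        then have "y \<noteq> s x" "y \<noteq> t x" using neg by auto
        then show ?thesis using y by (intro exI[of _ y]) auto
      qed
      from someI_ex[OF this] show ?thesis using x by (simp add: r_def)
    qed
    have rR: "r s t \<in> R" if st: "s \<in> G" "t \<in> G" for s t
    proof -
      have Acs: "A s t \<in> cut_sets R"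
        unfolding A_def using M Gfin GR st by (intro cs_intros R_intros)
      interpret root_step R d M "A s t" s t "r s t"
      proof
        show "\<exists>F. root_cover Q F" if "Q \<in> pols R" "\<And>x. degree (Q x) < d" for Q
          using that by (rule Suc.IH)
        fix x y assume "x \<in> A s t" "s x < y" "y < t x"
        then show "poly (pderiv (M x)) y \<noteq> 0" by (intro crit) (auto simp: A_def)
      qed (use M d1 deg monic Acs GR st r in \<open>auto simp: r_def\<close>)
      show ?thesis by (rule root_in_R)
    qed
    define F where "F = G \<union> F2 \<union> (\<lambda>(s, t). r s t) ` (G \<times> G)"
    have "root_cover P F"
      unfolding root_cover_def
    proof (intro conjI allI impI)
      show "finite F" using Gfin F2 by (auto simp: F_def root_cover_def)
      show "F \<subseteq> R" using GR F2 rR by (auto simp: F_def root_cover_def)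
      fix x y assume Px: "P x \<noteq> 0" and y: "poly (P x) y = 0"
      show "\<exists>f\<in>F. f x = y"
      proof (cases "a x = 0")
        case True
        then have "N x = P x" by (simp add: N_def)
        then have "\<exists>f\<in>F2. f x = y" using root_coverD[OF F2, of x y] Px y by simp
        then show ?thesis by (auto simp: F_def)
      next
        case False
        then have My: "poly (M x) y = 0" using y by (simp add: M_def)
        have M0: "M x \<noteq> 0" using monic[of x] by auto
        show ?thesis
        proof (cases "\<exists>g\<in>G. g x = y")
          case True
          then show ?thesis by (auto simp: F_def)
        next
          case ny: False
          have yb: "\<bar>y\<bar> < b x" unfolding b_def by (rule monic_root_bound[OF deg monic d1 My])
          define G' where "G' = (\<lambda>g. g x) ` G"
          have "\<exists>g\<in>G'. \<exists>h\<in>G'. g < y \<and> y < h \<and> (\<forall>k\<in>G'. \<not> (g < k \<and> k < h))"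
            by (rule finite_neighbours[of G' "- b x" "b x"])
              (use Gfin yb ny in \<open>auto simp: G'_def G_def abs_less_iff\<close>)
          then obtain s t where st: "s \<in> G" "t \<in> G" "s x < y" "y < t x" "\<forall>g\<in>G. \<not> (s x < g x \<and> g x < t x)"
            by (auto simp: G'_def)
          note rb = root_between_critical_points[OF rc M0 crit[where s = s and t = t and x = x, OF st(5)] st(3,4) My]
          have xA: "x \<in> A s t" using rb(1) st by (simp add: A_def)
          have "r s t x = y" using r[OF xA] by (intro rb(2)) auto
          then show ?thesis using st(1,2) unfolding F_def by force
        qed
      qed
    qed
    then show ?thesis ..
  qed
qed

lemma root_cover_exists:
  assumes "P \<in> pols R"
  shows "\<exists>F. root_cover P F"
proof -
  obtain d where d: "\<forall>x. degree (P x) \<le> d" using pols_degree[OF assms] by auto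
  show ?thesis by (rule root_cover_exists_aux[OF assms, of "Suc d"]) (use d in \<open>auto simp: less_Suc_eq_le\<close>)
qed

end

section \<open>Cuts\<close>

text \<open>Each sum is its largest term up to the factor \<open>n + 1\<close>. The right side
  avoids naming the largest terms: every nonzero term of the numerator is small enough against some
  term of the denominator.\<close>

lemma sum_ratio_mem_cut_iff:
  fixes a b :: "nat \<Rightarrow> 'k::linordered_field"
  assumes C: "scaling_cut C" and a: "\<And>k. 0 \<le> a k" and b: "\<And>k. 0 \<le> b k"
  shows "(\<Sum>k\<le>n. a k) / (\<Sum>k\<le>n. b k) \<in> C \<longleftrightarrow>
    (\<exists>k\<in>{..n}. 0 < a k) \<and> (\<forall>k\<in>{..n}. a k = 0 \<or> (\<exists>l\<in>{..n}. a k / b l \<in> C))"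
proof -
  define Sa Sb where "Sa = (\<Sum>k\<le>n. a k)" and "Sb = (\<Sum>k\<le>n. b k)"
  have mx: "\<exists>l\<le>n. (\<Sum>k\<le>n. c k) \<le> of_nat (Suc n) * c l" for c :: "nat \<Rightarrow> 'k"
  proof -
    have "Max (c ` {..n}) \<in> c ` {..n}" by (intro Max_in) auto
    then obtain l where l: "l \<le> n" "Max (c ` {..n}) = c l" by (metis atMost_iff imageE)
    have "(\<Sum>k\<le>n. c k) \<le> (\<Sum>k\<le>n. c l)"
      by (rule sum_mono) (simp add: l(2)[symmetric])
    then show ?thesis using l(1) by (intro exI[of _ l]) simp
  qed
  have ale: "a k \<le> Sa" if "k \<le> n" for k
    unfolding Sa_def by (rule member_le_sum) (use that a in auto)
  have ble: "b k \<le> Sb" if "k \<le> n" for k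
    unfolding Sb_def by (rule member_le_sum) (use that b in auto)
  have S0: "0 \<le> Sa" "0 \<le> Sb" unfolding Sa_def Sb_def using a b by (auto intro: sum_nonneg)
  show ?thesis
    unfolding Sa_def[symmetric] Sb_def[symmetric]
  proof
    assume SC: "Sa / Sb \<in> C"
    have "0 < Sa / Sb" by (rule scaling_cut_pos[OF C SC])
    then have pos: "0 < Sa" "0 < Sb" using S0 by (auto simp: zero_less_divide_iff)
    obtain l where l: "l \<le> n" "Sb \<le> of_nat (Suc n) * b l" using mx[of b] unfolding Sb_def by auto
    have bl: "0 < b l" using l pos b[of l] by (cases "b l = 0") auto
    have "a k / b l \<in> C" if k: "k \<le> n" "a k \<noteq> 0" for k
    proof (rule scaling_cut_le[OF C SC])
      have ak: "0 < a k" using a[of k] k by auto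
      then show "0 < a k / b l" using bl by simp
      have "a k * Sb \<le> Sa * (of_nat (Suc n) * b l)"
        using ale[OF k(1)] l(2) S0 by (intro mult_mono) auto
      then show "a k / b l \<le> of_nat (Suc n) * (Sa / Sb)"
        using pos bl by (simp add: field_simps del: of_nat_Suc)
    qed
    moreover have "\<exists>k\<le>n. 0 < a k"
    proof (rule ccontr)
      assume "\<not> (\<exists>k\<le>n. 0 < a k)"
      then have "Sa = 0" unfolding Sa_def using a by (intro sum.neutral) (auto simp: order_eq_iff not_less)
      then show False using pos by simp
    qed
    ultimately show "(\<exists>k\<in>{..n}. 0 < a k) \<and> (\<forall>k\<in>{..n}. a k = 0 \<or> (\<exists>l\<in>{..n}. a k / b l \<in> C))"
      using l(1) by auto
  next
    assume *: "(\<exists>k\<in>{..n}. 0 < a k) \<and> (\<forall>k\<in>{..n}. a k = 0 \<or> (\<exists>l\<in>{..n}. a k / b l \<in> C))"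
    then have Sa: "0 < Sa" using ale by (auto intro: less_le_trans)
    obtain k where k: "k \<le> n" "Sa \<le> of_nat (Suc n) * a k" using mx[of a] unfolding Sa_def by auto
    have ak: "0 < a k" using k Sa a[of k] by (cases "a k = 0") auto
    then obtain l where l: "l \<le> n" "a k / b l \<in> C" using *[THEN conjunct2, rule_format, of k] k by auto
    have "0 < a k / b l" by (rule scaling_cut_pos[OF C l(2)])
    then have bl: "0 < b l" using ak by (auto simp: zero_less_divide_iff)
    then have Sb: "0 < Sb" using ble[OF l(1)] by linarith
    show "Sa / Sb \<in> C"
    proof (rule scaling_cut_le[OF C l(2)])
      show "0 < Sa / Sb" using Sa Sb by simp
      have "Sa * b l \<le> (of_nat (Suc n) * a k) * Sb"
        using k(2) ble[OF l(1)] Sa b[of l] ak by (intro mult_mono) auto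
      then show "Sa / Sb \<le> of_nat (Suc n) * (a k / b l)"
        using Sb bl by (simp add: field_simps del: of_nat_Suc)
    qed
  qed
qed

lemma scaling_cut_root:
  assumes C: "scaling_cut C"
  shows "scaling_cut {u. 0 < u \<and> u ^ m \<in> C}"
proof (rule scaling_cutI)
  fix y z assume z: "z \<in> {u. 0 < u \<and> u ^ m \<in> C}" and y: "0 < y" "y \<le> 2 * z"
  have "y ^ m \<le> (2 * z) ^ m" using y by (intro power_mono) auto
  then have "y ^ m \<le> of_nat (2 ^ m) * z ^ m" by (simp add: power_mult_distrib)
  moreover have "0 < y ^ m" using y by simp
  moreover have "z ^ m \<in> C" using z by simp
  ultimately have "y ^ m \<in> C" using scaling_cut_le[OF C] by blast
  then show "y \<in> {u. 0 < u \<and> u ^ m \<in> C}" using y by simp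
qed simp

text \<open>Inversion reverses the order; passing to the complement makes the set downward closed
  again.\<close>

lemma scaling_cut_inverse:
  assumes C: "scaling_cut C"
  shows "scaling_cut {t. 0 < t \<and> 1 / t \<notin> C}"
proof (rule scaling_cutI)
  fix y z assume z: "z \<in> {t. 0 < t \<and> 1 / t \<notin> C}" and y: "0 < y" "y \<le> 2 * z"
  have "1 / z \<in> C" if "1 / y \<in> C"
    using z y by (intro scaling_cut_le[OF C that, of _ 2]) (auto simp: field_simps)
  then show "y \<in> {t. 0 < t \<and> 1 / t \<notin> C}" using z y by auto
qed simp

text \<open>The factors \<open>e\<close> for which \<open>C\<close> does not fit into
  \<open>e\<close> times \<open>C'\<close>. Inclusion between two cuts scaled by functions thereby
  becomes a single atom on the ratio of the scales.\<close>

lemma scaling_cut_compare: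
  assumes C: "scaling_cut C" and C': "scaling_cut C'"
  shows "scaling_cut {e. 0 < e \<and> \<not> (\<forall>c\<in>C. c / e \<in> C')}"
proof (rule scaling_cutI)
  fix y z assume z: "z \<in> {e. 0 < e \<and> \<not> (\<forall>c\<in>C. c / e \<in> C')}" and y: "0 < y" "y \<le> 2 * z"
  then obtain c where c: "c \<in> C" "c / z \<notin> C'" "0 < z" by auto
  have c0: "0 < c" by (rule scaling_cut_pos[OF C c(1)])
  have "c / z \<in> C'" if "c / y \<in> C'"
  proof (rule scaling_cut_le[OF C' that, of _ 2])
    show "0 < c / z" using c0 c by simp
    have "c * y \<le> c * (2 * z)" using y c0 by (intro mult_left_mono) auto
    then show "c / z \<le> of_nat 2 * (c / y)" using y c by (simp add: field_simps)
  qed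
  then show "y \<in> {e. 0 < e \<and> \<not> (\<forall>c\<in>C. c / e \<in> C')}" using c y by auto
qed simp

section \<open>Finite unions of convex sets\<close>

definition fin_convex :: "'k::linorder set \<Rightarrow> bool" where
  "fin_convex Y \<longleftrightarrow> (\<exists>\<Y>. finite \<Y> \<and> (\<forall>C\<in>\<Y>. order_convex_in UNIV C) \<and> Y = \<Union>\<Y>)"

lemma fin_convex_convex: "order_convex_in UNIV C \<Longrightarrow> fin_convex C"
  unfolding fin_convex_def by (intro exI[of _ "{C}"]) auto

lemma fin_convex_empty: "fin_convex {}"
  unfolding fin_convex_def by (intro exI[of _ "{}"]) auto

lemma fin_convex_Un:
  assumes "fin_convex A" "fin_convex B"
  shows "fin_convex (A \<union> B)"
proof -
  obtain \<A> \<B> where "finite \<A>" "\<forall>C\<in>\<A>. order_convex_in UNIV C" "A = \<Union>\<A>"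
    "finite \<B>" "\<forall>C\<in>\<B>. order_convex_in UNIV C" "B = \<Union>\<B>"
    using assms unfolding fin_convex_def by auto
  then show ?thesis unfolding fin_convex_def by (intro exI[of _ "\<A> \<union> \<B>"]) auto
qed

lemma fin_convex_UN: "finite I \<Longrightarrow> (\<And>i. i \<in> I \<Longrightarrow> fin_convex (A i)) \<Longrightarrow> fin_convex (\<Union>i\<in>I. A i)"
  by (induction I rule: finite_induct) (auto intro: fin_convex_Un fin_convex_empty)

lemma fin_convex_affine_image:
  fixes Y :: "'k::linordered_field set"
  assumes Y: "fin_convex Y" and e: "e = 1 \<or> e = - 1"
  shows "fin_convex ((\<lambda>z. c + e * z) ` Y)"
proof -
  obtain \<Y> where \<Y>: "finite \<Y>" "\<forall>C\<in>\<Y>. order_convex_in UNIV C" "Y = \<Union>\<Y>"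
    using Y unfolding fin_convex_def by auto
  have img: "order_convex_in UNIV ((\<lambda>z. c + e * z) ` C)" if "order_convex_in UNIV C" for C
    unfolding order_convex_in_def
  proof (intro conjI ballI impI)
    fix a b y assume "a \<in> (\<lambda>z. c + e * z) ` C" "b \<in> (\<lambda>z. c + e * z) ` C" "a \<le> y \<and> y \<le> b"
    then obtain u w where uw: "u \<in> C" "w \<in> C" "c + e * u \<le> y" "y \<le> c + e * w" by auto
    have conv: "v \<in> C" if "a \<in> C" "b \<in> C" "a \<le> v" "v \<le> b" for a b v
      using \<open>order_convex_in UNIV C\<close> that unfolding order_convex_in_def by blast
    have "e * (y - c) \<in> C"
      using e
    proof
      assume "e = 1"
      with uw show ?thesis using conv[of u w "y - c"] by auto
    next
      assume "e = - 1"
      with uw show ?thesis using conv[of w u "c - y"] by auto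
    qed
    then have "c + e * (e * (y - c)) \<in> (\<lambda>z. c + e * z) ` C" by (rule imageI)
    moreover have "c + e * (e * (y - c)) = y" using e by auto
    ultimately show "y \<in> (\<lambda>z. c + e * z) ` C" by simp
  qed simp
  have "\<forall>C\<in>(`) (\<lambda>z. c + e * z) ` \<Y>. order_convex_in UNIV C" using \<Y>(2) img by blast
  moreover have "(\<lambda>z. c + e * z) ` Y = \<Union>((`) (\<lambda>z. c + e * z) ` \<Y>)" using \<Y>(3) by auto
  ultimately show ?thesis
    unfolding fin_convex_def using \<Y>(1) by (intro exI[of _ "(`) (\<lambda>z. c + e * z) ` \<Y>"]) auto
qed

context full_alg
begin

text \<open>Definable choice: iterated case distinction picks one of finitely many
  candidates.\<close>

lemma R_select:
  assumes "finite F" "F \<subseteq> R" "\<And>f. f \<in> F \<Longrightarrow> {x. p f x} \<in> cut_sets R"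
  shows "\<exists>g\<in>R. \<forall>x. (\<exists>f\<in>F. p f x) \<longrightarrow> (\<exists>f\<in>F. p f x \<and> g x = f x)"
  using assms
proof (induction F rule: finite_induct)
  case empty
  show ?case using R_const[of 0] by auto
next
  case (insert h F)
  then obtain g where g: "g \<in> R" "\<forall>x. (\<exists>f\<in>F. p f x) \<longrightarrow> (\<exists>f\<in>F. p f x \<and> g x = f x)" by auto
  have "(\<lambda>x. if p h x then h x else g x) \<in> R" using insert.prems g by (intro R_if) auto
  then show ?case by (rule bexI[rotated]) (use g(2) in auto)
qed

text \<open>The roots of \<open>X ^ m - E\<close> are covered by functions in \<open>R\<close>, and
  positivity selects the right one.\<close>

lemma R_root:
  assumes E: "E \<in> R" "\<And>x. 0 < E x" and m: "m \<ge> 1"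
  shows "\<exists>g\<in>R. \<forall>x. 0 < g x \<and> g x ^ m = E x"
proof -
  define P where "P x = monom 1 m - [:E x:]" for x
  have polyP: "poly (P x) y = y ^ m - E x" for x y by (simp add: P_def poly_monom)
  have "P \<in> pols R" unfolding P_def using E by (intro P_intros)
  then obtain F where F: "root_cover P F" using root_cover_exists by auto
  have P0: "P x \<noteq> 0" for x
  proof
    assume "P x = 0"
    then have "poly (P x) 0 = 0" by simp
    then show False using E(2)[of x] m by (simp add: polyP zero_power)
  qed
  have ex: "\<exists>f\<in>F. 0 < f x \<and> f x ^ m = E x" for x
  proof -
    have "1 + E x \<le> (1 + E x) ^ m"
      using power_increasing[of 1 m "1 + E x"] m E(2)[of x] by simp
    then have "poly (P x) 0 * poly (P x) (1 + E x) \<le> 0"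
      using E(2)[of x] m by (intro mult_nonpos_nonneg) (auto simp: polyP zero_power)
    then obtain y where y: "0 \<le> y" "y \<le> 1 + E x" "poly (P x) y = 0"
      using real_closed_poly_IVT[OF rc, of 0 "1 + E x" "P x"] E(2)[of x] by auto
    have "y \<noteq> 0" using y(3) E(2)[of x] m by (auto simp: polyP zero_power)
    then have y0: "0 < y" using y(1) by simp
    from root_coverD[OF F P0 y(3)] obtain f where f: "f \<in> F" "f x = y" by (elim bexE)
    show ?thesis by (rule bexI[OF _ f(1)]) (use f(2) y0 y(3) in \<open>simp add: polyP\<close>)
  qed
  have "\<exists>g\<in>R. \<forall>x. (\<exists>f\<in>F. 0 < f x \<and> f x ^ m = E x) \<longrightarrow> (\<exists>f\<in>F. (0 < f x \<and> f x ^ m = E x) \<and> g x = f x)"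
    using F E(1) by (intro R_select cs_intros R_intros) (auto simp: root_cover_def)
  then obtain g where g: "g \<in> R" "\<And>x. \<exists>f\<in>F. (0 < f x \<and> f x ^ m = E x) \<and> g x = f x"
    using ex by auto
  have "0 < g x \<and> g x ^ m = E x" for x using g(2)[of x] by auto
  then show ?thesis using g(1) by blast
qed

text \<open>Initial segments of the positive elements, depending on the parameter. Over a fixed
  parameter they form a chain, so conditions on \<open>z\<close> reduce to inclusions between pairs
  of segments.\<close>

inductive basic_cut :: "('x \<Rightarrow> 'k set) \<Rightarrow> bool" where
  closed: "f \<in> R \<Longrightarrow> basic_cut (\<lambda>x. {z. 0 < z \<and> z \<le> f x})"
| opened: "f \<in> R \<Longrightarrow> basic_cut (\<lambda>x. {z. 0 < z \<and> z < f x})"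
| scaled: "E \<in> R \<Longrightarrow> (\<And>x. 0 < E x) \<Longrightarrow> scaling_cut C \<Longrightarrow> basic_cut (\<lambda>x. {z. z / E x \<in> C})"

lemma basic_cut_pos: "basic_cut D \<Longrightarrow> z \<in> D x \<Longrightarrow> 0 < z"
proof (induction rule: basic_cut.induct)
  case (scaled E C)
  then show ?case using scaling_cut_pos[of C "z / E x"] scaled(2)[of x] by (auto simp: zero_less_divide_iff)
qed auto

lemma basic_cut_down: "basic_cut D \<Longrightarrow> z \<in> D x \<Longrightarrow> 0 < y \<Longrightarrow> y \<le> z \<Longrightarrow> y \<in> D x"
proof (induction rule: basic_cut.induct)
  case (scaled E C)
  have "y / E x \<in> C"
    by (rule scaling_cut_le[of C "z / E x" _ 1])
      (use scaled scaled(2)[of x] in \<open>auto simp: divide_le_cancel dest: less_imp_le less_asym\<close>)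
  then show ?case by simp
qed auto

lemma basic_cut_linear:
  assumes "basic_cut D" "basic_cut D'" "\<not> D x \<subseteq> D' x"
  shows "D' x \<subseteq> D x"
proof
  fix y assume y: "y \<in> D' x"
  obtain z where z: "z \<in> D x" "z \<notin> D' x" using assms(3) by blast
  have "y \<le> z"
  proof (rule ccontr)
    assume "\<not> y \<le> z"
    then have "z \<in> D' x" by (intro basic_cut_down[OF assms(2) y] basic_cut_pos[OF assms(1) z(1)]) simp
    with z(2) show False ..
  qed
  then show "y \<in> D x" using basic_cut_down[OF assms(1) z(1)] basic_cut_pos[OF assms(2) y] by simp
qed

text \<open>In each of the nine cases end points and scales decide the inclusion, because the order
  is dense and a scaling cut has no greatest element: with each element it contains the
  double.\<close>

lemma basic_cut_compare:
  assumes D: "basic_cut D" and D': "basic_cut D'"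
  shows "{x. D x \<subseteq> D' x} \<in> cut_sets R"
proof -
  have CX: "{x. {z. 0 < z \<and> z \<le> f x} \<subseteq> D' x} = {x. f x \<le> 0 \<or> f x \<in> D' x}" for f
  proof (intro Collect_cong iffI)
    fix x assume "{z. 0 < z \<and> z \<le> f x} \<subseteq> D' x"
    then show "f x \<le> 0 \<or> f x \<in> D' x" by (cases "f x \<le> 0") auto
  next
    fix x assume *: "f x \<le> 0 \<or> f x \<in> D' x"
    show "{z. 0 < z \<and> z \<le> f x} \<subseteq> D' x"
    proof
      fix z assume z: "z \<in> {z. 0 < z \<and> z \<le> f x}"
      then have "f x \<in> D' x" using * by auto
      then show "z \<in> D' x" by (rule basic_cut_down[OF D']) (use z in auto)
    qed
  qed
  have OX: "{z. 0 < z \<and> z < f x} \<subseteq> D' x \<longleftrightarrow> f x \<le> 0 \<or> (\<forall>z. 0 < z \<longrightarrow> z < f x \<longrightarrow> z \<in> D' x)" for f x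
    by (cases "f x \<le> 0") auto
  \<comment> \<open>By density, an open segment has its end point as least upper bound.\<close>
  have half: "(\<forall>z. 0 < z \<longrightarrow> z < f \<longrightarrow> z \<le> g) \<longleftrightarrow> f \<le> g" if "0 < f" for f g :: 'k
  proof
    assume a: "\<forall>z. 0 < z \<longrightarrow> z < f \<longrightarrow> z \<le> g"
    show "f \<le> g"
    proof (rule ccontr)
      assume "\<not> f \<le> g"
      then have "max 0 g < f" using that by simp
      from dense[OF this] obtain z where "max 0 g < z" "z < f" by auto
      then show False using a[rule_format, of z] by auto
    qed
  qed auto
  show ?thesis
    using D
  proof cases
    case (closed f)
    note Df = this
    from D' show ?thesis
    proof cases
      case (closed g)
      have "{x. f x \<le> 0 \<or> f x \<le> g x} \<in> cut_sets R" using Df closed by (intro cs_intros R_intros)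
      also have "{x. f x \<le> 0 \<or> f x \<le> g x} = {x. D x \<subseteq> D' x}"
        unfolding Df CX unfolding closed by (auto simp: not_le)
      finally show ?thesis .
    next
      case (opened g)
      have "{x. f x \<le> 0 \<or> f x < g x} \<in> cut_sets R" using Df opened by (intro cs_intros R_intros)
      also have "{x. f x \<le> 0 \<or> f x < g x} = {x. D x \<subseteq> D' x}"
        unfolding Df CX unfolding opened by (auto simp: not_le)
      finally show ?thesis .
    next
      case (scaled E C)
      have "{x. f x \<le> 0 \<or> f x / E x \<in> C} \<in> cut_sets R" using Df scaled by (intro cs_intros R_intros)
      also have "{x. f x \<le> 0 \<or> f x / E x \<in> C} = {x. D x \<subseteq> D' x}"
        unfolding Df CX unfolding scaled by auto
      finally show ?thesis .
    qed
  next
    case (opened f)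
    note Df = this
    from D' show ?thesis
    proof cases
      case (closed g)
      have "{x. f x \<le> 0 \<or> f x \<le> g x} \<in> cut_sets R" using Df closed by (intro cs_intros R_intros)
      also have "{x. f x \<le> 0 \<or> f x \<le> g x} = {x. D x \<subseteq> D' x}"
      proof (intro Collect_cong)
        fix x show "(f x \<le> 0 \<or> f x \<le> g x) = (D x \<subseteq> D' x)"
          unfolding Df OX unfolding closed using half[of "f x" "g x"]
          by (cases "0 < f x") (auto simp: not_less)
      qed
      finally show ?thesis .
    next
      case (opened g)
      have "{x. f x \<le> 0 \<or> f x \<le> g x} \<in> cut_sets R" using Df opened by (intro cs_intros R_intros)
      also have "{x. f x \<le> 0 \<or> f x \<le> g x} = {x. D x \<subseteq> D' x}"
      proof (intro Collect_cong)
        fix x show "(f x \<le> 0 \<or> f x \<le> g x) = (D x \<subseteq> D' x)"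
          unfolding Df OX unfolding opened using half[of "f x" "g x"]
          by (cases "0 < f x") (auto simp: not_less intro: less_imp_le)
      qed
      finally show ?thesis .
    next
      case (scaled E C)
      have "{x. f x \<le> 0 \<or> f x / E x \<in> C} \<in> cut_sets R" using Df scaled by (intro cs_intros R_intros)
      also have "{x. f x \<le> 0 \<or> f x / E x \<in> C} = {x. D x \<subseteq> D' x}"
      proof (intro Collect_cong)
        fix x
        have h1: "f x / E x \<in> C" if "0 < f x" "\<forall>z. 0 < z \<longrightarrow> z < f x \<longrightarrow> z / E x \<in> C"
        proof (rule scaling_cut_le[OF scaled(4), of "f x / 2 / E x" _ 2])
          show "f x / 2 / E x \<in> C" by (rule that(2)[rule_format]) (use that(1) in auto)
        qed (use that scaled(3)[of x] in auto)
        have h2: "z / E x \<in> C" if "f x / E x \<in> C" "0 < z" "z < f x" for z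
          by (rule scaling_cut_le[OF scaled(4) that(1), of _ 1])
            (use that scaled(3)[of x] in \<open>auto simp: divide_le_cancel dest: less_imp_le less_asym\<close>)
        have h: "f x / E x \<in> C \<longleftrightarrow> (\<forall>z. 0 < z \<longrightarrow> z < f x \<longrightarrow> z / E x \<in> C)" if "0 < f x"
        proof
          assume "f x / E x \<in> C"
          from h2[OF this] show "\<forall>z. 0 < z \<longrightarrow> z < f x \<longrightarrow> z / E x \<in> C" by blast
        qed (rule h1[OF that])
        show "(f x \<le> 0 \<or> f x / E x \<in> C) = (D x \<subseteq> D' x)"
        proof (cases "0 < f x")
          case True
          show ?thesis unfolding Df OX unfolding scaled mem_Collect_eq h[OF True] by (rule refl)
        next
          case False
          then show ?thesis unfolding Df OX by (simp add: not_less)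
        qed
      qed
      finally show ?thesis .
    qed
  next
    case (scaled E C)
    note DE = this
    \<comment> \<open>A scaled cut fits under a positive bound \<open>f\<close> exactly if it misses
      \<open>f\<close>, since otherwise it contains \<open>2 * f\<close>. Under a bound that is not
      positive only the empty cut fits. The flag \<open>b\<close> tells whether the bound itself is
      allowed.\<close>
    have up: "(\<forall>z. z / E x \<in> C \<longrightarrow> q z) \<longleftrightarrow> (if 0 < f then f / E x \<notin> C else C = {})"
      if q: "\<And>z. 0 < z \<Longrightarrow> q z \<longleftrightarrow> z < f \<or> (b \<and> z = f)" for x q f b
    proof -
      have Ex: "0 < E x" using DE by simp
      have pos: "0 < z" if "z / E x \<in> C" for z
        using scaling_cut_pos[OF DE(4) that] Ex by (simp add: zero_less_divide_iff)
      show ?thesis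
      proof (cases "0 < f")
        case True
        have h1: "f / E x \<in> C" if "z / E x \<in> C" "\<not> q z" for z
          by (rule scaling_cut_le[OF DE(4) that(1), of _ 1])
            (use that q[OF pos[OF that(1)]] True Ex in \<open>auto simp: divide_le_cancel dest: less_imp_le less_asym\<close>)
        have h2: "2 * f / E x \<in> C \<and> \<not> q (2 * f)" if "f / E x \<in> C"
          using scaling_cut_le[OF DE(4) that, of "2 * f / E x" 2] q[of "2 * f"] True Ex by auto
        have "(\<forall>z. z / E x \<in> C \<longrightarrow> q z) \<longleftrightarrow> f / E x \<notin> C" using h1 h2 by blast
        then show ?thesis using True by simp
      next
        case False
        have h3: "\<not> q z" if "0 < z" for z using q[OF that] False that by auto
        have "(\<forall>z. z / E x \<in> C \<longrightarrow> q z) \<longleftrightarrow> C = {}"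
        proof
          assume all: "\<forall>z. z / E x \<in> C \<longrightarrow> q z"
          show "C = {}"
          proof (rule equals0I)
            fix c assume "c \<in> C"
            then have c: "(c * E x) / E x \<in> C" using Ex by simp
            with all have "q (c * E x)" by blast
            with h3 pos[OF c] show False by blast
          qed
        qed simp
        then show ?thesis using False by simp
      qed
    qed
    from D' show ?thesis
    proof cases
      case (closed g)
      have "{x. 0 < g x \<and> \<not> g x / E x \<in> C \<or> \<not> 0 < g x \<and> C = {}} \<in> cut_sets R"
        using DE closed by (intro cs_intros R_intros)
      also have "{x. 0 < g x \<and> \<not> g x / E x \<in> C \<or> \<not> 0 < g x \<and> C = {}} = {x. D x \<subseteq> D' x}"
      proof (intro Collect_cong)
        fix x
        have u: "(\<forall>z. z / E x \<in> C \<longrightarrow> 0 < z \<and> z \<le> g x) \<longleftrightarrow> (if 0 < g x then g x / E x \<notin> C else C = {})"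
          by (rule up[where b = True]) (auto simp: le_less)
        show "(0 < g x \<and> \<not> g x / E x \<in> C \<or> \<not> 0 < g x \<and> C = {}) = (D x \<subseteq> D' x)"
          unfolding DE(1) closed(1) subset_iff mem_Collect_eq u by simp
      qed
      finally show ?thesis .
    next
      case (opened g)
      have "{x. 0 < g x \<and> \<not> g x / E x \<in> C \<or> \<not> 0 < g x \<and> C = {}} \<in> cut_sets R"
        using DE opened by (intro cs_intros R_intros)
      also have "{x. 0 < g x \<and> \<not> g x / E x \<in> C \<or> \<not> 0 < g x \<and> C = {}} = {x. D x \<subseteq> D' x}"
      proof (intro Collect_cong)
        fix x
        have u: "(\<forall>z. z / E x \<in> C \<longrightarrow> 0 < z \<and> z < g x) \<longleftrightarrow> (if 0 < g x then g x / E x \<notin> C else C = {})"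
          by (rule up[where b = False]) auto
        show "(0 < g x \<and> \<not> g x / E x \<in> C \<or> \<not> 0 < g x \<and> C = {}) = (D x \<subseteq> D' x)"
          unfolding DE(1) opened(1) subset_iff mem_Collect_eq u by simp
      qed
      finally show ?thesis .
    next
      case (scaled E' C')
      define K where "K = {e. 0 < e \<and> \<not> (\<forall>c\<in>C. c / e \<in> C')}"
      have K: "scaling_cut K" unfolding K_def by (rule scaling_cut_compare[OF DE(4) scaled(4)])
      have "{x. \<not> E' x / E x \<in> K} \<in> cut_sets R" using DE scaled K by (intro cs_intros R_intros)
      also have "{x. \<not> E' x / E x \<in> K} = {x. D x \<subseteq> D' x}"
      proof (intro Collect_cong)
        fix x
        have pos: "0 < E x" "0 < E' x" using DE scaled by auto
        have "(\<forall>c\<in>C. c / (E' x / E x) \<in> C') \<longleftrightarrow> (\<forall>z. z / E x \<in> C \<longrightarrow> z / E' x \<in> C')"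
        proof
          assume a: "\<forall>c\<in>C. c / (E' x / E x) \<in> C'"
          show "\<forall>z. z / E x \<in> C \<longrightarrow> z / E' x \<in> C'"
          proof (intro allI impI)
            fix z assume "z / E x \<in> C"
            from bspec[OF a this] show "z / E' x \<in> C'" using pos by simp
          qed
        next
          assume a: "\<forall>z. z / E x \<in> C \<longrightarrow> z / E' x \<in> C'"
          show "\<forall>c\<in>C. c / (E' x / E x) \<in> C'"
          proof
            fix c assume "c \<in> C"
            then show "c / (E' x / E x) \<in> C'" using a[rule_format, of "c * E x"] pos by simp
          qed
        qed
        then show "(\<not> E' x / E x \<in> K) = (D x \<subseteq> D' x)"
          unfolding DE(1) scaled(1) K_def subset_iff mem_Collect_eq using pos by simp
      qed
      finally show ?thesis .
    qed
  qed
qed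

end

section \<open>Elimination of one variable\<close>

context full_alg
begin

definition cell :: "'x set \<Rightarrow> ('x \<Rightarrow> 'k set) \<Rightarrow> ('x \<Rightarrow> 'k set) \<Rightarrow> ('x \<times> 'k) set" where
  "cell A D D' = {(x, z). x \<in> A \<and> z \<in> D x \<and> z \<notin> D' x}"

lemma cell_iff: "(x, z) \<in> cell A D D' \<longleftrightarrow> x \<in> A \<and> z \<in> D x \<and> z \<notin> D' x"
  by (simp add: cell_def)

inductive_set zsets :: "('x \<times> 'k) set set" where
  zcell: "A \<in> cut_sets R \<Longrightarrow> basic_cut D \<Longrightarrow> basic_cut D' \<Longrightarrow> cell A D D' \<in> zsets"
| zempty: "{} \<in> zsets"
| zunion: "W \<in> zsets \<Longrightarrow> V \<in> zsets \<Longrightarrow> W \<union> V \<in> zsets"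

text \<open>Of the two outer segments the smaller one counts, of the two removed ones the larger.
  Which is which varies with the parameter, but definably, and this gives four cells.\<close>

lemma cell_inter:
  assumes A: "A1 \<in> cut_sets R" "A2 \<in> cut_sets R"
    and D: "basic_cut D1" "basic_cut D2" and E: "basic_cut E1" "basic_cut E2"
  shows "cell A1 D1 E1 \<inter> cell A2 D2 E2 \<in> zsets"
proof -
  define S T where "S = {x. D1 x \<subseteq> D2 x}" and "T = {x. E1 x \<subseteq> E2 x}"
  have ST: "S \<in> cut_sets R" "T \<in> cut_sets R"
    unfolding S_def T_def using D E by (auto intro: basic_cut_compare)
  define A where "A = A1 \<inter> A2"
  have Acs: "A \<in> cut_sets R" unfolding A_def using A by (rule cut_sets.inter)
  have nS: "D2 x \<subseteq> D1 x" if "x \<notin> S" for x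
    using that basic_cut_linear[OF D] by (simp add: S_def)
  have nT: "E2 x \<subseteq> E1 x" if "x \<notin> T" for x
    using that basic_cut_linear[OF E] by (simp add: T_def)
  have "cell (A \<inter> (S \<inter> T)) D1 E2 \<union> (cell (A \<inter> (S \<inter> - T)) D1 E1 \<union>
      (cell (A \<inter> (- S \<inter> T)) D2 E2 \<union> cell (A \<inter> (- S \<inter> - T)) D2 E1)) \<in> zsets"
    using Acs ST D E by (intro zunion zcell cut_sets.inter cut_sets.compl)
  moreover have "(x, z) \<in> cell (A \<inter> (S \<inter> T)) D1 E2 \<union> (cell (A \<inter> (S \<inter> - T)) D1 E1 \<union>
      (cell (A \<inter> (- S \<inter> T)) D2 E2 \<union> cell (A \<inter> (- S \<inter> - T)) D2 E1))
      \<longleftrightarrow> (x, z) \<in> cell A1 D1 E1 \<inter> cell A2 D2 E2" for x z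
  proof -
    have 1: "if x \<in> S then z \<in> D1 x \<longrightarrow> z \<in> D2 x else z \<in> D2 x \<longrightarrow> z \<in> D1 x"
      using nS[of x] by (auto simp: S_def)
    have 2: "if x \<in> T then z \<in> E1 x \<longrightarrow> z \<in> E2 x else z \<in> E2 x \<longrightarrow> z \<in> E1 x"
      using nT[of x] by (auto simp: T_def)
    show ?thesis
      unfolding Un_iff Int_iff Compl_iff cell_iff A_def using 1 2 by argo
  qed
  then have "cell (A \<inter> (S \<inter> T)) D1 E2 \<union> (cell (A \<inter> (S \<inter> - T)) D1 E1 \<union>
      (cell (A \<inter> (- S \<inter> T)) D2 E2 \<union> cell (A \<inter> (- S \<inter> - T)) D2 E1))
      = cell A1 D1 E1 \<inter> cell A2 D2 E2"
    by (intro Set.set_eqI) (simp only: split_paired_all)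
  ultimately show ?thesis by simp
qed

lemma zsets_inter:
  assumes "W \<in> zsets" "V \<in> zsets"
  shows "W \<inter> V \<in> zsets"
  using assms(1)
proof induction
  case (zcell A D D')
  from assms(2) show ?case
  proof induction
    case (zcell A' E E')
    then show ?case using \<open>A \<in> cut_sets R\<close> \<open>basic_cut D\<close> \<open>basic_cut D'\<close> by (intro cell_inter)
  next
    case zempty
    show ?case using zsets.zempty by simp
  next
    case (zunion W V)
    then show ?case by (simp only: Int_Un_distrib zsets.zunion)
  qed
next
  case zempty
  show ?case using zsets.zempty by simp
next
  case (zunion W V)
  then show ?case by (simp only: Int_Un_distrib2 zsets.zunion)
qed

abbreviation whole :: "'x \<Rightarrow> 'k set" where "whole \<equiv> \<lambda>x. {z. z / 1 \<in> {0<..}}"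
abbreviation none :: "'x \<Rightarrow> 'k set" where "none \<equiv> \<lambda>x. {z. 0 < z \<and> z \<le> 0}"

lemma basic_whole: "basic_cut whole"
  by (rule basic_cut.scaled) (auto intro: R_intros)

lemma basic_none: "basic_cut none"
  by (rule basic_cut.closed) (rule R_const)

lemma zsets_compl:
  assumes "W \<in> zsets"
  shows "{(x, z). 0 < z \<and> (x, z) \<notin> W} \<in> zsets"
  using assms
proof induction
  case (zcell A D D')
  then have "cell (- A) whole none \<union> (cell UNIV whole D \<union> cell UNIV D' none) \<in> zsets"
    using UNIV_cs by (intro zsets.zunion zsets.zcell basic_whole basic_none cut_sets.compl)
  also have "cell (- A) whole none \<union> (cell UNIV whole D \<union> cell UNIV D' none)
      = {(x, z). 0 < z \<and> (x, z) \<notin> cell A D D'}"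
    using basic_cut_pos[OF zcell(3)] by (auto simp: cell_def)
  finally show ?case .
next
  case zempty
  have "cell UNIV whole none \<in> zsets" using UNIV_cs by (intro zsets.zcell basic_whole basic_none)
  also have "cell UNIV whole none = {(x, z). 0 < z \<and> (x, z) \<notin> {}}" by (auto simp: cell_def)
  finally show ?case .
next
  case (zunion W V)
  have "{(x, z). 0 < z \<and> (x, z) \<notin> W \<union> V}
      = {(x, z). 0 < z \<and> (x, z) \<notin> W} \<inter> {(x, z). 0 < z \<and> (x, z) \<notin> V}" by auto
  then show ?case using zsets_inter[OF zunion.IH] by simp
qed

text \<open>Over a parameter in \<open>A\<close>, a cell has an empty fibre exactly if
  \<open>D x \<subseteq> D' x\<close>, which \<open>basic_cut_compare\<close> makes definable.
  Unions commute with projection.\<close>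

lemma zsets_proj:
  assumes "W \<in> zsets"
  shows "{x. \<exists>z. (x, z) \<in> W} \<in> cut_sets R"
  using assms
proof induction
  case (zcell A D D')
  have "{x. x \<in> A \<and> \<not> x \<in> {x. D x \<subseteq> D' x}} \<in> cut_sets R"
    using zcell by (intro cs_intros basic_cut_compare)
  also have "{x. x \<in> A \<and> \<not> x \<in> {x. D x \<subseteq> D' x}} = {x. \<exists>z. (x, z) \<in> cell A D D'}"
    by (auto simp: cell_def)
  finally show ?case .
next
  case zempty
  show ?case using cs_const[of False] by simp
next
  case (zunion W V)
  have "{x. (\<exists>z. (x, z) \<in> W) \<or> (\<exists>z. (x, z) \<in> V)} \<in> cut_sets R"
    using zunion.IH by (rule cs_disj)
  also have "{x. (\<exists>z. (x, z) \<in> W) \<or> (\<exists>z. (x, z) \<in> V)} = {x. \<exists>z. (x, z) \<in> W \<union> V}" by blast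
  finally show ?case .
qed

text \<open>A difference of two initial segments is convex.\<close>

lemma zsets_fibre:
  assumes "W \<in> zsets"
  shows "fin_convex {z. (x, z) \<in> W}"
  using assms
proof induction
  case (zcell A D D')
  have "order_convex_in UNIV {z. (x, z) \<in> cell A D D'}"
    unfolding order_convex_in_def
  proof (intro conjI ballI impI)
    fix a b y assume a: "a \<in> {z. (x, z) \<in> cell A D D'}" and b: "b \<in> {z. (x, z) \<in> cell A D D'}"
      and y: "a \<le> y \<and> y \<le> b"
    have a0: "0 < a" using a basic_cut_pos[OF zcell(2)] by (auto simp: cell_def)
    have "y \<in> D x" by (rule basic_cut_down[OF zcell(2), of b]) (use a0 b y in \<open>auto simp: cell_def\<close>)
    moreover have "y \<notin> D' x"
    proof
      assume "y \<in> D' x"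
      then have "a \<in> D' x" by (rule basic_cut_down[OF zcell(3)]) (use a0 y in auto)
      then show False using a by (simp add: cell_def)
    qed
    ultimately show "y \<in> {z. (x, z) \<in> cell A D D'}" using a by (simp add: cell_def)
  qed simp
  then show ?case by (rule fin_convex_convex)
next
  case zempty
  show ?case using fin_convex_empty by simp
next
  case (zunion W V)
  have "{z. (x, z) \<in> W \<union> V} = {z. (x, z) \<in> W} \<union> {z. (x, z) \<in> V}" by auto
  then show ?case using fin_convex_Un[OF zunion.IH] by simp
qed

section \<open>Conditions on a positive variable over the parameters\<close>

definition zs :: "('x \<Rightarrow> 'k \<Rightarrow> bool) \<Rightarrow> bool" where
  "zs p \<longleftrightarrow> {(x, z). 0 < z \<and> p x z} \<in> zsets"

named_theorems zs_intros

lemma zs_not [zs_intros]: "zs p \<Longrightarrow> zs (\<lambda>x z. \<not> p x z)"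
proof -
  assume "zs p"
  then have "{(x, z). 0 < z \<and> (x, z) \<notin> {(x, z). 0 < z \<and> p x z}} \<in> zsets"
    unfolding zs_def by (rule zsets_compl)
  also have "{(x, z). 0 < z \<and> (x, z) \<notin> {(x, z). 0 < z \<and> p x z}} = {(x, z). 0 < z \<and> \<not> p x z}" by auto
  finally show ?thesis unfolding zs_def .
qed

lemma zs_conj [zs_intros]: "zs p \<Longrightarrow> zs q \<Longrightarrow> zs (\<lambda>x z. p x z \<and> q x z)"
proof -
  assume "zs p" "zs q"
  then have "{(x, z). 0 < z \<and> p x z} \<inter> {(x, z). 0 < z \<and> q x z} \<in> zsets"
    unfolding zs_def by (rule zsets_inter)
  also have "{(x, z). 0 < z \<and> p x z} \<inter> {(x, z). 0 < z \<and> q x z} = {(x, z). 0 < z \<and> p x z \<and> q x z}" by auto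
  finally show ?thesis unfolding zs_def .
qed

lemma zs_disj [zs_intros]: "zs p \<Longrightarrow> zs q \<Longrightarrow> zs (\<lambda>x z. p x z \<or> q x z)"
proof -
  assume "zs p" "zs q"
  then have "zs (\<lambda>x z. \<not> (\<not> p x z \<and> \<not> q x z))" by (intro zs_not zs_conj)
  then show ?thesis by simp
qed

lemma zs_const [zs_intros]:
  assumes "{x. p x} \<in> cut_sets R"
  shows "zs (\<lambda>x z. p x)"
proof -
  have "cell {x. p x} whole none \<in> zsets" using assms by (intro zcell basic_whole basic_none)
  also have "cell {x. p x} whole none = {(x, z). 0 < z \<and> p x}" by (auto simp: cell_def)
  finally show ?thesis unfolding zs_def .
qed

lemma zs_ball [zs_intros]:
  "finite I \<Longrightarrow> (\<And>i. i \<in> I \<Longrightarrow> zs (p i)) \<Longrightarrow> zs (\<lambda>x z. \<forall>i\<in>I. p i x z)"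
proof (induction I rule: finite_induct)
  case empty
  show ?case using zs_const[OF cs_const[of True]] by simp
next
  case (insert i I)
  then have "zs (\<lambda>x z. p i x z \<and> (\<forall>i\<in>I. p i x z))" by (intro zs_conj) auto
  then show ?case by simp
qed

lemma zs_bex [zs_intros]:
  "finite I \<Longrightarrow> (\<And>i. i \<in> I \<Longrightarrow> zs (p i)) \<Longrightarrow> zs (\<lambda>x z. \<exists>i\<in>I. p i x z)"
proof -
  assume "finite I" "\<And>i. i \<in> I \<Longrightarrow> zs (p i)"
  then have "zs (\<lambda>x z. \<not> (\<forall>i\<in>I. \<not> p i x z))" by (intro zs_not zs_ball)
  then show ?thesis by simp
qed

lemma zs_le:
  assumes "f \<in> R"
  shows "zs (\<lambda>x z. z \<le> f x)"
proof -
  have "cell UNIV (\<lambda>x. {z. 0 < z \<and> z \<le> f x}) none \<in> zsets"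
    using assms by (intro zcell basic_cut.closed basic_none UNIV_cs)
  also have "cell UNIV (\<lambda>x. {z. 0 < z \<and> z \<le> f x}) none = {(x, z). 0 < z \<and> z \<le> f x}"
    by (auto simp: cell_def)
  finally show ?thesis unfolding zs_def .
qed

text \<open>Take \<open>m\<close>-th roots on both sides: that of \<open>E\<close> lies in
  \<open>R\<close> by \<open>R_root\<close>, and that of a scaling cut is a scaling cut.\<close>

lemma zs_power_divide:
  assumes E: "E \<in> R" and C: "scaling_cut C" and m: "m \<ge> 1"
  shows "zs (\<lambda>x z. z ^ m / E x \<in> C)"
proof -
  \<comment> \<open>Where \<open>E\<close> is not positive the condition is false; the value 1 only
    keeps the function positive there.\<close>
  define E' where "E' x = (if 0 < E x then E x else 1)" for x
  have "E' \<in> R" unfolding E'_def using E by (intro R_intros cs_intros)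
  moreover have "0 < E' x" for x by (simp add: E'_def)
  ultimately have "\<exists>g\<in>R. \<forall>x. 0 < g x \<and> g x ^ m = E' x" using m by (rule R_root)
  then obtain g where g: "g \<in> R" "\<forall>x. 0 < g x \<and> g x ^ m = E' x" by (elim bexE)
  define C' where "C' = {u. 0 < u \<and> u ^ m \<in> C}"
  have C': "scaling_cut C'" unfolding C'_def by (rule scaling_cut_root[OF C])
  have "cell {x. 0 < E x} (\<lambda>x. {z. z / g x \<in> C'}) none \<in> zsets"
    using E g C' by (intro zcell basic_cut.scaled basic_none cs_intros R_intros) auto
  also have "cell {x. 0 < E x} (\<lambda>x. {z. z / g x \<in> C'}) none = {(x, z). 0 < z \<and> z ^ m / E x \<in> C}"
  proof (rule Set.set_eqI)
    fix p :: "'x \<times> 'k"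
    obtain x z where p: "p = (x, z)" by (cases p)
    have gx: "0 < g x" "g x ^ m = E' x" using g(2) by auto
    have 1: "0 < z" if "z / g x \<in> C'" using that gx by (auto simp: C'_def zero_less_divide_iff)
    have 2: "0 < E x" if "0 < z" "z ^ m / E x \<in> C"
    proof -
      have "0 < z ^ m / E x" by (rule scaling_cut_pos[OF C that(2)])
      moreover have "0 < z ^ m" using that by simp
      ultimately show ?thesis by (metis less_asym zero_less_divide_iff)
    qed
    have "z / g x \<in> C' \<longleftrightarrow> z ^ m / E x \<in> C" if "0 < z" "0 < E x"
      using that gx by (auto simp: C'_def E'_def power_divide)
    then show "p \<in> cell {x. 0 < E x} (\<lambda>x. {z. z / g x \<in> C'}) none \<longleftrightarrow> p \<in> {(x, z). 0 < z \<and> z ^ m / E x \<in> C}"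
      unfolding p cell_def using 1 2 by auto
  qed
  finally show ?thesis unfolding zs_def .
qed

lemma zs_divide_power:
  assumes E: "E \<in> R" and C: "scaling_cut C" and m: "m \<ge> 1"
  shows "zs (\<lambda>x z. E x / z ^ m \<in> C)"
proof -
  define C' where "C' = {t. 0 < t \<and> 1 / t \<notin> C}"
  have C': "scaling_cut C'" unfolding C'_def by (rule scaling_cut_inverse[OF C])
  have "zs (\<lambda>x z. 0 < E x \<and> \<not> z ^ m / E x \<in> C')"
    using E C' m by (intro zs_intros zs_power_divide cs_intros R_intros)
  moreover have "(0 < E x \<and> \<not> z ^ m / E x \<in> C') \<longleftrightarrow> E x / z ^ m \<in> C" if z: "0 < z" for x z
  proof -
    have zm: "0 < z ^ m" using z by simp
    have "0 < E x" if "E x / z ^ m \<in> C"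
      using scaling_cut_pos[OF C that] zm by (metis less_asym zero_less_divide_iff)
    then show ?thesis using zm by (auto simp: C'_def)
  qed
  ultimately show ?thesis unfolding zs_def by (simp cong: conj_cong)
qed

lemma zs_monomial_ratio:
  assumes a: "a \<in> R" and b: "b \<in> R" and C: "scaling_cut C"
  shows "zs (\<lambda>x z. (a x * z ^ k) / (b x * z ^ l) \<in> C)"
proof (cases k l rule: linorder_cases)
  case less
  have "zs (\<lambda>x z. (a x / b x) / z ^ (l - k) \<in> C)"
    using a b C less by (intro zs_divide_power R_intros) auto
  moreover have "(a x / b x) / z ^ (l - k) = (a x * z ^ k) / (b x * z ^ l)" if "0 < z" for x z
  proof -
    have "z ^ l = z ^ k * z ^ (l - k)" using less by (simp add: power_add[symmetric])
    then show ?thesis using that by simp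
  qed
  ultimately show ?thesis unfolding zs_def by (simp cong: conj_cong)
next
  case equal
  have "zs (\<lambda>x z. a x / b x \<in> C)" using a b C by (intro zs_const cs_intros)
  then show ?thesis unfolding zs_def equal by (simp cong: conj_cong)
next
  case greater
  have "zs (\<lambda>x z. z ^ (k - l) / (b x / a x) \<in> C)"
    using a b C greater by (intro zs_power_divide R_intros) auto
  moreover have "z ^ (k - l) / (b x / a x) = (a x * z ^ k) / (b x * z ^ l)" if "0 < z" for x z
  proof -
    have "z ^ k = z ^ l * z ^ (k - l)" using greater by (simp add: power_add[symmetric])
    then show ?thesis using that by simp
  qed
  ultimately show ?thesis unfolding zs_def by (simp cong: conj_cong)
qed

section \<open>Sets given by polynomials in the variable to be eliminated\<close>

inductive_set psets :: "('x \<times> 'k) set set" where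
  patom: "P \<in> pols R \<Longrightarrow> Q \<in> pols R \<Longrightarrow> scaling_cut C \<Longrightarrow>
    {(x, y). poly (P x) y / poly (Q x) y \<in> C} \<in> psets"
| pcompl: "S \<in> psets \<Longrightarrow> - S \<in> psets"
| pinter: "S \<in> psets \<Longrightarrow> T \<in> psets \<Longrightarrow> S \<inter> T \<in> psets"

lemma psets_graph:
  assumes "S \<in> psets" "g \<in> R"
  shows "{x. (x, g x) \<in> S} \<in> cut_sets R"
  using assms(1)
proof induction
  case (patom P Q C)
  then have "{x. poly (P x) (g x) / poly (Q x) (g x) \<in> C} \<in> cut_sets R"
    using assms(2) by (intro cs_intros R_intros)
  then show ?case by simp
next
  case (pcompl S)
  then have "{x. \<not> (x, g x) \<in> S} \<in> cut_sets R" by (intro cs_not)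
  then show ?case by simp
next
  case (pinter S T)
  then have "{x. (x, g x) \<in> S \<and> (x, g x) \<in> T} \<in> cut_sets R" by (intro cs_conj)
  then show ?case by simp
qed

text \<open>The bound is half the distance to each \<open>h\<close> on the side \<open>e\<close> of
  \<open>g\<close>, so that no member of \<open>G\<close> is met at \<open>g + e * y\<close> for
  \<open>0 < y < 2 * z\<close>, as \<open>poly_near_cmp\<close> demands.\<close>

definition near :: "('x \<Rightarrow> 'k) set \<Rightarrow> ('x \<Rightarrow> 'k) \<Rightarrow> 'k \<Rightarrow> 'x \<Rightarrow> 'k \<Rightarrow> bool" where
  "near G g e x z \<longleftrightarrow> (\<forall>h\<in>G. \<not> (0 < e * (h x - g x)) \<or> z \<le> e * (h x - g x) / 2)"

text \<open>The centre \<open>g\<close> ranges over all of \<open>R\<close> and not just over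
  \<open>G\<close>. Hence the property survives enlarging \<open>G\<close>, which gives two sets a
  common \<open>G\<close>.\<close>

definition localizes :: "('x \<times> 'k) set \<Rightarrow> ('x \<Rightarrow> 'k) set \<Rightarrow> bool" where
  "localizes S G \<longleftrightarrow> (\<forall>g\<in>R. \<forall>e. \<bar>e\<bar> = 1 \<longrightarrow> (\<exists>q. zs q \<and>
    (\<forall>x z. 0 < z \<longrightarrow> near G g e x z \<longrightarrow> ((x, g x + e * z) \<in> S \<longleftrightarrow> q x z))))"

lemma near_mono: "G \<subseteq> H \<Longrightarrow> near H g e x z \<Longrightarrow> near G g e x z"
  unfolding near_def by blast

lemma localizes_mono: "localizes S G \<Longrightarrow> G \<subseteq> H \<Longrightarrow> localizes S H"
  unfolding localizes_def
proof (intro ballI allI impI)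
  fix g and e :: 'k
  assume loc: "\<forall>g\<in>R. \<forall>e. \<bar>e\<bar> = 1 \<longrightarrow> (\<exists>q. zs q \<and>
      (\<forall>x z. 0 < z \<longrightarrow> near G g e x z \<longrightarrow> ((x, g x + e * z) \<in> S \<longleftrightarrow> q x z)))"
    and GH: "G \<subseteq> H" and ge: "g \<in> R" "\<bar>e\<bar> = 1"
  from loc[rule_format, OF ge] obtain q where q: "zs q"
    "\<forall>x z. 0 < z \<longrightarrow> near G g e x z \<longrightarrow> ((x, g x + e * z) \<in> S \<longleftrightarrow> q x z)" by (elim exE conjE)
  show "\<exists>q. zs q \<and> (\<forall>x z. 0 < z \<longrightarrow> near H g e x z \<longrightarrow> ((x, g x + e * z) \<in> S \<longleftrightarrow> q x z))"
    by (intro exI[of _ q] conjI q(1) allI impI) (use q(2) near_mono[OF GH] in blast)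
qed

text \<open>With the roots of all derivatives of \<open>P\<close> and \<open>Q\<close> in
  \<open>G\<close>, both absolute values are comparable with sums of monomials in \<open>z\<close>,
  and the sign of the product is that of its first nonzero Taylor coefficient. What remains are
  quotients of monomials and conditions on the parameter alone.\<close>

lemma localizes_atom:
  assumes P: "P \<in> pols R" and Q: "Q \<in> pols R" and C: "scaling_cut C"
  shows "\<exists>G. finite G \<and> G \<subseteq> R \<and> localizes {(x, y). poly (P x) y / poly (Q x) y \<in> C} G"
proof -
  obtain n1 n2 where n12: "\<And>x. degree (P x) \<le> n1" "\<And>x. degree (Q x) \<le> n2"
    using P Q pols_degree by metis
  define n where "n = max n1 n2"
  have dP: "degree (P x) \<le> n" and dQ: "degree (Q x) \<le> n" for x
    using n12[of x] by (auto simp: n_def)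
  have cP: "\<exists>F. root_cover (\<lambda>x. (pderiv ^^ k) (P x)) F" for k
    using P by (intro root_cover_exists P_intros)
  have cQ: "\<exists>F. root_cover (\<lambda>x. (pderiv ^^ k) (Q x)) F" for k
    using Q by (intro root_cover_exists P_intros)
  obtain G1 where G1: "finite G1" "G1 \<subseteq> R" "G1 \<noteq> {}"
    "\<And>x k y. (pderiv ^^ k) (P x) \<noteq> 0 \<Longrightarrow> poly ((pderiv ^^ k) (P x)) y = 0 \<Longrightarrow> \<exists>g\<in>G1. g x = y"
    by (fact derivs_cover[of P n, OF dP cP])
  obtain G2 where G2: "finite G2" "G2 \<subseteq> R" "G2 \<noteq> {}"
    "\<And>x k y. (pderiv ^^ k) (Q x) \<noteq> 0 \<Longrightarrow> poly ((pderiv ^^ k) (Q x)) y = 0 \<Longrightarrow> \<exists>g\<in>G2. g x = y"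
    by (fact derivs_cover[of Q n, OF dQ cQ])
  obtain m where m: "\<And>(p :: 'k poly) c e z. degree p \<le> n \<Longrightarrow> \<bar>e\<bar> = 1 \<Longrightarrow> 0 < z \<Longrightarrow>
    (\<And>k y. 0 < y \<Longrightarrow> y < 2 * z \<Longrightarrow> (pderiv ^^ k) p \<noteq> 0 \<Longrightarrow> poly ((pderiv ^^ k) p) (c + e * y) \<noteq> 0) \<Longrightarrow>
    cmp m \<bar>poly p (c + e * z)\<bar> (\<Sum>k\<le>n. \<bar>coeff (pcompose p [:c, e:]) k\<bar> * z ^ k)"
    by (fact poly_near_cmp[OF rc, of n])
  have "localizes {(x, y). poly (P x) y / poly (Q x) y \<in> C} (G1 \<union> G2)"
    unfolding localizes_def
  proof (intro ballI allI impI)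
    fix g and e :: 'k assume g: "g \<in> R" and e: "\<bar>e\<bar> = 1"
    have ee: "e * e = 1" using e by (auto simp: abs_if split: if_splits)
    define a where "a k x = \<bar>coeff (pcompose (P x) [:g x, e:]) k\<bar>" for k x
    define b where "b k x = \<bar>coeff (pcompose (Q x) [:g x, e:]) k\<bar>" for k x
    \<comment> \<open>The quotient has the sign of the product, whose degree is at most
      \<open>2 * n\<close>.\<close>
    define c where "c k x = coeff (pcompose (P x * Q x) [:g x, e:]) k" for k x
    have abR: "a k \<in> R" "b k \<in> R" "c k \<in> R" for k
      unfolding a_def b_def c_def using P Q g by (auto intro!: R_intros P_intros)
    define q where "q x z \<longleftrightarrow> (\<exists>k\<in>{..2 * n}. 0 < c k x \<and> (\<forall>j\<in>{..<k}. c j x = 0)) \<and>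
      ((\<exists>k\<in>{..n}. 0 < a k x) \<and> (\<forall>k\<in>{..n}. a k x = 0 \<or>
        (\<exists>l\<in>{..n}. (a k x * z ^ k) / (b l x * z ^ l) \<in> C)))" for x z
    have "zs q"
      unfolding q_def using abR C
      by (intro zs_conj zs_ball zs_bex zs_disj zs_monomial_ratio zs_const cs_intros R_intros) auto
    moreover have "(x, g x + e * z) \<in> {(x, y). poly (P x) y / poly (Q x) y \<in> C} \<longleftrightarrow> q x z"
      if z: "0 < z" and nr: "near (G1 \<union> G2) g e x z" for x z
    proof -
      have noG: False if h: "h \<in> G1 \<union> G2" "h x = g x + e * y" and y: "0 < y" "y < 2 * z" for h y
      proof -
        have eq: "e * (h x - g x) = y" using h(2) by (simp add: ee mult.assoc[symmetric])
        from nr[unfolded near_def, THEN bspec, OF h(1)] show False unfolding eq using y by simp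
      qed
      have nzP: "poly ((pderiv ^^ k) (P x)) (g x + e * y) \<noteq> 0"
        if "0 < y" "y < 2 * z" "(pderiv ^^ k) (P x) \<noteq> 0" for k y
        using G1(4)[OF that(3)] noG that(1,2) by blast
      have nzQ: "poly ((pderiv ^^ k) (Q x)) (g x + e * y) \<noteq> 0"
        if "0 < y" "y < 2 * z" "(pderiv ^^ k) (Q x) \<noteq> 0" for k y
        using G2(4)[OF that(3)] noG that(1,2) by blast
      define p1 p2 where "p1 = poly (P x) (g x + e * z)" and "p2 = poly (Q x) (g x + e * z)"
      have cP: "cmp m \<bar>p1\<bar> (\<Sum>k\<le>n. a k x * z ^ k)"
        unfolding p1_def a_def by (rule m[OF dP e z nzP])
      have cQ: "cmp m \<bar>p2\<bar> (\<Sum>k\<le>n. b k x * z ^ k)"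
        unfolding p2_def b_def by (rule m[OF dQ e z nzQ])
      have "p1 / p2 \<in> C \<longleftrightarrow> 0 < p1 * p2 \<and> \<bar>p1\<bar> / \<bar>p2\<bar> \<in> C"
      proof -
        have "0 < p1 * p2" if "p1 / p2 \<in> C"
          using scaling_cut_pos[OF C that] by (auto simp: zero_less_divide_iff zero_less_mult_iff)
        moreover have "\<bar>p1\<bar> / \<bar>p2\<bar> = p1 / p2" if "0 < p1 * p2"
          using that by (auto simp: zero_less_mult_iff abs_if)
        ultimately show ?thesis by (cases "0 < p1 * p2") auto
      qed
      also have "\<bar>p1\<bar> / \<bar>p2\<bar> \<in> C \<longleftrightarrow> (\<Sum>k\<le>n. a k x * z ^ k) / (\<Sum>k\<le>n. b k x * z ^ k) \<in> C"
        by (rule cmp_divide_iff[OF C cP cQ])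
      also have "\<dots> \<longleftrightarrow> (\<exists>k\<in>{..n}. 0 < a k x * z ^ k) \<and> (\<forall>k\<in>{..n}. a k x * z ^ k = 0 \<or>
          (\<exists>l\<in>{..n}. (a k x * z ^ k) / (b l x * z ^ l) \<in> C))"
        using z by (intro sum_ratio_mem_cut_iff[OF C]) (auto simp: a_def b_def)
      also have "\<dots> \<longleftrightarrow> (\<exists>k\<in>{..n}. 0 < a k x) \<and> (\<forall>k\<in>{..n}. a k x = 0 \<or>
          (\<exists>l\<in>{..n}. (a k x * z ^ k) / (b l x * z ^ l) \<in> C))"
        using z by (simp add: zero_less_mult_iff)
      also have "0 < p1 * p2 \<longleftrightarrow> (\<exists>k\<in>{..2 * n}. 0 < c k x \<and> (\<forall>j\<in>{..<k}. c j x = 0))"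
      proof -
        define h where "h = pcompose (P x * Q x) [:g x, e:]"
        have polyh: "poly h y = poly (P x) (g x + e * y) * poly (Q x) (g x + e * y)" for y
          by (simp add: h_def poly_pcompose mult.commute)
        have "degree (P x * Q x) \<le> 2 * n"
          using degree_mult_le[of "P x" "Q x"] dP[of x] dQ[of x] by linarith
        then have "degree h \<le> 2 * n" using e by (simp add: h_def degree_pcompose)
        moreover have "poly h y \<noteq> 0" if y: "0 < y" "y \<le> z" "h \<noteq> 0" for y
        proof -
          have "P x \<noteq> 0" "Q x \<noteq> 0" using y(3) by (auto simp: h_def)
          then show ?thesis using nzP[of y 0] nzQ[of y 0] y z by (simp add: polyh)
        qed
        ultimately have "0 < poly h z \<longleftrightarrow> (\<exists>k\<le>2 * n. 0 < coeff h k \<and> (\<forall>j<k. coeff h j = 0))"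
          using z by (intro poly_pos_iff_first_coeff[OF rc])
        moreover have "p1 * p2 = poly h z" by (simp add: polyh p1_def p2_def)
        ultimately show ?thesis
          by (simp add: c_def h_def[symmetric] Bex_def Ball_def del: poly_mult poly_pcompose)
      qed
      finally show ?thesis unfolding q_def p1_def p2_def by simp
    qed
    ultimately show "\<exists>q. zs q \<and> (\<forall>x z. 0 < z \<longrightarrow> near (G1 \<union> G2) g e x z \<longrightarrow>
        ((x, g x + e * z) \<in> {(x, y). poly (P x) y / poly (Q x) y \<in> C} \<longleftrightarrow> q x z))"
      by (intro exI[of _ q]) auto
  qed
  then show ?thesis using G1 G2 by (intro exI[of _ "G1 \<union> G2"]) auto
qed

lemma psets_localized:
  assumes "S \<in> psets"
  shows "\<exists>G. finite G \<and> G \<subseteq> R \<and> localizes S G"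
  using assms
proof induction
  case (patom P Q C)
  then show ?case by (rule localizes_atom)
next
  case (pcompl S)
  then obtain G where G: "finite G" "G \<subseteq> R" "localizes S G" by auto
  have "localizes (- S) G"
    unfolding localizes_def
  proof (intro ballI allI impI)
    fix g and e :: 'k assume "g \<in> R" "\<bar>e\<bar> = 1"
    then obtain q where q: "zs q"
      "\<forall>x z. 0 < z \<longrightarrow> near G g e x z \<longrightarrow> ((x, g x + e * z) \<in> S \<longleftrightarrow> q x z)"
      using G(3) unfolding localizes_def by blast
    then show "\<exists>q. zs q \<and> (\<forall>x z. 0 < z \<longrightarrow> near G g e x z \<longrightarrow> ((x, g x + e * z) \<in> - S \<longleftrightarrow> q x z))"
      by (intro exI[of _ "\<lambda>x z. \<not> q x z"]) (auto intro: zs_not)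
  qed
  then show ?case using G by auto
next
  case (pinter S T)
  then obtain G H where G: "finite G" "G \<subseteq> R" "localizes S G" and H: "finite H" "H \<subseteq> R" "localizes T H"
    by auto
  have GH: "localizes S (G \<union> H)" "localizes T (G \<union> H)"
    using G H by (auto intro: localizes_mono)
  have "localizes (S \<inter> T) (G \<union> H)"
    unfolding localizes_def
  proof (intro ballI allI impI)
    fix g and e :: 'k assume ge: "g \<in> R" "\<bar>e\<bar> = 1"
    obtain q where q: "zs q"
      "\<forall>x z. 0 < z \<longrightarrow> near (G \<union> H) g e x z \<longrightarrow> ((x, g x + e * z) \<in> S \<longleftrightarrow> q x z)"
      using GH(1) ge unfolding localizes_def by blast
    obtain r where r: "zs r"
      "\<forall>x z. 0 < z \<longrightarrow> near (G \<union> H) g e x z \<longrightarrow> ((x, g x + e * z) \<in> T \<longleftrightarrow> r x z)"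
      using GH(2) ge unfolding localizes_def by blast
    show "\<exists>q. zs q \<and> (\<forall>x z. 0 < z \<longrightarrow> near (G \<union> H) g e x z \<longrightarrow> ((x, g x + e * z) \<in> S \<inter> T \<longleftrightarrow> q x z))"
      using q r by (intro exI[of _ "\<lambda>x z. q x z \<and> r x z"]) (auto intro: zs_conj)
  qed
  then show ?case using G H by (intro exI[of _ "G \<union> H"]) auto
qed

text \<open>A point off the graphs of \<open>G\<close> is expanded at the nearest member. The
  members on the same side are then at least twice as far from the centre as the point, which is
  what \<open>near\<close> asks.\<close>

lemma psets_description:
  assumes S: "S \<in> psets"
  obtains G W where "finite G" "G \<subseteq> R" "\<And>g e. g \<in> G \<Longrightarrow> \<bar>e\<bar> = 1 \<Longrightarrow> W g e \<in> zsets"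
    "\<And>x y. (x, y) \<in> S \<longleftrightarrow> (\<exists>g\<in>G. y = g x \<and> (x, g x) \<in> S) \<or>
      (\<exists>g\<in>G. \<exists>e\<in>{1, - 1}. \<exists>z. (x, z) \<in> W g e \<and> y = g x + e * z)"
proof -
  obtain G0 where G0: "finite G0" "G0 \<subseteq> R" "localizes S G0" using psets_localized[OF S] by auto
  define G where "G = insert (\<lambda>_. 0) G0"
  have G: "finite G" "G \<subseteq> R" "G \<noteq> {}" using G0 R_const by (auto simp: G_def)
  have loc: "localizes S G" using G0(3) by (rule localizes_mono) (auto simp: G_def)
  have "\<forall>p\<in>R \<times> {e. \<bar>e\<bar> = 1}. \<exists>q. zs q \<and> (\<forall>x z. 0 < z \<longrightarrow> near G (fst p) (snd p) x z \<longrightarrow>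
      ((x, fst p x + snd p * z) \<in> S \<longleftrightarrow> q x z))"
    using loc unfolding localizes_def by auto
  from bchoice[OF this] obtain Q where Q: "\<forall>p\<in>R \<times> {e. \<bar>e\<bar> = 1}. zs (Q p) \<and>
      (\<forall>x z. 0 < z \<longrightarrow> near G (fst p) (snd p) x z \<longrightarrow> ((x, fst p x + snd p * z) \<in> S \<longleftrightarrow> Q p x z))"
    by (elim exE)
  define W where "W g e = {(x, z). 0 < z \<and> (Q (g, e) x z \<and> near G g e x z)}" for g e
  show ?thesis
  proof (rule that[of G W])
    show "finite G" "G \<subseteq> R" using G by auto
    fix g and e :: 'k assume g: "g \<in> G" and e: "\<bar>e\<bar> = 1"
    have "zs (\<lambda>x z. \<not> (0 < e * (h x - g x)) \<or> z \<le> e * (h x - g x) / 2)" if "h \<in> G" for h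
      using that g G by (intro zs_disj zs_const zs_le cs_intros R_intros) auto
    then have "zs (near G g e)"
      unfolding near_def using G by (intro zs_ball)
    moreover have "zs (Q (g, e))" using Q g e G by auto
    ultimately have "zs (\<lambda>x z. Q (g, e) x z \<and> near G g e x z)" by (intro zs_conj)
    then show "W g e \<in> zsets" unfolding zs_def W_def .
  next
    fix x y
    have Wiff: "(x, z) \<in> W g e \<longleftrightarrow> 0 < z \<and> near G g e x z \<and> (x, g x + e * z) \<in> S"
      if "g \<in> G" "\<bar>e\<bar> = 1" for g e z
      using Q[THEN bspec, of "(g, e)"] that G by (auto simp: W_def)
    show "(x, y) \<in> S \<longleftrightarrow> (\<exists>g\<in>G. y = g x \<and> (x, g x) \<in> S) \<or>
      (\<exists>g\<in>G. \<exists>e\<in>{1, - 1}. \<exists>z. (x, z) \<in> W g e \<and> y = g x + e * z)"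
    proof
      assume xy: "(x, y) \<in> S"
      show "(\<exists>g\<in>G. y = g x \<and> (x, g x) \<in> S) \<or>
        (\<exists>g\<in>G. \<exists>e\<in>{1, - 1}. \<exists>z. (x, z) \<in> W g e \<and> y = g x + e * z)"
      proof (cases "\<exists>g\<in>G. y = g x")
        case True
        then show ?thesis using xy by auto
      next
        case False
        obtain g where g: "g \<in> G" "\<forall>h\<in>G. \<bar>y - g x\<bar> \<le> \<bar>y - h x\<bar>"
          using ex_min_if_finite[of "(\<lambda>g. \<bar>y - g x\<bar>) ` G"] G by (auto simp: not_less)
        define e :: 'k where "e = (if g x < y then 1 else - 1)"
        define z where "z = \<bar>y - g x\<bar>"
        have e: "\<bar>e\<bar> = 1" "e \<in> {1, - 1}" "g x + e * z = y" by (auto simp: e_def z_def)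
        have z: "0 < z" using False g(1) by (auto simp: z_def)
        have "near G g e x z"
          unfolding near_def
        proof (intro ballI)
          fix h assume h: "h \<in> G"
          define w where "w = e * (h x - g x)"
          have "y - h x = e * (z - w)" using e(2,3) by (auto simp: w_def)
          then have "\<bar>y - h x\<bar> = \<bar>z - w\<bar>" by (simp add: abs_mult e(1))
          then have "z \<le> \<bar>z - w\<bar>" using g(2) h unfolding z_def by auto
          then show "\<not> 0 < e * (h x - g x) \<or> z \<le> e * (h x - g x) / 2"
            unfolding w_def[symmetric] by (auto simp: abs_if split: if_splits)
        qed
        then have "(x, z) \<in> W g e" using Wiff[OF g(1) e(1)] z e(3) xy by simp
        then show ?thesis using g(1) e by blast
      qed
    next
      assume "(\<exists>g\<in>G. y = g x \<and> (x, g x) \<in> S) \<or>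
        (\<exists>g\<in>G. \<exists>e\<in>{1, - 1}. \<exists>z. (x, z) \<in> W g e \<and> y = g x + e * z)"
      then show "(x, y) \<in> S" using Wiff by (elim disjE bexE exE conjE) auto
    qed
  qed
qed

theorem psets_proj:
  assumes S: "S \<in> psets"
  shows "{x. \<exists>y. (x, y) \<in> S} \<in> cut_sets R"
proof (rule psets_description[OF S])
  fix G W assume G: "finite G" "G \<subseteq> R" and W: "\<And>g e. g \<in> G \<Longrightarrow> \<bar>e\<bar> = 1 \<Longrightarrow> W g e \<in> zsets"
    and iff: "\<And>x y. (x, y) \<in> S \<longleftrightarrow> (\<exists>g\<in>G. y = g x \<and> (x, g x) \<in> S) \<or>
      (\<exists>g\<in>G. \<exists>e\<in>{1, - 1}. \<exists>z. (x, z) \<in> W g e \<and> y = g x + e * z)"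
  have "{x. (\<exists>g\<in>G. (x, g x) \<in> S) \<or> (\<exists>g\<in>G. \<exists>e\<in>{1, - 1}. \<exists>z. (x, z) \<in> W g e)} \<in> cut_sets R"
    using G W S by (intro cs_disj cs_bex psets_graph zsets_proj) auto
  also have "{x. (\<exists>g\<in>G. (x, g x) \<in> S) \<or> (\<exists>g\<in>G. \<exists>e\<in>{1, - 1}. \<exists>z. (x, z) \<in> W g e)} = {x. \<exists>y. (x, y) \<in> S}"
  proof (intro Collect_cong iffI)
    fix x assume "(\<exists>g\<in>G. (x, g x) \<in> S) \<or> (\<exists>g\<in>G. \<exists>e\<in>{1, - 1}. \<exists>z. (x, z) \<in> W g e)"
    then show "\<exists>y. (x, y) \<in> S"
    proof (elim disjE bexE exE)
      fix g e z assume "g \<in> G" "e \<in> {1, - 1}" "(x, z) \<in> W g e"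
      then have "(x, g x + e * z) \<in> S" by (subst iff) blast
      then show ?thesis ..
    qed blast
  next
    fix x assume "\<exists>y. (x, y) \<in> S"
    then obtain y where "(x, y) \<in> S" ..
    then show "(\<exists>g\<in>G. (x, g x) \<in> S) \<or> (\<exists>g\<in>G. \<exists>e\<in>{1, - 1}. \<exists>z. (x, z) \<in> W g e)"
      by (subst (asm) iff) blast
  qed
  finally show ?thesis .
qed

theorem psets_fibre:
  assumes S: "S \<in> psets"
  shows "fin_convex {y. (x, y) \<in> S}"
proof (rule psets_description[OF S])
  fix G W assume G: "finite G" "G \<subseteq> R" and W: "\<And>g e. g \<in> G \<Longrightarrow> \<bar>e\<bar> = 1 \<Longrightarrow> W g e \<in> zsets"
    and iff: "\<And>x y. (x, y) \<in> S \<longleftrightarrow> (\<exists>g\<in>G. y = g x \<and> (x, g x) \<in> S) \<or>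
      (\<exists>g\<in>G. \<exists>e\<in>{1, - 1}. \<exists>z. (x, z) \<in> W g e \<and> y = g x + e * z)"
  have "{y. (x, y) \<in> S} = (\<Union>g\<in>{g \<in> G. (x, g x) \<in> S}. {g x}) \<union>
      (\<Union>g\<in>G. \<Union>e\<in>{1, - 1}. (\<lambda>z. g x + e * z) ` {z. (x, z) \<in> W g e})"
  proof (rule Set.set_eqI)
    fix y
    show "y \<in> {y. (x, y) \<in> S} \<longleftrightarrow> y \<in> (\<Union>g\<in>{g \<in> G. (x, g x) \<in> S}. {g x}) \<union>
      (\<Union>g\<in>G. \<Union>e\<in>{1, - 1}. (\<lambda>z. g x + e * z) ` {z. (x, z) \<in> W g e})"
      unfolding mem_Collect_eq by (subst iff) blast
  qed
  moreover have "fin_convex \<dots>"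
  proof (intro fin_convex_Un fin_convex_UN)
    show "fin_convex {g x}" for g by (intro fin_convex_convex) (auto simp: order_convex_in_def)
    fix g and e :: 'k assume "g \<in> G" and e: "e \<in> {1, - 1}"
    then have "W g e \<in> zsets" by (intro W) auto
    then show "fin_convex ((\<lambda>z. g x + e * z) ` {z. (x, z) \<in> W g e})"
      using e by (intro fin_convex_affine_image zsets_fibre) auto
  qed (use G in auto)
  ultimately show ?thesis by simp
qed

end

section \<open>Uniform approximation of formulas\<close>

inductive_set polyfuns :: "((nat \<Rightarrow> 'k::linordered_field) \<Rightarrow> 'k) set" where
  pconst: "(\<lambda>_. c) \<in> polyfuns"
| pvar: "(\<lambda>e. e i) \<in> polyfuns"
| padd: "f \<in> polyfuns \<Longrightarrow> g \<in> polyfuns \<Longrightarrow> (\<lambda>e. f e + g e) \<in> polyfuns"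
| pmult: "f \<in> polyfuns \<Longrightarrow> g \<in> polyfuns \<Longrightarrow> (\<lambda>e. f e * g e) \<in> polyfuns"

lemma fun_algebra_polyfuns: "fun_algebra polyfuns"
  unfolding fun_algebra_def by (auto intro: polyfuns.intros)

interpretation pf: fun_alg "polyfuns :: ((nat \<Rightarrow> 'k::linordered_field) \<Rightarrow> 'k) set"
  by standard (rule fun_algebra_polyfuns)

text \<open>The maximal algebra \<open>S\<close> has the same cut sets as the polynomial functions,
  so the root functions used in the projection leave no trace in the result.\<close>

theorem cut_sets_exists:
  fixes A :: "(nat \<Rightarrow> 'k::linordered_field) set"
  assumes rc: "real_closed TYPE('k)" and A: "A \<in> cut_sets polyfuns"
  shows "{e. \<exists>y. e(i := y) \<in> A} \<in> cut_sets polyfuns"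
proof -
  obtain S where S: "polyfuns \<subseteq> S" "cut_sets S = cut_sets (polyfuns :: ((nat \<Rightarrow> 'k) \<Rightarrow> 'k) set)" "full_alg S"
    using full_alg_exists[OF rc fun_algebra_polyfuns] by blast
  interpret full_alg S by (rule S(3))
  have upd: "\<exists>P\<in>pols S. \<forall>e y. f (e(i := y)) = poly (P e) y" if "f \<in> polyfuns" for f
    using that
  proof induction
    case (pconst c)
    show ?case by (rule bexI[OF _ pols_const[of "[:c:]"]]) simp
  next
    case (pvar j)
    show ?case
    proof (cases "j = i")
      case True
      then show ?thesis by (intro bexI[OF _ pols_const[of "[:0, 1:]"]]) simp
    next
      case False
      have "(\<lambda>e. e j) \<in> S" using S(1) polyfuns.pvar by blast
      from pols_of_R[OF this] show ?thesis by (rule bexI[rotated]) (use False in simp)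
    qed
  next
    case (padd f g)
    from padd.IH(1) obtain P where P: "P \<in> pols S" "\<forall>e y. f (e(i := y)) = poly (P e) y" by (elim bexE)
    from padd.IH(2) obtain Q where Q: "Q \<in> pols S" "\<forall>e y. g (e(i := y)) = poly (Q e) y" by (elim bexE)
    note PQ = P(1) Q(1) P(2) Q(2)
    from pols_add[OF PQ(1,2)] show ?case
      by (rule bexI[rotated]) (intro allI, simp only: PQ(3,4)[rule_format] poly_add)
  next
    case (pmult f g)
    from pmult.IH(1) obtain P where P: "P \<in> pols S" "\<forall>e y. f (e(i := y)) = poly (P e) y" by (elim bexE)
    from pmult.IH(2) obtain Q where Q: "Q \<in> pols S" "\<forall>e y. g (e(i := y)) = poly (Q e) y" by (elim bexE)
    note PQ = P(1) Q(1) P(2) Q(2)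
    from pols_mult[OF PQ(1,2)] show ?case
      by (rule bexI[rotated]) (intro allI, simp only: PQ(3,4)[rule_format] poly_mult)
  qed
  have "{(e, y). e(i := y) \<in> A} \<in> psets"
    using A
  proof induction
    case (atom f g C)
    obtain P where P: "P \<in> pols S" "\<forall>e y. f (e(i := y)) = poly (P e) y" using upd[OF atom(1)] by blast
    obtain Q where Q: "Q \<in> pols S" "\<forall>e y. g (e(i := y)) = poly (Q e) y" using upd[OF atom(2)] by blast
    have "{(e, y). poly (P e) y / poly (Q e) y \<in> C} \<in> psets" by (rule patom[OF P(1) Q(1) atom(3)])
    then show ?case by (simp only: P(2)[rule_format] Q(2)[rule_format] mem_Collect_eq)
  next
    case (compl A)
    have "{(e, y). e(i := y) \<in> - A} = - {(e, y). e(i := y) \<in> A}" by auto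
    then show ?case using pcompl[OF compl.IH] by (simp only:)
  next
    case (inter A B)
    have "{(e, y). e(i := y) \<in> A \<inter> B} = {(e, y). e(i := y) \<in> A} \<inter> {(e, y). e(i := y) \<in> B}" by auto
    then show ?case using pinter[OF inter.IH] by (simp only:)
  qed
  from psets_proj[OF this] show ?thesis by (simp only: S(2) mem_Collect_eq case_prod_conv)
qed

text \<open>Over a parameter space with one point, all functions may serve as coefficients, and the
  diagonal section becomes a fibre.\<close>

theorem cut_sets_diagonal:
  fixes A :: "(nat \<Rightarrow> 'k::linordered_field) set"
  assumes rc: "real_closed TYPE('k)" and A: "A \<in> cut_sets polyfuns"
  shows "fin_convex {x. (\<lambda>_. x) \<in> A}"
proof -
  have "fun_algebra (UNIV :: (unit \<Rightarrow> 'k) set)" by (simp add: fun_algebra_def)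
  then obtain S :: "(unit \<Rightarrow> 'k) set" where S: "UNIV \<subseteq> S" "full_alg S"
    using full_alg_exists[OF rc] by metis
  interpret full_alg S by (rule S(2))
  have diag: "\<exists>p. \<forall>x. f (\<lambda>_. x) = poly p x" if "f \<in> polyfuns" for f :: "(nat \<Rightarrow> 'k) \<Rightarrow> 'k"
    using that
  proof induction
    case (pconst c)
    show ?case by (intro exI[of _ "[:c:]"]) simp
  next
    case (pvar j)
    show ?case by (intro exI[of _ "[:0, 1:]"]) simp
  next
    case (padd f g)
    then obtain p q where "\<forall>x. f (\<lambda>_. x) = poly p x" "\<forall>x. g (\<lambda>_. x) = poly q x" by auto
    then show ?case by (intro exI[of _ "p + q"]) simp
  next
    case (pmult f g)
    then obtain p q where "\<forall>x. f (\<lambda>_. x) = poly p x" "\<forall>x. g (\<lambda>_. x) = poly q x" by auto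
    then show ?case by (intro exI[of _ "p * q"]) simp
  qed
  have "{(u :: unit, x). (\<lambda>_. x) \<in> A} \<in> psets"
    using A
  proof induction
    case (atom f g C)
    obtain p where p: "\<forall>x. f (\<lambda>_. x) = poly p x" using diag[OF atom(1)] by blast
    obtain q where q: "\<forall>x. g (\<lambda>_. x) = poly q x" using diag[OF atom(2)] by blast
    have "{(u :: unit, x). poly p x / poly q x \<in> C} \<in> psets"
      using patom[OF pols_const[of p] pols_const[of q] atom(3)] .
    then show ?case using p q by simp
  next
    case (compl A)
    have "{(u :: unit, x). (\<lambda>_. x) \<in> - A} = - {(u, x). (\<lambda>_. x) \<in> A}" by auto
    then show ?case using pcompl[OF compl.IH] by (simp only:)
  next
    case (inter A B)
    have "{(u :: unit, x). (\<lambda>_. x) \<in> A \<inter> B} = {(u, x). (\<lambda>_. x) \<in> A} \<inter> {(u, x). (\<lambda>_. x) \<in> B}" by auto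
    then show ?case using pinter[OF inter.IH] by (simp only:)
  qed
  from psets_fibre[OF this, of "()"] show ?thesis by simp
qed

section \<open>Finite-valued functions and their uniform limits\<close>

definition simple_fn :: "((nat \<Rightarrow> 'k::linordered_field) \<Rightarrow> 'b) \<Rightarrow> bool" where
  "simple_fn s \<longleftrightarrow> finite (range s) \<and> (\<forall>c. {e. s e = c} \<in> cut_sets polyfuns)"

lemma simple_fn_pred:
  assumes "simple_fn s"
  shows "{e. Q (s e)} \<in> cut_sets polyfuns"
proof -
  have "{e. \<exists>c\<in>{c \<in> range s. Q c}. s e = c} \<in> cut_sets polyfuns"
    using assms by (intro pf.cs_bex) (auto simp: simple_fn_def)
  also have "{e. \<exists>c\<in>{c \<in> range s. Q c}. s e = c} = {e. Q (s e)}" by auto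
  finally show ?thesis .
qed

lemma simple_fn_comp: "simple_fn s \<Longrightarrow> simple_fn (\<lambda>e. h (s e))"
  unfolding simple_fn_def[of "\<lambda>e. h (s e)"]
  using simple_fn_pred[of s] finite_imageI[of "range s" h]
  by (auto simp: image_image simple_fn_def)

lemma simple_fn_pair:
  assumes "simple_fn s" "simple_fn t"
  shows "simple_fn (\<lambda>e. (s e, t e))"
  unfolding simple_fn_def
proof (intro conjI allI)
  show "finite (range (\<lambda>e. (s e, t e)))"
    by (rule finite_subset[of _ "range s \<times> range t"]) (use assms in \<open>auto simp: simple_fn_def\<close>)
  fix c
  have "{e. s e = fst c \<and> t e = snd c} \<in> cut_sets polyfuns"
    using assms by (intro pf.cs_conj) (auto simp: simple_fn_def)
  then show "{e. (s e, t e) = c} \<in> cut_sets polyfuns" by (simp add: prod_eq_iff)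
qed

lemma simple_fn_const: "simple_fn (\<lambda>_. c)"
  unfolding simple_fn_def
proof (intro conjI allI)
  show "finite (range (\<lambda>_ :: nat \<Rightarrow> 'a. c))" by (rule finite_subset[of _ "{c}"]) auto
qed (rule pf.cs_const)

lemma simple_fn_mem:
  assumes "A \<in> cut_sets polyfuns"
  shows "simple_fn (\<lambda>e. e \<in> A)"
  unfolding simple_fn_def
proof (intro conjI allI)
  show "finite (range (\<lambda>e. e \<in> A))" by (rule finite_subset[of _ UNIV]) auto
  fix c show "{e. (e \<in> A) = c} \<in> cut_sets polyfuns"
    using assms pf.cs_not[OF pf.cs_mem[OF assms]] by (cases c) auto
qed

lemma simple_fn_map:
  "(\<And>s. s \<in> set ss \<Longrightarrow> simple_fn s) \<Longrightarrow> simple_fn (\<lambda>e. map (\<lambda>s. s e) ss)"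
proof (induction ss)
  case Nil
  show ?case using simple_fn_const[of "[]"] by simp
next
  case (Cons s ss)
  have "simple_fn (\<lambda>e. (s e, map (\<lambda>s. s e) ss))" using Cons by (intro simple_fn_pair) auto
  from simple_fn_comp[OF this, of "\<lambda>p. fst p # snd p"] show ?case by simp
qed

lemma simple_fn_sum:
  "finite I \<Longrightarrow> (\<And>i. i \<in> I \<Longrightarrow> simple_fn (s i)) \<Longrightarrow> simple_fn (\<lambda>e. \<Sum>i\<in>I. s i e :: real)"
proof (induction I rule: finite_induct)
  case empty
  show ?case using simple_fn_const[of 0] by simp
next
  case (insert i I)
  have "simple_fn (\<lambda>e. (s i e, \<Sum>i\<in>I. s i e))" using insert by (intro simple_fn_pair) auto
  from simple_fn_comp[OF this, of "\<lambda>p. fst p + snd p"] insert show ?case by simp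
qed

definition approximable :: "(nat \<Rightarrow> 'k::linordered_field) set \<Rightarrow> ((nat \<Rightarrow> 'k) \<Rightarrow> real) \<Rightarrow> bool" where
  "approximable E g \<longleftrightarrow> (\<forall>\<epsilon>>0. \<exists>s. simple_fn s \<and> (\<forall>e\<in>E. \<bar>g e - s e\<bar> \<le> \<epsilon>))"

lemma approximableE:
  assumes "approximable E g" "0 < \<epsilon>"
  obtains s where "simple_fn s" "\<forall>e\<in>E. \<bar>g e - s e\<bar> \<le> \<epsilon>"
  using assms unfolding approximable_def by blast

lemma simple_fn_bounded:
  assumes "simple_fn (s :: _ \<Rightarrow> real)"
  obtains B where "\<forall>e. \<bar>s e\<bar> \<le> B"
proof -
  have "finite (range (\<lambda>e. \<bar>s e\<bar>))" using simple_fn_comp[OF assms, of abs] by (simp add: simple_fn_def)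
  then have "\<forall>e. \<bar>s e\<bar> \<le> Max (range (\<lambda>e. \<bar>s e\<bar>))" by auto
  then show ?thesis by (rule that)
qed

lemma approximable_bounded:
  assumes "approximable E g"
  obtains B where "\<forall>e\<in>E. \<bar>g e\<bar> \<le> B"
proof -
  obtain s where s: "simple_fn s" "\<forall>e\<in>E. \<bar>g e - s e\<bar> \<le> 1"
    using approximableE[OF assms, of 1] by auto
  obtain B where B: "\<forall>e. \<bar>s e\<bar> \<le> B" using simple_fn_bounded[OF s(1)] by auto
  have "\<bar>g e\<bar> \<le> B + 1" if "e \<in> E" for e
    using s(2) B that by (smt (verit))
  then show ?thesis using that by blast
qed

text \<open>Counting the levels \<open>k / n\<close> that \<open>g\<close> reaches gives
  \<open>\<lfloor>n * g\<rfloor> / n\<close>. The superlevel sets have to agree with cut sets on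
  \<open>E\<close> only.\<close>

lemma approximable_thresholds:
  assumes g: "\<And>e. e \<in> E \<Longrightarrow> 0 \<le> g e \<and> g e \<le> 1"
    and A: "\<And>c. \<exists>A\<in>cut_sets polyfuns. \<forall>e\<in>E. e \<in> A \<longleftrightarrow> c \<le> g e"
  shows "approximable E g"
  unfolding approximable_def
proof (intro allI impI)
  fix \<epsilon> :: real assume \<epsilon>: "0 < \<epsilon>"
  obtain N where N: "1 / real (Suc N) < \<epsilon>" using \<epsilon> nat_approx_posE by blast
  define n where "n = Suc N"
  obtain T where T: "\<And>c. T c \<in> cut_sets polyfuns" "\<And>c e. e \<in> E \<Longrightarrow> e \<in> T c \<longleftrightarrow> c \<le> g e"
    using A by metis
  define s where "s e = (\<Sum>k\<in>{1..n}. if e \<in> T (real k / real n) then 1 / real n else 0)" for e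
  have "simple_fn s"
    unfolding s_def
  proof (rule simple_fn_sum)
    fix k
    show "simple_fn (\<lambda>e. if e \<in> T (real k / real n) then 1 / real n else 0)"
      by (rule simple_fn_comp[OF simple_fn_mem[OF T(1)], of "\<lambda>b. if b then 1 / real n else 0"])
  qed simp
  moreover have "\<bar>g e - s e\<bar> \<le> \<epsilon>" if e: "e \<in> E" for e
  proof -
    define m where "m = nat \<lfloor>real n * g e\<rfloor>"
    have n0: "0 < real n" by (simp add: n_def)
    have ng: "0 \<le> real n * g e" "real n * g e \<le> real n"
      using g[OF e] n0 mult_left_le[of "g e" "real n"] by auto
    have m: "real m \<le> real n * g e" "real n * g e < real m + 1"
      using ng(1) by (auto simp: m_def)
    then have "real m \<le> real n" using ng by linarith
    then have mn: "m \<le> n" by simp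
    have "k \<le> m \<longleftrightarrow> e \<in> T (real k / real n)" for k
    proof -
      have "e \<in> T (real k / real n) \<longleftrightarrow> real k \<le> real n * g e"
        using T(2)[OF e] n0 by (simp add: field_simps)
      also have "\<dots> \<longleftrightarrow> k \<le> m" using m by auto
      finally show ?thesis by simp
    qed
    then have "s e = (\<Sum>k\<in>{1..n}. if k \<in> {1..m} then 1 / real n else 0)"
      unfolding s_def by (intro sum.cong) auto
    also have "\<dots> = (\<Sum>k\<in>{1..n} \<inter> {1..m}. 1 / real n)" by (rule sum.inter_restrict[symmetric]) simp
    also have "{1..n} \<inter> {1..m} = {1..m}" using mn by auto
    finally have "s e = real m / real n" by simp
    moreover have "real m / real n \<le> g e" "g e < real m / real n + 1 / real n"
      using m n0 by (auto simp: field_simps)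
    ultimately have "\<bar>g e - s e\<bar> \<le> 1 / real n" by (auto simp: abs_le_iff)
    then show ?thesis using N by (simp add: n_def)
  qed
  ultimately show "\<exists>s. simple_fn s \<and> (\<forall>e\<in>E. \<bar>g e - s e\<bar> \<le> \<epsilon>)" by blast
qed

text \<open>Uniform continuity on the compact set of sequences that are bounded by \<open>B\<close>
  and zero from index \<open>n\<close> on.\<close>

lemma continuous_padded_uniform:
  fixes u :: "(nat \<Rightarrow> real) \<Rightarrow> real"
  assumes u: "continuous_on UNIV u" and \<epsilon>: "0 < \<epsilon>"
  obtains \<delta> where "0 < \<delta>" "\<And>xs ys. length xs = n \<Longrightarrow> length ys = n \<Longrightarrow>
    (\<And>i. i < n \<Longrightarrow> \<bar>xs ! i\<bar> \<le> B \<and> \<bar>ys ! i\<bar> \<le> B \<and> \<bar>xs ! i - ys ! i\<bar> \<le> \<delta>) \<Longrightarrow>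
    \<bar>u (nth_default 0 xs) - u (nth_default 0 ys)\<bar> \<le> \<epsilon>"
proof -
  define K where "K = PiE (UNIV :: nat set) (\<lambda>i. if i < n then {- B..B} else {0 :: real})"
  have "compactin (product_topology (\<lambda>i. euclidean :: real topology) UNIV) K"
    unfolding K_def compactin_PiE by (auto simp: compactin_euclidean_iff)
  then have "compact K" by (simp add: euclidean_product_topology compactin_euclidean_iff)
  then have "uniformly_continuous_on K u"
    using continuous_on_subset[OF u] by (intro compact_uniformly_continuous) auto
  then obtain d where d: "0 < d" "\<And>f h. f \<in> K \<Longrightarrow> h \<in> K \<Longrightarrow> dist h f < d \<Longrightarrow> dist (u h) (u f) < \<epsilon>"
    using \<epsilon> unfolding uniformly_continuous_on_def by blast
  \<comment> \<open>The distance of sequences is at most twice the largest distance among the first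
    terms plus the tail \<open>(1 / 2) ^ N\<close>. With \<open>d / 5\<close> for the coordinates
    and less than \<open>d / 2\<close> for the tail, it stays below \<open>d\<close>.\<close>
  obtain N where N: "(1 / 2 :: real) ^ N < d / 2"
    using real_arch_pow_inv[of "d / 2" "1 / 2"] d(1) by auto
  show ?thesis
  proof (rule that[of "d / 5"])
    show "0 < d / 5" using d by simp
    fix xs ys :: "real list" assume len: "length xs = n" "length ys = n"
      and le: "\<And>i. i < n \<Longrightarrow> \<bar>xs ! i\<bar> \<le> B \<and> \<bar>ys ! i\<bar> \<le> B \<and> \<bar>xs ! i - ys ! i\<bar> \<le> d / 5"
    define f h where "f = nth_default 0 xs" and "h = nth_default 0 ys"
    have f: "f i = (if i < n then xs ! i else 0)" and h: "h i = (if i < n then ys ! i else 0)" for i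
      by (auto simp: f_def h_def nth_default_def len)
    have "- B \<le> xs ! i \<and> xs ! i \<le> B \<and> - B \<le> ys ! i \<and> ys ! i \<le> B" if "i < n" for i
      using le[OF that] by linarith
    then have fhK: "f \<in> K" "h \<in> K"
      unfolding K_def by (auto simp: PiE_def Pi_def f h)
    have fh: "dist (h i) (f i) \<le> d / 5" for i
      using le[of i] d(1) by (auto simp: f h dist_real_def abs_minus_commute)
    have "{dist (h (from_nat k)) (f (from_nat k)) |k. k \<le> N}
        = (\<lambda>k. dist (h (from_nat k)) (f (from_nat k))) ` {..N}" by auto
    then have "Max {dist (h (from_nat k)) (f (from_nat k)) |k. k \<le> N} \<le> d / 5"
      using fh by (simp only:) (intro Max.boundedI, auto)
    then have "dist h f \<le> 2 * (d / 5) + (1 / 2) ^ N"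
      using dist_fun_le_dist_first_terms[of h f N] by linarith
    then have "dist h f < d" using N d(1) by linarith
    then have "dist (u h) (u f) < \<epsilon>" using d(2)[OF fhK] by simp
    then show "\<bar>u (nth_default 0 xs) - u (nth_default 0 ys)\<bar> \<le> \<epsilon>"
      by (simp add: dist_real_def f_def h_def abs_minus_commute)
  qed
qed

lemma approximable_connective:
  assumes u: "continuous_on UNIV u" and gs: "\<And>g. g \<in> set gs \<Longrightarrow> approximable E g"
  shows "approximable E (\<lambda>e. u (nth_default 0 (map (\<lambda>g. g e) gs)))"
  unfolding approximable_def
proof (intro allI impI)
  fix \<epsilon> :: real assume \<epsilon>: "0 < \<epsilon>"
  have "\<exists>B. \<forall>g\<in>set gs. \<forall>e\<in>E. \<bar>g e\<bar> \<le> B"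
    using gs
  proof (induction gs)
    case Nil
    show ?case by simp
  next
    case (Cons g gs)
    then obtain B where B: "\<forall>g\<in>set gs. \<forall>e\<in>E. \<bar>g e\<bar> \<le> B" by auto
    obtain B' where B': "\<forall>e\<in>E. \<bar>g e\<bar> \<le> B'" using approximable_bounded[of E g] Cons.prems by auto
    show ?case
      by (rule exI[of _ "max B B'"]) (use B B' in \<open>auto intro: le_max_iff_disj[THEN iffD2]\<close>)
  qed
  then obtain B where B: "\<forall>g\<in>set gs. \<forall>e\<in>E. \<bar>g e\<bar> \<le> B" ..
  obtain \<delta> where \<delta>: "0 < \<delta>" "\<And>xs ys. length xs = length gs \<Longrightarrow> length ys = length gs \<Longrightarrow>
    (\<And>i. i < length gs \<Longrightarrow> \<bar>xs ! i\<bar> \<le> B + 1 \<and> \<bar>ys ! i\<bar> \<le> B + 1 \<and> \<bar>xs ! i - ys ! i\<bar> \<le> \<delta>) \<Longrightarrow>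
    \<bar>u (nth_default 0 xs) - u (nth_default 0 ys)\<bar> \<le> \<epsilon>"
    by (fact continuous_padded_uniform[OF u \<epsilon>, of "length gs" "B + 1"])
  \<comment> \<open>The cap 1 keeps the approximants within the bound \<open>B + 1\<close> for which
    \<open>\<delta>\<close> was chosen.\<close>
  define \<eta> where "\<eta> = min \<delta> 1"
  have \<eta>: "0 < \<eta>" "\<eta> \<le> \<delta>" "\<eta> \<le> 1" using \<delta>(1) by (auto simp: \<eta>_def)
  have "\<forall>g\<in>set gs. \<exists>s. simple_fn s \<and> (\<forall>e\<in>E. \<bar>g e - s e\<bar> \<le> \<eta>)"
    using gs \<eta>(1) unfolding approximable_def by blast
  from bchoice[OF this] obtain S where S: "\<forall>g\<in>set gs. simple_fn (S g) \<and> (\<forall>e\<in>E. \<bar>g e - S g e\<bar> \<le> \<eta>)"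
    by (elim exE)
  define s where "s e = u (nth_default 0 (map (\<lambda>t. t e) (map S gs)))" for e
  have "simple_fn (\<lambda>e. map (\<lambda>t. t e) (map S gs))"
    by (rule simple_fn_map) (use S in auto)
  then have "simple_fn s" unfolding s_def by (rule simple_fn_comp)
  moreover have "\<bar>u (nth_default 0 (map (\<lambda>g. g e) gs)) - s e\<bar> \<le> \<epsilon>" if e: "e \<in> E" for e
    unfolding s_def
  proof (rule \<delta>(2))
    fix i assume i: "i < length gs"
    then have g: "gs ! i \<in> set gs" by simp
    have 1: "\<bar>(gs ! i) e\<bar> \<le> B" using B g e by blast
    have 2: "\<bar>(gs ! i) e - S (gs ! i) e\<bar> \<le> \<eta>" using S g e by blast
    have "\<bar>S (gs ! i) e\<bar> \<le> B + 1" using 1 2 \<eta>(3) by linarith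
    then show "\<bar>map (\<lambda>g. g e) gs ! i\<bar> \<le> B + 1 \<and> \<bar>map (\<lambda>t. t e) (map S gs) ! i\<bar> \<le> B + 1 \<and>
        \<bar>map (\<lambda>g. g e) gs ! i - map (\<lambda>t. t e) (map S gs) ! i\<bar> \<le> \<delta>"
      using i 1 2 \<eta>(2) by (simp del: map_map)
  qed auto
  ultimately show "\<exists>s. simple_fn s \<and> (\<forall>e\<in>E. \<bar>u (nth_default 0 (map (\<lambda>g. g e) gs)) - s e\<bar> \<le> \<epsilon>)"
    by blast
qed

lemma SUP_close:
  fixes f h :: "'a \<Rightarrow> real"
  assumes ne: "U \<noteq> {}" and h: "finite (h ` U)" and fh: "\<And>a. a \<in> U \<Longrightarrow> \<bar>f a - h a\<bar> \<le> \<epsilon>"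
  shows "\<bar>(SUP a\<in>U. f a) - (SUP a\<in>U. h a)\<bar> \<le> \<epsilon>"
proof -
  have bh: "bdd_above (h ` U)" using h by (rule bdd_above_finite)
  then obtain B where B: "\<And>a. a \<in> U \<Longrightarrow> h a \<le> B" by (auto simp: bdd_above_def)
  have bf: "bdd_above (f ` U)"
    by (rule bdd_aboveI2[of _ _ "B + \<epsilon>"]) (use B fh in \<open>smt (verit)\<close>)
  have "(SUP a\<in>U. f a) \<le> (SUP a\<in>U. h a) + \<epsilon>"
  proof (rule cSUP_least[OF ne])
    fix a assume a: "a \<in> U"
    show "f a \<le> (SUP a\<in>U. h a) + \<epsilon>" using cSUP_upper[OF a bh] fh[OF a] by linarith
  qed
  moreover have "(SUP a\<in>U. h a) \<le> (SUP a\<in>U. f a) + \<epsilon>"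
  proof (rule cSUP_least[OF ne])
    fix a assume a: "a \<in> U"
    show "h a \<le> (SUP a\<in>U. f a) + \<epsilon>" using cSUP_upper[OF a bf] fh[OF a] by linarith
  qed
  ultimately show ?thesis by linarith
qed

lemma INF_close:
  fixes f h :: "'a \<Rightarrow> real"
  assumes ne: "U \<noteq> {}" and h: "finite (h ` U)" and fh: "\<And>a. a \<in> U \<Longrightarrow> \<bar>f a - h a\<bar> \<le> \<epsilon>"
  shows "\<bar>(INF a\<in>U. f a) - (INF a\<in>U. h a)\<bar> \<le> \<epsilon>"
proof -
  have "finite ((\<lambda>a. - h a) ` U)" using finite_imageI[OF h, of uminus] by (simp add: image_image)
  then have "\<bar>(SUP a\<in>U. - f a) - (SUP a\<in>U. - h a)\<bar> \<le> \<epsilon>"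
    by (rule SUP_close[OF ne]) (use fh in \<open>simp add: abs_minus_commute\<close>)
  then show ?thesis by (simp add: Inf_real_def image_image abs_minus_commute)
qed

section \<open>Models of ORCMVR\<close>

lemma char_span_zero: "(\<lambda>_. 0) \<in> char_span \<C>"
  unfolding char_span_def by (intro CollectI exI[of _ "{}"]) auto

lemma char_span_indicator: "A \<in> \<C> \<Longrightarrow> (\<lambda>x. c * indicator A x) \<in> char_span \<C>"
proof -
  assume "A \<in> \<C>"
  moreover have "(\<lambda>x. c * indicator A x) = (\<lambda>x. \<Sum>B\<in>{A}. c * indicator B x)"
    by (simp only: sum.insert finite.emptyI empty_iff not_False_eq_True sum.empty add_0_right)
  ultimately show ?thesis
    unfolding char_span_def by (intro CollectI exI[of _ "{A}"] exI[of _ "\<lambda>_. c"] conjI) simp_all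
qed

lemma char_span_add:
  assumes "f \<in> char_span \<C>" "g \<in> char_span \<C>"
  shows "(\<lambda>x. f x + g x) \<in> char_span \<C>"
proof -
  obtain F c where F: "f = (\<lambda>x. \<Sum>A\<in>F. c A * indicator A x)" "finite F" "F \<subseteq> \<C>"
    using assms(1) unfolding char_span_def by auto
  obtain G d where G: "g = (\<lambda>x. \<Sum>A\<in>G. d A * indicator A x)" "finite G" "G \<subseteq> \<C>"
    using assms(2) unfolding char_span_def by auto
  define k where "k A = (if A \<in> F then c A else 0) + (if A \<in> G then d A else 0)" for A
  have "f x + g x = (\<Sum>A\<in>F \<union> G. k A * indicator A x)" for x
  proof -
    have "f x = (\<Sum>A\<in>F \<union> G. (if A \<in> F then c A else 0) * indicator A x)"
      unfolding F(1) using F(2) G(2) by (intro sum.mono_neutral_cong_left) auto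
    moreover have "g x = (\<Sum>A\<in>F \<union> G. (if A \<in> G then d A else 0) * indicator A x)"
      unfolding G(1) using F(2) G(2) by (intro sum.mono_neutral_cong_left) auto
    ultimately show ?thesis by (simp add: k_def sum.distrib distrib_right)
  qed
  then show ?thesis
    unfolding char_span_def using F G by (intro CollectI exI[of _ "F \<union> G"] exI[of _ k]) auto
qed

lemma char_span_sum:
  "finite I \<Longrightarrow> (\<And>i. i \<in> I \<Longrightarrow> f i \<in> char_span \<C>) \<Longrightarrow> (\<lambda>x. \<Sum>i\<in>I. f i x) \<in> char_span \<C>"
  by (induction I rule: finite_induct) (auto intro: char_span_add char_span_zero)

lemma char_span_scale:
  assumes "f \<in> char_span \<C>"
  shows "(\<lambda>x. c * f x) \<in> char_span \<C>"
proof -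
  obtain F d where F: "f = (\<lambda>x. \<Sum>A\<in>F. d A * indicator A x)" "finite F" "F \<subseteq> \<C>"
    using assms unfolding char_span_def by auto
  have "(\<lambda>x. c * f x) = (\<lambda>x. \<Sum>A\<in>F. (c * d A) * indicator A x)"
    by (simp only: F(1) sum_distrib_left mult.assoc)
  then show ?thesis
    unfolding char_span_def using F(2,3)
    by (intro CollectI exI[of _ F] exI[of _ "\<lambda>A. c * d A"] conjI)
qed

lemma char_span_restrict:
  assumes f: "f \<in> char_span \<C>" and B: "\<And>A. A \<in> \<C> \<Longrightarrow> A \<inter> B \<in> \<C>"
  shows "(\<lambda>x. f x * indicator B x) \<in> char_span \<C>"
proof -
  obtain F d where F: "f = (\<lambda>x. \<Sum>A\<in>F. d A * indicator A x)" "finite F" "F \<subseteq> \<C>"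
    using f unfolding char_span_def by auto
  have "(\<lambda>x. \<Sum>A\<in>F. d A * indicator (A \<inter> B) x) \<in> char_span \<C>"
    using F B by (intro char_span_sum char_span_indicator) auto
  moreover have "(\<lambda>x. f x * indicator B x) = (\<lambda>x. \<Sum>A\<in>F. d A * indicator (A \<inter> B) x)"
    unfolding F(1) by (auto simp: sum_distrib_right indicator_inter_arith mult.assoc)
  ultimately show ?thesis by simp
qed

lemma char_span_Union:
  assumes inter: "\<And>A B. A \<in> \<C> \<Longrightarrow> B \<in> \<C> \<Longrightarrow> A \<inter> B \<in> \<C>"
    and "finite \<A>" "\<A> \<subseteq> \<C>"
  shows "(indicator (\<Union>\<A>) :: _ \<Rightarrow> real) \<in> char_span \<C>"
  using assms(2,3)
proof (induction \<A> rule: finite_induct)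
  case empty
  have "(indicator (\<Union>{}) :: _ \<Rightarrow> real) = (\<lambda>_. 0)" by auto
  then show ?case using char_span_zero by simp
next
  case (insert A \<A>)
  then have A: "A \<in> \<C>" and IH: "(indicator (\<Union>\<A>) :: _ \<Rightarrow> real) \<in> char_span \<C>" by auto
  have "(\<lambda>x. indicator (\<Union>\<A>) x + (1 * indicator A x + (- 1) * (indicator (\<Union>\<A>) x * indicator A x)) :: real) \<in> char_span \<C>"
    using A inter by (intro char_span_add IH char_span_indicator char_span_scale char_span_restrict) auto
  moreover have "(indicator (\<Union>(insert A \<A>)) :: _ \<Rightarrow> real)
      = (\<lambda>x. indicator (\<Union>\<A>) x + (1 * indicator A x + (- 1) * (indicator (\<Union>\<A>) x * indicator A x)))"
    by (auto simp: indicator_def)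
  ultimately show ?case by simp
qed

lemma fin_convex_char_span:
  assumes "fin_convex Y"
  shows "(indicator (Y \<inter> U) :: _ \<Rightarrow> real) \<in> char_span {C. order_convex_in U C}"
proof -
  obtain \<Y> where \<Y>: "finite \<Y>" "\<forall>C\<in>\<Y>. order_convex_in UNIV C" "Y = \<Union>\<Y>"
    using assms unfolding fin_convex_def by auto
  have "(indicator (\<Union>((\<lambda>C. C \<inter> U) ` \<Y>)) :: _ \<Rightarrow> real) \<in> char_span {C. order_convex_in U C}"
  proof (rule char_span_Union)
    fix A B assume "A \<in> {C. order_convex_in U C}" "B \<in> {C. order_convex_in U C}"
    then show "A \<inter> B \<in> {C. order_convex_in U C}" unfolding order_convex_in_def by blast
  next
    show "(\<lambda>C. C \<inter> U) ` \<Y> \<subseteq> {C. order_convex_in U C}"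
      using \<Y>(2) unfolding order_convex_in_def by blast
  qed (use \<Y>(1) in simp)
  moreover have "\<Union>((\<lambda>C. C \<inter> U) ` \<Y>) = Y \<inter> U" using \<Y>(3) by auto
  ultimately show ?thesis by simp
qed

lemma INF_eq_attained:
  fixes f :: "'a \<Rightarrow> real"
  assumes "z0 \<in> A" "f z0 = m" "\<And>z. z \<in> A \<Longrightarrow> m \<le> f z"
  shows "(INF z\<in>A. f z) = m"
  using assms by (intro cInf_eq_minimum) auto

text \<open>A model seen without its valuations: a convex subring with a multiplicative norm that is
  at most 1 on it. Monotonicity of the norm and its blindness to doubling follow from this.\<close>

locale normed_convex_ring =
  fixes U :: "'k::linordered_field set" and nrm :: "'k \<Rightarrow> real"
  assumes rc: "real_closed TYPE('k)"
    and U0: "0 \<in> U" and U1: "1 \<in> U"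
    and U_add: "\<And>x y. x \<in> U \<Longrightarrow> y \<in> U \<Longrightarrow> x + y \<in> U"
    and U_mult: "\<And>x y. x \<in> U \<Longrightarrow> y \<in> U \<Longrightarrow> x * y \<in> U"
    and U_uminus: "\<And>x. x \<in> U \<Longrightarrow> - x \<in> U"
    and U_convex: "\<And>x y. 0 \<le> x \<Longrightarrow> x \<le> y \<Longrightarrow> y \<in> U \<Longrightarrow> x \<in> U"
    and nrm_0: "nrm 0 = 0" and nrm_pos: "\<And>x. x \<noteq> 0 \<Longrightarrow> 0 < nrm x"
    and nrm_mult: "\<And>x y. nrm (x * y) = nrm x * nrm y"
    and nrm_le_1: "\<And>x. x \<in> U \<Longrightarrow> nrm x \<le> 1"
    and nontriv: "\<exists>x\<in>U. x \<noteq> 0 \<and> nrm x \<noteq> 1"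
begin

lemma nrm_nonneg: "0 \<le> nrm x"
  using nrm_0 nrm_pos[of x] by (cases "x = 0") auto

lemma nrm_1: "nrm 1 = 1"
  using nrm_mult[of 1 1] nrm_pos[of 1] by simp

lemma nrm_uminus: "nrm (- x) = nrm x"
proof -
  have "nrm (- 1) * nrm (- 1) = 1" using nrm_mult[of "- 1" "- 1"] nrm_1 by simp
  then have "nrm (- 1) = 1" using nrm_nonneg[of "- 1"] by (simp add: square_eq_1_iff)
  then show ?thesis using nrm_mult[of "- 1" x] by simp
qed

lemma nrm_mono:
  assumes "0 \<le> x" "x \<le> y"
  shows "nrm x \<le> nrm y"
proof (cases "y = 0")
  case False
  then have y: "0 < y" using assms by simp
  have "x / y \<in> U" by (rule U_convex[OF _ _ U1]) (use assms y in auto)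
  then have "nrm (x / y) * nrm y \<le> 1 * nrm y"
    using nrm_le_1 nrm_nonneg by (intro mult_right_mono) auto
  then show ?thesis using y by (simp add: nrm_mult[symmetric])
qed (use assms in auto)

text \<open>The norm of 2 is squeezed between the norm of 1 and the bound 1 on \<open>U\<close>.
  This is why balls are stable under doubling.\<close>

lemma nrm_2: "nrm 2 = 1"
proof -
  have "(2 :: 'k) \<in> U" using U_add[OF U1 U1] by simp
  then show ?thesis using nrm_mono[of 1 2] nrm_le_1[of 2] nrm_1 by simp
qed

lemma U_diff: "x \<in> U \<Longrightarrow> y \<in> U \<Longrightarrow> x - y \<in> U"
  using U_add[OF _ U_uminus, of x y] by simp

lemma abs_mem_U: "\<bar>x\<bar> \<in> U \<longleftrightarrow> x \<in> U"
  using U_uminus[of x] U_uminus[of "- x"] by (auto simp: abs_if)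

lemma U_abs_le: "\<bar>x\<bar> \<le> \<bar>y\<bar> \<Longrightarrow> y \<in> U \<Longrightarrow> x \<in> U"
  using U_convex[of "\<bar>x\<bar>" "\<bar>y\<bar>"] by (simp add: abs_mem_U)

text \<open>If a nonzero \<open>x\<close> does not divide \<open>y\<close>, then
  \<open>x * z\<close> has at most half the size of \<open>y\<close>: otherwise \<open>2 * z\<close>
  would dominate \<open>y / x\<close>, and convexity would put the latter into \<open>U\<close>. So
  subtracting \<open>x * z\<close> from \<open>y\<close> cannot lower the norm, as halving preserves
  it.\<close>

lemma divis_value:
  assumes x: "x \<in> U" and y: "y \<in> U"
  shows "divis_predicate U nrm x y = (if y = 0 \<or> x \<noteq> 0 \<and> y / x \<in> U then 0 else nrm y)"
proof (cases "y = 0 \<or> x \<noteq> 0 \<and> y / x \<in> U")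
  case True
  then obtain z where "z \<in> U" "y - x * z = 0"
  proof
    assume "y = 0" then show ?thesis using that[of 0] U0 by simp
  next
    assume "x \<noteq> 0 \<and> y / x \<in> U" then show ?thesis using that[of "y / x"] by simp
  qed
  then show ?thesis
    unfolding divis_predicate_def using True nrm_0 nrm_nonneg
    by (subst INF_eq_attained[of z _ _ 0]) auto
next
  case False
  have "nrm y \<le> nrm (y - x * z)" if z: "z \<in> U" for z
  proof (cases "x = 0")
    case x0: False
    have y0: "y \<noteq> 0" using False by auto
    define t where "t = x * z / y"
    have t: "\<bar>t\<bar> \<le> 1 / 2"
    proof (rule ccontr)
      assume "\<not> \<bar>t\<bar> \<le> 1 / 2"
      then have "1 / 2 < \<bar>x * z\<bar> / \<bar>y\<bar>" by (simp only: t_def abs_divide not_le)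
      then have "1 / 2 * \<bar>y\<bar> < \<bar>x * z\<bar>" using y0 by (subst (asm) pos_less_divide_eq) auto
      then have "\<bar>y\<bar> \<le> \<bar>2 * z\<bar> * \<bar>x\<bar>" by (simp add: abs_mult mult.commute)
      then have "\<bar>y / x\<bar> \<le> \<bar>2 * z\<bar>" unfolding abs_divide using x0 by (subst pos_divide_le_eq) auto
      moreover have "2 * z \<in> U" using U_add[OF z z] by (simp only: mult_2)
      ultimately have "y / x \<in> U" by (rule U_abs_le)
      then show False using False x0 by simp
    qed
    then have "1 / 2 \<le> 1 - t" by (simp add: abs_le_iff)
    then have "nrm (1 / 2) \<le> nrm (1 - t)" by (intro nrm_mono) auto
    moreover have "nrm (1 / 2) = 1" using nrm_mult[of 2 "1 / 2"] nrm_1 nrm_2 by simp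
    ultimately have "nrm y * 1 \<le> nrm y * nrm (1 - t)" by (intro mult_left_mono nrm_nonneg) simp
    moreover have "y - x * z = y * (1 - t)" using y0 by (simp add: t_def algebra_simps)
    ultimately show ?thesis by (simp add: nrm_mult)
  qed simp
  then show ?thesis
    unfolding divis_predicate_def using False U0 by (subst INF_eq_attained[of 0 _ _ "nrm y"]) auto
qed

text \<open>For \<open>x > y\<close> the norm is monotone in the difference, so the nearest point of
  the ray is its end point \<open>y\<close>.\<close>

lemma ray_value:
  assumes x: "x \<in> U" and y: "y \<in> U"
  shows "ray_predicate U (\<lambda>a b. nrm (a - b)) x y = (if x \<le> y then 0 else nrm (x - y))"
proof (cases "x \<le> y")
  case True
  then show ?thesis
    unfolding ray_predicate_def using x nrm_0 nrm_nonneg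
    by (subst INF_eq_attained[of x _ _ 0]) auto
next
  case False
  then show ?thesis
    unfolding ray_predicate_def using y
    by (subst INF_eq_attained[of y _ _ "nrm (x - y)"]) (auto intro!: nrm_mono)
qed

abbreviation "envs \<equiv> {e :: nat \<Rightarrow> 'k. \<forall>i. e i \<in> U}"

lemma scaling_cut_U: "scaling_cut {z. 0 < z \<and> z \<in> U}"
proof (rule scaling_cutI)
  fix y z assume z: "z \<in> {z. 0 < z \<and> z \<in> U}" and y: "0 < y" "y \<le> 2 * z"
  have "2 * z \<in> U" using z U_add[of z z] by (simp only: mult_2 mem_Collect_eq)
  then show "y \<in> {z. 0 < z \<and> z \<in> U}" using U_convex[of y "2 * z"] y by simp
qed simp

lemma scaling_cut_nrm: "scaling_cut {z. 0 < z \<and> nrm z < c}"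
proof (rule scaling_cutI)
  fix y z assume z: "z \<in> {z. 0 < z \<and> nrm z < c}" and y: "0 < y" "y \<le> 2 * z"
  have "nrm y \<le> nrm (2 * z)" using y by (intro nrm_mono) auto
  then show "y \<in> {z. 0 < z \<and> nrm z < c}" using z y by (simp add: nrm_mult nrm_2)
qed simp

text \<open>Scaling cuts contain positive elements only. Negative quotients are tested after a
  change of sign, and a vanishing numerator or denominator gives the quotient 0, which lies in
  \<open>U\<close>.\<close>

lemma cs_ratio_U:
  assumes f: "f \<in> polyfuns" and g: "g \<in> polyfuns"
  shows "{e. f e / g e \<in> U} \<in> cut_sets polyfuns"
proof -
  have "{e. f e = 0 \<or> g e = 0 \<or> f e / g e \<in> {z. 0 < z \<and> z \<in> U} \<or> (- f e) / g e \<in> {z. 0 < z \<and> z \<in> U}}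
      \<in> cut_sets polyfuns"
    using f g scaling_cut_U by (intro pf.cs_intros pf.R_intros)
  also have "{e. f e = 0 \<or> g e = 0 \<or> f e / g e \<in> {z. 0 < z \<and> z \<in> U} \<or> (- f e) / g e \<in> {z. 0 < z \<and> z \<in> U}}
      = {e. f e / g e \<in> U}"
  proof (intro Collect_cong)
    fix e
    have "x = 0 \<or> x \<in> {z. 0 < z \<and> z \<in> U} \<or> - x \<in> {z. 0 < z \<and> z \<in> U} \<longleftrightarrow> x \<in> U" for x :: 'k
      using U0 U_uminus[of x] U_uminus[of "- x"] by (cases "0 < x"; cases "x = 0") auto
    from this[of "f e / g e"]
    show "(f e = 0 \<or> g e = 0 \<or> f e / g e \<in> {z. 0 < z \<and> z \<in> U} \<or> (- f e) / g e \<in> {z. 0 < z \<and> z \<in> U})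
        = (f e / g e \<in> U)"
      by (simp only: divide_eq_0_iff minus_divide_left disj_assoc)
  qed
  finally show ?thesis .
qed

lemma cs_nrm:
  assumes f: "f \<in> polyfuns"
  shows "{e. c \<le> nrm (f e)} \<in> cut_sets polyfuns"
proof -
  have one: "(\<lambda>_. 1) \<in> (polyfuns :: ((nat \<Rightarrow> 'k) \<Rightarrow> 'k) set)" by (rule polyfuns.pconst)
  have "{e. c \<le> 0 \<or> \<not> (f e = 0 \<or> f e / 1 \<in> {z. 0 < z \<and> nrm z < c} \<or> (- f e) / 1 \<in> {z. 0 < z \<and> nrm z < c})}
      \<in> cut_sets polyfuns"
    using f scaling_cut_nrm one by (intro pf.cs_intros pf.R_intros)
  also have "{e. c \<le> 0 \<or> \<not> (f e = 0 \<or> f e / 1 \<in> {z. 0 < z \<and> nrm z < c} \<or> (- f e) / 1 \<in> {z. 0 < z \<and> nrm z < c})}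
      = {e. c \<le> nrm (f e)}"
  proof (intro Collect_cong)
    fix e
    show "(c \<le> 0 \<or> \<not> (f e = 0 \<or> f e / 1 \<in> {z. 0 < z \<and> nrm z < c} \<or>
        (- f e) / 1 \<in> {z. 0 < z \<and> nrm z < c})) = (c \<le> nrm (f e))"
      unfolding mem_Collect_eq div_by_1 nrm_uminus
    proof (cases "f e = 0")
      case True
      show "(c \<le> 0 \<or> \<not> (f e = 0 \<or> 0 < f e \<and> nrm (f e) < c \<or> 0 < - f e \<and> nrm (f e) < c))
          = (c \<le> nrm (f e))"
        unfolding True nrm_0 by simp
    next
      case False
      then have "0 < f e \<or> 0 < - f e" by linarith
      moreover have "c \<le> nrm (f e)" if "c \<le> 0" using that nrm_nonneg by (rule order_trans)
      ultimately show "(c \<le> 0 \<or> \<not> (f e = 0 \<or> 0 < f e \<and> nrm (f e) < c \<or> 0 < - f e \<and> nrm (f e) < c))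
          = (c \<le> nrm (f e))"
        using False unfolding not_less[symmetric] by blast
    qed
  qed
  finally show ?thesis .
qed

section \<open>Values of terms and formulas\<close>

definition M :: "('k, ring_fn, ring_pr) metric_structure" where
  "M = \<lparr>universe = U, metric = (\<lambda>x y. nrm (x - y)), fn_interp = ring_fn_interp,
      pr_interp = orcmvr_pr_interp U nrm\<rparr>"

lemma eval_trm_polyfun:
  assumes "wf_trm orcmvr_sig U t"
  shows "(\<lambda>e. eval_trm M e t) \<in> polyfuns \<and> (\<forall>e\<in>envs. eval_trm M e t \<in> U)"
  using assms
proof (induction t)
  case (Var i)
  then show ?case by (auto intro: polyfuns.pvar)
next
  case (Param a)
  then show ?case by (auto intro: polyfuns.pconst)
next
  case (Fn f ts)
  have IH: "(\<lambda>e. eval_trm M e t) \<in> polyfuns" "\<And>e. e \<in> envs \<Longrightarrow> eval_trm M e t \<in> U" if "t \<in> set ts" for t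
    using Fn.IH[OF that] Fn.prems that by auto
  have len: "length ts = fn_arity orcmvr_sig f" using Fn.prems by simp
  show ?case
  proof (cases f)
    case Zero
    then have "ts = []" using len by (simp add: orcmvr_sig_def)
    then show ?thesis using Zero U0 by (auto simp: M_def intro: polyfuns.pconst)
  next
    case One
    then have "ts = []" using len by (simp add: orcmvr_sig_def)
    then show ?thesis using One U1 by (auto simp: M_def intro: polyfuns.pconst)
  next
    case Plus
    then have "length ts = 2" using len by (simp add: orcmvr_sig_def)
    then obtain a b where ts: "ts = [a, b]" by (auto simp: length_Suc_conv numeral_2_eq_2)
    have "(\<lambda>e. eval_trm M e a + eval_trm M e b) \<in> polyfuns"
      by (intro polyfuns.padd IH) (auto simp: ts)
    moreover have "eval_trm M e a + eval_trm M e b \<in> U" if "e \<in> envs" for e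
      by (intro U_add IH that) (auto simp: ts)
    ultimately show ?thesis using Plus by (simp add: ts M_def)
  next
    case Minus
    then have "length ts = 1" using len by (simp add: orcmvr_sig_def)
    then obtain a where ts: "ts = [a]" by (auto simp: length_Suc_conv)
    have "(\<lambda>e. - eval_trm M e a) \<in> polyfuns"
      by (intro pf.R_uminus IH) (auto simp: ts)
    moreover have "- eval_trm M e a \<in> U" if "e \<in> envs" for e
      by (intro U_uminus IH that) (auto simp: ts)
    ultimately show ?thesis using Minus by (simp add: ts M_def)
  next
    case Times
    then have "length ts = 2" using len by (simp add: orcmvr_sig_def)
    then obtain a b where ts: "ts = [a, b]" by (auto simp: length_Suc_conv numeral_2_eq_2)
    have "(\<lambda>e. eval_trm M e a * eval_trm M e b) \<in> polyfuns"
      by (intro polyfuns.pmult IH) (auto simp: ts)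
    moreover have "eval_trm M e a * eval_trm M e b \<in> U" if "e \<in> envs" for e
      by (intro U_mult IH that) (auto simp: ts)
    ultimately show ?thesis using Times by (simp add: ts M_def)
  qed
qed

text \<open>Here the projection theorem enters: whether a value is attained as one variable runs
  through \<open>U\<close> is definable, so the whole set of attained values is again a
  finite-valued function.\<close>

lemma simple_fn_image:
  assumes s: "simple_fn s"
  shows "simple_fn (\<lambda>e. (\<lambda>a. s (e(i := a))) ` U)"
  unfolding simple_fn_def
proof (intro conjI allI)
  show "finite (range (\<lambda>e. (\<lambda>a. s (e(i := a))) ` U))"
    by (rule finite_subset[of _ "Pow (range s)"]) (use s in \<open>auto simp: simple_fn_def\<close>)
  have ex: "{e. \<exists>a\<in>U. s (e(i := a)) = c} \<in> cut_sets polyfuns" for c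
  proof -
    have "{e. e i / 1 \<in> U} \<in> cut_sets polyfuns"
      by (intro cs_ratio_U polyfuns.intros)
    then have "{e. e i \<in> U} \<inter> {e. s e = c} \<in> cut_sets polyfuns"
      using s by (intro cut_sets.inter) (auto simp: simple_fn_def)
    from cut_sets_exists[OF rc this, of i]
    have "{e. \<exists>y. e(i := y) \<in> {e. e i \<in> U} \<inter> {e. s e = c}} \<in> cut_sets polyfuns" .
    also have "{e. \<exists>y. e(i := y) \<in> {e. e i \<in> U} \<inter> {e. s e = c}} = {e. \<exists>a\<in>U. s (e(i := a)) = c}"
      by auto
    finally show ?thesis .
  qed
  fix Y
  have fin: "finite (range s)" using s by (simp add: simple_fn_def)
  have "{e. Y \<subseteq> range s \<and> (\<forall>c\<in>range s. (c \<in> Y \<longrightarrow> (\<exists>a\<in>U. s (e(i := a)) = c)) \<and>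
      ((\<exists>a\<in>U. s (e(i := a)) = c) \<longrightarrow> c \<in> Y))} \<in> cut_sets polyfuns"
    by (intro pf.cs_conj pf.cs_ball[OF fin] pf.cs_imp pf.cs_const ex)
  also have "{e. Y \<subseteq> range s \<and> (\<forall>c\<in>range s. (c \<in> Y \<longrightarrow> (\<exists>a\<in>U. s (e(i := a)) = c)) \<and>
      ((\<exists>a\<in>U. s (e(i := a)) = c) \<longrightarrow> c \<in> Y))} = {e. (\<lambda>a. s (e(i := a))) ` U = Y}"
  proof (intro Collect_cong)
    fix e
    define V where "V = (\<lambda>a. s (e(i := a))) ` U"
    have V: "(\<exists>a\<in>U. s (e(i := a)) = c) \<longleftrightarrow> c \<in> V" for c
      unfolding V_def image_iff by (rule bex_cong) (auto simp: eq_commute)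
    have "V \<subseteq> range s" unfolding V_def by (rule image_subsetI) (rule rangeI)
    then show "(Y \<subseteq> range s \<and> (\<forall>c\<in>range s. (c \<in> Y \<longrightarrow> (\<exists>a\<in>U. s (e(i := a)) = c)) \<and>
        ((\<exists>a\<in>U. s (e(i := a)) = c) \<longrightarrow> c \<in> Y))) = ((\<lambda>a. s (e(i := a))) ` U = Y)"
      unfolding V V_def[symmetric] by blast
  qed
  finally show "{e. (\<lambda>a. s (e(i := a))) ` U = Y} \<in> cut_sets polyfuns" .
qed

text \<open>Supremum and infimum of an approximant are functions \<open>Q\<close> of its set of
  values. Both change by at most the uniform distance, so the error does not grow.\<close>

lemma approximable_quantifiers:
  assumes g: "approximable envs g"
  shows "approximable envs (\<lambda>e. SUP a\<in>U. g (e(i := a)))"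
    and "approximable envs (\<lambda>e. INF a\<in>U. g (e(i := a)))"
proof -
  have main: "\<exists>s. simple_fn s \<and> (\<forall>e\<in>envs. \<bar>h (\<lambda>a. g (e(i := a))) - s e\<bar> \<le> \<epsilon>)"
    if \<epsilon>: "0 < \<epsilon>" and h: "h = (\<lambda>f. Q (f ` U))"
      and close: "\<And>f f'. finite (f' ` U) \<Longrightarrow> (\<And>a. a \<in> U \<Longrightarrow> \<bar>f a - f' a\<bar> \<le> \<epsilon>) \<Longrightarrow> \<bar>h f - h f'\<bar> \<le> \<epsilon>"
    for \<epsilon> and h :: "('k \<Rightarrow> real) \<Rightarrow> real" and Q :: "real set \<Rightarrow> real"
  proof -
    obtain s where s: "simple_fn s" "\<forall>e\<in>envs. \<bar>g e - s e\<bar> \<le> \<epsilon>" using approximableE[OF g \<epsilon>] by blast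
    have "simple_fn (\<lambda>e. Q ((\<lambda>a. s (e(i := a))) ` U))"
      by (rule simple_fn_comp[OF simple_fn_image[OF s(1)]])
    moreover have "\<bar>h (\<lambda>a. g (e(i := a))) - Q ((\<lambda>a. s (e(i := a))) ` U)\<bar> \<le> \<epsilon>" if e: "e \<in> envs" for e
    proof -
      have "finite ((\<lambda>a. s (e(i := a))) ` U)"
        by (rule finite_subset[of _ "range s"]) (use s(1) in \<open>auto simp: simple_fn_def\<close>)
      moreover have "\<bar>g (e(i := a)) - s (e(i := a))\<bar> \<le> \<epsilon>" if "a \<in> U" for a
        using s(2) e that by auto
      ultimately have "\<bar>h (\<lambda>a. g (e(i := a))) - h (\<lambda>a. s (e(i := a)))\<bar> \<le> \<epsilon>" by (rule close)
      then show ?thesis by (simp add: h)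
    qed
    ultimately show ?thesis by blast
  qed
  have ne: "U \<noteq> {}" using U0 by auto
  show "approximable envs (\<lambda>e. SUP a\<in>U. g (e(i := a)))"
    unfolding approximable_def
  proof (intro allI impI)
    fix \<epsilon> :: real assume "0 < \<epsilon>"
    then show "\<exists>s. simple_fn s \<and> (\<forall>e\<in>envs. \<bar>(SUP a\<in>U. g (e(i := a))) - s e\<bar> \<le> \<epsilon>)"
      by (rule main[where h = "\<lambda>f. SUP a\<in>U. f a" and Q = Sup, OF _ refl]) (rule SUP_close[OF ne])
  qed
  show "approximable envs (\<lambda>e. INF a\<in>U. g (e(i := a)))"
    unfolding approximable_def
  proof (intro allI impI)
    fix \<epsilon> :: real assume "0 < \<epsilon>"
    then show "\<exists>s. simple_fn s \<and> (\<forall>e\<in>envs. \<bar>(INF a\<in>U. g (e(i := a))) - s e\<bar> \<le> \<epsilon>)"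
      by (rule main[where h = "\<lambda>f. INF a\<in>U. f a" and Q = Inf, OF _ refl]) (rule INF_close[OF ne])
  qed
qed

lemma eval_fm_approximable:
  assumes "wf_fm orcmvr_sig U \<phi>"
  shows "approximable envs (\<lambda>e. eval_fm M e \<phi>)"
  using assms
proof (induction \<phi>)
  case (Dist s t)
  then have s: "(\<lambda>e. eval_trm M e s) \<in> polyfuns" "\<forall>e\<in>envs. eval_trm M e s \<in> U"
    and t: "(\<lambda>e. eval_trm M e t) \<in> polyfuns" "\<forall>e\<in>envs. eval_trm M e t \<in> U"
    using eval_trm_polyfun[of s] eval_trm_polyfun[of t] by auto
  have eq: "(\<lambda>e. eval_fm M e (Dist s t)) = (\<lambda>e. nrm (eval_trm M e s - eval_trm M e t))"
    by (simp add: M_def)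
  show ?case
    unfolding eq
  proof (rule approximable_thresholds)
    fix e assume "e \<in> envs"
    then show "0 \<le> nrm (eval_trm M e s - eval_trm M e t) \<and> nrm (eval_trm M e s - eval_trm M e t) \<le> 1"
      using s(2) t(2) nrm_nonneg nrm_le_1 U_diff by blast
  next
    fix c
    show "\<exists>A\<in>cut_sets polyfuns. \<forall>e\<in>envs. e \<in> A \<longleftrightarrow> c \<le> nrm (eval_trm M e s - eval_trm M e t)"
      by (rule bexI[OF _ cs_nrm[where c = c, OF pf.R_diff[OF s(1) t(1)]]]) simp
  qed
next
  case (Pred p ts)
  have "length ts = 2" using Pred by (simp add: orcmvr_sig_def)
  then obtain s t where ts: "ts = [s, t]" by (auto simp: length_Suc_conv numeral_2_eq_2)
  define f g where "f e = eval_trm M e s" and "g e = eval_trm M e t" for e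
  have s: "f \<in> polyfuns" "\<And>e. e \<in> envs \<Longrightarrow> f e \<in> U"
    and t: "g \<in> polyfuns" "\<And>e. e \<in> envs \<Longrightarrow> g e \<in> U"
    using eval_trm_polyfun[of s] eval_trm_polyfun[of t] Pred by (auto simp: ts f_def[abs_def] g_def[abs_def])
  show ?case
  proof (cases p)
    case Divis
    have ev: "eval_fm M e (Pred p ts) = (if g e = 0 \<or> f e \<noteq> 0 \<and> g e / f e \<in> U then 0 else nrm (g e))"
      if "e \<in> envs" for e
      using divis_value[OF s(2)[OF that] t(2)[OF that]] by (simp add: M_def Divis ts f_def g_def)
    show ?thesis
    proof (rule approximable_thresholds)
      fix e assume e: "e \<in> envs"
      show "0 \<le> eval_fm M e (Pred p ts) \<and> eval_fm M e (Pred p ts) \<le> 1"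
        unfolding ev[OF e] using nrm_nonneg[of "g e"] nrm_le_1[OF t(2)[OF e]] by auto
    next
      fix c
      have A: "{e. c \<le> 0 \<or> \<not> (g e = 0 \<or> \<not> f e = 0 \<and> g e / f e \<in> U) \<and> c \<le> nrm (g e)} \<in> cut_sets polyfuns"
        using s(1) t(1) by (intro pf.cs_disj pf.cs_conj pf.cs_not pf.cs_eq pf.cs_const cs_ratio_U cs_nrm pf.R_const)
      show "\<exists>A\<in>cut_sets polyfuns. \<forall>e\<in>envs. e \<in> A \<longleftrightarrow> c \<le> eval_fm M e (Pred p ts)"
      proof (rule bexI[OF _ A], intro ballI)
        fix e assume e: "e \<in> envs"
        show "e \<in> {e. c \<le> 0 \<or> \<not> (g e = 0 \<or> \<not> f e = 0 \<and> g e / f e \<in> U) \<and> c \<le> nrm (g e)} \<longleftrightarrow> c \<le> eval_fm M e (Pred p ts)"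
          unfolding ev[OF e] mem_Collect_eq using nrm_nonneg[of "g e"] by auto
      qed
    qed
  next
    case Ray
    have ev: "eval_fm M e (Pred p ts) = (if f e \<le> g e then 0 else nrm (f e - g e))"
      if "e \<in> envs" for e
      using ray_value[OF s(2)[OF that] t(2)[OF that]] by (simp add: M_def Ray ts f_def g_def)
    show ?thesis
    proof (rule approximable_thresholds)
      fix e assume e: "e \<in> envs"
      show "0 \<le> eval_fm M e (Pred p ts) \<and> eval_fm M e (Pred p ts) \<le> 1"
        unfolding ev[OF e] using nrm_nonneg[of "f e - g e"] nrm_le_1[OF U_diff[OF s(2)[OF e] t(2)[OF e]]] by auto
    next
      fix c
      have A: "{e. c \<le> 0 \<or> \<not> f e \<le> g e \<and> c \<le> nrm (f e - g e)} \<in> cut_sets polyfuns"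
        using s(1) t(1) by (intro pf.cs_disj pf.cs_conj pf.cs_not pf.cs_le pf.cs_const cs_nrm pf.R_diff)
      show "\<exists>A\<in>cut_sets polyfuns. \<forall>e\<in>envs. e \<in> A \<longleftrightarrow> c \<le> eval_fm M e (Pred p ts)"
      proof (rule bexI[OF _ A], intro ballI)
        fix e assume e: "e \<in> envs"
        show "e \<in> {e. c \<le> 0 \<or> \<not> f e \<le> g e \<and> c \<le> nrm (f e - g e)} \<longleftrightarrow> c \<le> eval_fm M e (Pred p ts)"
          unfolding ev[OF e] mem_Collect_eq using nrm_nonneg[of "f e - g e"] by auto
      qed
    qed
  qed
next
  case (Conn u \<phi>s)
  have "approximable envs (\<lambda>e. u (nth_default 0 (map (\<lambda>g. g e) (map (\<lambda>\<phi> e. eval_fm M e \<phi>) \<phi>s))))"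
    by (rule approximable_connective) (use Conn in auto)
  moreover have "(\<lambda>e. u (nth_default 0 (map (\<lambda>g. g e) (map (\<lambda>\<phi> e. eval_fm M e \<phi>) \<phi>s))))
      = (\<lambda>e. eval_fm M e (Conn u \<phi>s))" by (simp add: comp_def)
  ultimately show ?case by simp
next
  case (SupQ i \<phi>)
  then have "approximable envs (\<lambda>e. SUP a\<in>U. eval_fm M (e(i := a)) \<phi>)"
    by (intro approximable_quantifiers) auto
  then show ?case by (simp add: M_def)
next
  case (InfQ i \<phi>)
  then have "approximable envs (\<lambda>e. INF a\<in>U. eval_fm M (e(i := a)) \<phi>)"
    by (intro approximable_quantifiers) auto
  then show ?case by (simp add: M_def)
qed

text \<open>The \<open>n\<close>-th formula is replaced by a finite-valued approximant with error
  \<open>1 / Suc n\<close>, whose level sets on the diagonal are finite unions of convex sets. The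
  approximants have the same uniform limit.\<close>

theorem weakly_o_minimal_M: "weakly_o_minimal orcmvr_sig M"
  unfolding weakly_o_minimal_def
proof (intro allI impI)
  fix P assume "definable_predicate orcmvr_sig M P"
  then obtain \<phi> where \<phi>: "\<And>n. wf_fm orcmvr_sig U (\<phi> n)"
    and lim: "uniform_limit U (\<lambda>n x. eval_fm M (\<lambda>_. x) (\<phi> n)) P sequentially"
    unfolding definable_predicate_def by (auto simp: M_def)
  have "\<exists>s. simple_fn s \<and> (\<forall>e\<in>envs. \<bar>eval_fm M e (\<phi> n) - s e\<bar> \<le> 1 / real (Suc n))" for n
    using eval_fm_approximable[OF \<phi>, of n] unfolding approximable_def by simp
  then obtain s where s: "\<And>n. simple_fn (s n)"
    "\<And>n e. e \<in> envs \<Longrightarrow> \<bar>eval_fm M e (\<phi> n) - s n e\<bar> \<le> 1 / real (Suc n)"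
    by metis
  define f where "f n x = (\<Sum>c\<in>range (s n). c * indicator ({x. s n (\<lambda>_. x) = c} \<inter> U) x)" for n x
  have fU: "f n x = s n (\<lambda>_. x)" if "x \<in> U" for n x
  proof -
    have "f n x = (\<Sum>c\<in>range (s n). if c = s n (\<lambda>_. x) then c else 0)"
      unfolding f_def using that by (intro sum.cong) (auto simp: indicator_def)
    then show ?thesis using s(1)[of n] by (simp add: simple_fn_def)
  qed
  have "f n \<in> char_span {C. order_convex_in U C}" for n
    unfolding f_def[abs_def]
  proof (intro char_span_sum char_span_scale fin_convex_char_span)
    show "finite (range (s n))" using s(1)[of n] by (simp add: simple_fn_def)
    fix c
    have "{e. s n e = c} \<in> cut_sets polyfuns" using s(1)[of n] by (simp add: simple_fn_def)
    from cut_sets_diagonal[OF rc this] show "fin_convex {x. s n (\<lambda>_. x) = c}" by simp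
  qed
  moreover have "uniform_limit U f P sequentially"
  proof (rule uniform_limitI)
    fix \<epsilon> :: real assume \<epsilon>: "0 < \<epsilon>"
    obtain N where N: "1 / real (Suc N) < \<epsilon> / 2" using \<epsilon> nat_approx_posE[of "\<epsilon> / 2"] by auto
    have "\<forall>\<^sub>F n in sequentially. \<forall>x\<in>U. dist (eval_fm M (\<lambda>_. x) (\<phi> n)) (P x) < \<epsilon> / 2"
      using uniform_limitD[OF lim, of "\<epsilon> / 2"] \<epsilon> by simp
    then show "\<forall>\<^sub>F n in sequentially. \<forall>x\<in>U. dist (f n x) (P x) < \<epsilon>"
      using eventually_ge_at_top[of N]
    proof eventually_elim
      case (elim n)
      show ?case
      proof
        fix x assume x: "x \<in> U"
        have "1 / real (Suc n) \<le> 1 / real (Suc N)" using elim(2) by (simp add: frac_le)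
        moreover have "\<bar>eval_fm M (\<lambda>_. x) (\<phi> n) - s n (\<lambda>_. x)\<bar> \<le> 1 / real (Suc n)"
          using x by (intro s(2)) simp
        moreover have "\<bar>eval_fm M (\<lambda>_. x) (\<phi> n) - P x\<bar> < \<epsilon> / 2"
          using elim(1) x by (simp add: dist_real_def)
        ultimately show "dist (f n x) (P x) < \<epsilon>"
          using N by (simp only: dist_real_def fU[OF x])
      qed
    qed
  qed
  ultimately show "weakly_regulated (universe M) P"
    unfolding weakly_regulated_def M_def by auto
qed

text \<open>An element of \<open>U\<close> with norm below 1 has no inverse in \<open>U\<close>,
  because the inverse has norm above 1.\<close>

lemma small_element: "\<exists>p. 0 < p \<and> 1 / p \<notin> U"
proof -
  obtain t where t: "t \<in> U" "t \<noteq> 0" "nrm t \<noteq> 1" using nontriv by blast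
  have "1 / t \<notin> U"
  proof
    assume "1 / t \<in> U"
    then have "nrm t * nrm (1 / t) \<le> nrm t * 1" by (intro mult_left_mono nrm_le_1 nrm_nonneg)
    then have "1 \<le> nrm t" using t(2) by (simp add: nrm_mult[symmetric] nrm_1)
    then show False using nrm_le_1[OF t(1)] t(3) by simp
  qed
  then have "1 / \<bar>t\<bar> \<notin> U" using abs_mem_U[of "1 / t"] by (simp add: abs_divide)
  then show ?thesis using t(2) by (intro exI[of _ "\<bar>t\<bar>"]) simp
qed

theorem not_o_minimal_M: "\<not> o_minimal orcmvr_sig M"
proof
  assume omin: "o_minimal orcmvr_sig M"
  define \<phi> :: "('k, ring_fn, ring_pr) fm" where "\<phi> = Pred Divis [Var 0, Fn One []]"
  define P where "P x = eval_fm M (\<lambda>_. x) \<phi>" for x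
  have wf: "wf_fm orcmvr_sig (universe M) \<phi>" "free_vars \<phi> \<subseteq> {0}"
    by (auto simp: \<phi>_def orcmvr_sig_def)
  have Pv: "P x = (if x \<noteq> 0 \<and> 1 / x \<in> U then 0 else 1)" if "x \<in> U" for x
    using divis_value[OF that U1] by (simp add: P_def \<phi>_def M_def nrm_1)
  have "definable_predicate orcmvr_sig M P"
    unfolding definable_predicate_def P_def[abs_def]
    using wf by (intro exI[of _ "\<lambda>_. \<phi>"]) (auto intro: uniform_limit_const)
  then have "strongly_regulated U P" using omin unfolding o_minimal_def by (simp add: M_def)
  then obtain f where f: "\<forall>n. f n \<in> char_span (intervals U)" "uniform_limit U f P sequentially"
    unfolding strongly_regulated_def by blast
  from uniform_limitD[OF f(2), of "1 / 2"] obtain n where n: "\<forall>x\<in>U. dist (f n x) (P x) < 1 / 2"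
    by (auto simp: eventually_sequentially)
  obtain F c where F: "f n = (\<lambda>x. \<Sum>A\<in>F. c A * indicator A x)" "finite F" "F \<subseteq> intervals U"
    using f(1)[rule_format, of n] unfolding char_span_def by auto
  \<comment> \<open>\<open>sep E A\<close> says that membership in \<open>A\<close> can change only
    at points of \<open>E\<close>. For intervals, these are the end points.\<close>
  define sep where "sep E A \<longleftrightarrow> (\<forall>x\<in>U. \<forall>y\<in>U. x \<le> y \<longrightarrow> (\<forall>e\<in>E. \<not> (x \<le> e \<and> e \<le> y)) \<longrightarrow> (x \<in> A \<longleftrightarrow> y \<in> A))"
    for E A :: "'k set"
  have up: "\<exists>E. finite E \<and> sep E A" if "A \<in> upward_rays U" for A
  proof -
    from that consider "A = U" | a where "A = U \<inter> {a..}" | a where "A = U \<inter> {a<..}"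
      unfolding upward_rays_def by auto
    then show ?thesis
    proof cases
      case 1
      then show ?thesis by (intro exI[of _ "{}"]) (auto simp: sep_def)
    next
      case (2 a)
      then show ?thesis by (intro exI[of _ "{a}"]) (auto simp: sep_def)
    next
      case (3 a)
      then show ?thesis by (intro exI[of _ "{a}"]) (auto simp: sep_def)
    qed
  qed
  have down: "\<exists>E. finite E \<and> sep E A" if "A \<in> downward_rays U" for A
  proof -
    from that consider "A = U" | a where "A = U \<inter> {..a}" | a where "A = U \<inter> {..<a}"
      unfolding downward_rays_def by auto
    then show ?thesis
    proof cases
      case 1
      then show ?thesis by (intro exI[of _ "{}"]) (auto simp: sep_def)
    next
      case (2 a)
      then show ?thesis by (intro exI[of _ "{a}"]) (auto simp: sep_def)
    next
      case (3 a)
      then show ?thesis by (intro exI[of _ "{a}"]) (auto simp: sep_def)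
    qed
  qed
  have "\<exists>E. finite E \<and> sep E A" if int: "A \<in> intervals U" for A
  proof -
    from int[unfolded intervals_def mem_Collect_eq]
    obtain B C where A: "A = B \<inter> C" "B \<in> upward_rays U" "C \<in> downward_rays U"
      by (elim exE conjE)
    obtain E where E: "finite E" "sep E B" using up[OF A(2)] by auto
    obtain E' where E': "finite E'" "sep E' C" using down[OF A(3)] by auto
    have "sep (E \<union> E') A" using E(2) E'(2) unfolding sep_def A(1) by blast
    then show ?thesis using E E' by blast
  qed
  then have "\<forall>A\<in>F. \<exists>E. finite E \<and> sep E A" using F(3) by blast
  from bchoice[OF this] obtain E' where E': "\<forall>A\<in>F. finite (E' A) \<and> sep (E' A) A" by (elim exE)
  define E where "E = (\<Union>A\<in>F. E' A)"
  have fin: "finite E" using F(2) E' by (simp add: E_def)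
  have feq: "f n x = f n y" if xy: "x \<in> U" "y \<in> U" "x \<le> y" "\<forall>e\<in>E. \<not> (x \<le> e \<and> e \<le> y)" for x y
  proof -
    have "x \<in> A \<longleftrightarrow> y \<in> A" if A: "A \<in> F" for A
    proof -
      have "sep (E' A) A" using E' A by blast
      moreover have "\<forall>e\<in>E' A. \<not> (x \<le> e \<and> e \<le> y)" using xy(4) A by (auto simp: E_def)
      ultimately show ?thesis using xy(1-3) unfolding sep_def by blast
    qed
    then show ?thesis unfolding F(1) by (intro sum.cong) (auto simp: indicator_def)
  qed
  obtain p where p: "0 < p" "1 / p \<notin> U" using small_element by blast
  \<comment> \<open>The positive break points on either side of the edge of the maximal ideal;
    \<open>p\<close> and 1 make both sets nonempty.\<close>
  define I J where "I = insert p {e \<in> E. 0 < e \<and> 1 / e \<notin> U}" and "J = insert 1 {e \<in> E. 0 < e \<and> 1 / e \<in> U}"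
  have fIJ: "finite I" "finite J" "I \<noteq> {}" "J \<noteq> {}" using fin by (auto simp: I_def J_def)
  define m k where "m = Max I" and "k = Min J"
  have "m \<in> I" "k \<in> J" unfolding m_def k_def using fIJ by auto
  then have m: "0 < m" "1 / m \<notin> U" and k: "0 < k" "1 / k \<in> U"
    using p U1 by (auto simp: I_def J_def)
  \<comment> \<open>Doubling the last point below the edge and halving the first one above it does
    not cross the edge, and no break point lies between the results.\<close>
  define x y where "x = 2 * m" and "y = k / 2"
  have x0: "0 < x" and y0: "0 < y" using m k by (auto simp: x_def y_def)
  have two: "2 * z \<in> U" if "z \<in> U" for z using U_add[OF that that] by (simp only: mult_2)
  have x1: "1 / x \<notin> U"
  proof
    assume "1 / x \<in> U"
    from two[OF this] show False using m by (simp add: x_def)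
  qed
  have y1: "1 / y \<in> U" using two[OF k(2)] by (simp add: y_def)
  have "x < y"
  proof (rule ccontr)
    assume "\<not> x < y"
    then have "1 / x \<le> 1 / y" using x0 y0 by (intro divide_left_mono) auto
    then show False using U_convex[of "1 / x" "1 / y"] x0 y1 x1 by auto
  qed
  moreover have yU: "y \<in> U"
  proof -
    have "k \<le> 1" using fIJ by (simp add: k_def J_def)
    then show ?thesis using y0 by (intro U_convex[OF _ _ U1]) (auto simp: y_def)
  qed
  moreover have xU: "x \<in> U" using U_convex[of x y] x0 \<open>x < y\<close> yU by simp
  moreover have "\<not> (x \<le> e \<and> e \<le> y)" if e: "e \<in> E" for e
  proof
    assume xey: "x \<le> e \<and> e \<le> y"
    then have e0: "0 < e" using x0 by linarith
    show False
    proof (cases "1 / e \<in> U")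
      case True
      then have "e \<in> J" using e e0 by (simp add: J_def)
      then have "k \<le> e" using fIJ by (simp add: k_def)
      then show False using xey k(1) by (simp add: y_def)
    next
      case False
      then have "e \<in> I" using e e0 by (simp add: I_def)
      then have "e \<le> m" using fIJ by (simp add: m_def)
      then show False using xey m(1) by (simp add: x_def)
    qed
  qed
  ultimately have "f n x = f n y" by (intro feq) auto
  moreover have "P x = 1" "P y = 0" using Pv[OF xU] Pv[OF yU] x1 y1 y0 by auto
  moreover have "\<bar>f n x - P x\<bar> < 1 / 2" "\<bar>f n y - P y\<bar> < 1 / 2"
    using n xU yU by (auto simp: dist_real_def)
  ultimately show False by linarith
qed

end

section \<open>From valuations to convex rings with a norm\<close>

lemma valuation_Fin:
  assumes "valuation v" "x \<noteq> 0"
  obtains g where "v x = Fin g"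
  using assms unfolding valuation_def by (cases "v x") auto

lemma valuation_one:
  assumes v: "valuation v"
  shows "v 1 = 0"
proof -
  obtain g where g: "v 1 = Fin g" using valuation_Fin[OF v, of 1] by auto
  have "v (1 * 1) = v 1 + v 1" using v unfolding valuation_def by blast
  then show ?thesis by (simp add: g zero_extended_def)
qed

lemma valuation_uminus:
  assumes v: "valuation v"
  shows "v (- x) = v x"
proof -
  obtain g where g: "v (- 1) = Fin g" using valuation_Fin[OF v, of "- 1"] by auto
  have "v ((- 1) * (- 1)) = v (- 1) + v (- 1)" using v unfolding valuation_def by blast
  then have "g + g = 0" by (simp add: g valuation_one[OF v] zero_extended_def)
  then have "v (- 1) = Fin 0" by (simp add: g)
  moreover have "v ((- 1) * x) = v (- 1) + v x" using v unfolding valuation_def by blast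
  ultimately show ?thesis by (cases "v x") simp_all
qed

lemma orcmvr_normed_convex_ring:
  assumes "orcmvr v nrm"
  shows "normed_convex_ring (val_ring v) nrm"
proof -
  interpret orcmvr v nrm by (rule assms)
  have v: "valuation v" using ordered_valued by (simp add: ordered_valued_field_def)
  note vD = v[unfolded valuation_def]
  have ov: "\<forall>x y. 0 \<le> x \<and> 0 \<le> y \<longrightarrow> v (x + y) = min (v x) (v y)"
    using ordered_valued unfolding ordered_valued_field_def by (rule conjunct2)
  obtain w where w: "valuation w" "coarsens w v" "nrm = abs_val_of w" using abs_val by auto
  note wD = w(1)[unfolded valuation_def]
  have w0: "w 0 = \<infinity>" using wD by blast
  have nrm0: "nrm 0 = 0" unfolding w(3) abs_val_of_def w0 by simp
  have nrmF: "\<exists>g. w x = Fin g \<and> nrm x = exp (- g)" if x: "x \<noteq> 0" for x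
  proof -
    obtain g where g: "w x = Fin g" by (fact valuation_Fin[OF w(1) x])
    then have "nrm x = exp (- g)" by (simp add: w(3) abs_val_of_def)
    with g show ?thesis by blast
  qed
  show ?thesis
  proof
    show "real_closed TYPE('a)" by (rule real_closed)
    have "v 0 = \<infinity>" using vD by blast
    then show "0 \<in> val_ring v" by (simp add: val_ring_def)
    show "1 \<in> val_ring v" by (simp add: val_ring_def valuation_one[OF v])
    fix x y
    show "x + y \<in> val_ring v" if "x \<in> val_ring v" "y \<in> val_ring v"
    proof -
      have "0 \<le> min (v x) (v y)" using that by (simp add: val_ring_def)
      also have "\<dots> \<le> v (x + y)" using vD by blast
      finally show ?thesis by (simp add: val_ring_def)
    qed
    show "x * y \<in> val_ring v" if "x \<in> val_ring v" "y \<in> val_ring v"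
    proof -
      have "v (x * y) = v x + v y" using vD by blast
      then show ?thesis using that
        by (cases "v x"; cases "v y") (auto simp: val_ring_def zero_extended_def)
    qed
    show "- x \<in> val_ring v" if "x \<in> val_ring v"
      using that by (simp add: val_ring_def valuation_uminus[OF v])
    show "x \<in> val_ring v" if "0 \<le> x" "x \<le> y" "y \<in> val_ring v"
    proof -
      \<comment> \<open>Convexity of the valuation ring: \<open>y\<close> is the sum of the
        nonnegative elements \<open>x\<close> and \<open>y - x\<close>, so its value is at most that
        of \<open>x\<close>.\<close>
      have "v (x + (y - x)) = min (v x) (v (y - x))"
        by (rule ov[rule_format]) (use that in simp)
      then have "v y \<le> v x" by simp
      then show ?thesis using that(3) by (auto simp: val_ring_def)
    qed
    show "nrm 0 = 0" by (rule nrm0)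
    show "0 < nrm x" if "x \<noteq> 0" using nrmF[OF that] by auto
    show "nrm (x * y) = nrm x * nrm y"
    proof (cases "x = 0 \<or> y = 0")
      case False
      then have "x \<noteq> 0" "y \<noteq> 0" by auto
      from nrmF[OF this(1)] obtain a where a: "w x = Fin a" "nrm x = exp (- a)" by (elim exE conjE)
      from nrmF[OF \<open>y \<noteq> 0\<close>] obtain b where b: "w y = Fin b" "nrm y = exp (- b)" by (elim exE conjE)
      note ab = a b
      have "w (x * y) = w x + w y" using wD by blast
      then have "nrm (x * y) = exp (- (a + b))" by (simp add: w(3) abs_val_of_def ab)
      then show ?thesis by (simp add: ab exp_add[symmetric])
    qed (auto simp: nrm0)
    show "nrm x \<le> 1" if "x \<in> val_ring v"
    proof (cases "x = 0")
      case False
      obtain g where g: "w x = Fin g" "nrm x = exp (- g)" using nrmF[OF False] by blast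
      have "0 \<le> w x" using that w(2) by (auto simp: coarsens_def val_ring_def)
      then show ?thesis by (simp add: g zero_extended_def)
    qed (simp add: nrm0)
    show "\<exists>x\<in>val_ring v. x \<noteq> 0 \<and> nrm x \<noteq> 1" by (rule nontrivial)
  qed
qed

theorem theorem9p17:
  fixes v :: "'k::linordered_field \<Rightarrow> 'g::linordered_ab_group_add extended"
    and nrm :: "'k \<Rightarrow> real"
  assumes "orcmvr v nrm"
  shows "weakly_o_minimal orcmvr_sig (orcmvr_structure v nrm) \<and>
         \<not> o_minimal orcmvr_sig (orcmvr_structure v nrm)"
proof -
  interpret normed_convex_ring "val_ring v" nrm
    by (rule orcmvr_normed_convex_ring[OF assms])
  have "orcmvr_structure v nrm = M" by (simp add: orcmvr_structure_def M_def)
  then show ?thesis using weakly_o_minimal_M not_o_minimal_M by simp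
qed

end
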